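(* Let $\boldsymbol{Z}$ be the $d$-type branching process with immigration at the atoms of a $(\Lambda,K)$-determinantal point process $\Phi$, and let $\boldsymbol{Z}_\times$ be the corresponding process without immigration (both defined in the context). Let $t\ge0$ and $i,j\in\{1,\dots,d\}$. 1. We have $$\mathbb{E}[Z_i(t)]=\int_{(0,t]}K(x,x)\,\mathbb{E}[Z_{\times,i}(t-x)]\,\Lambda(\mathrm{d}x).$$ 2. If in addition all coordinates $I_k$ of $\boldsymbol{I}$ and all $(\nu_k)_l$ have finite second moments, then $$\operatorname{Cov}(Z_i(t),Z_j(t))=\int_{(0,t]}K(x,x)\,\mathbb{E}[Z_{\times,i}(t-x)Z_{\times,j}(t-x)]\,\Lambda(\mathrm{d}x)-\int_{(0,t]^2}K^2(x,y)\,\mathbb{E}[Z_{\times,i}(t-x)]\,\mathbb{E}[Z_{\times,j}(t-y)]\,\Lambda(\mathrm{d}x)\Lambda(\mathrm{d}y).$$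
   Context: Notation: $\mathbb{R}_+=[0,\infty)$, $\mathbb{N}_0=\{0,1,2,\dots\}$; $K^2(x,y)=(K(x,y))^2$. A point process is a random measure $\Phi=\sum_{i\le\kappa}\delta_{T_i}$ on $\mathbb{R}_+$ with random number $\kappa$ (possibly infinite) of random atoms $T_i\in\mathbb{R}_+$, repeated according to multiplicity. Process without immigration: $\boldsymbol{Z}_\times=(\boldsymbol{Z}_\times(t))_{t\ge0}$, with coordinates $Z_{\times,k}$, is a continuous-time $d$-type Markov branching process with random initial state $\boldsymbol{Z}_\times(0)$ distributed as $\boldsymbol{I}$, an $\mathbb{N}_0^d$-valued random vector. Particles evolve independently; a particle of type $i$ lives an exponential time with rate $1/\mu_i$ (mean $\mu_i>0$), and at death produces offspring distributed as $\boldsymbol{\nu}_i$, an $\mathbb{N}_0^d$-valued random vector whose $j$-th coordinate $(\nu_i)_j$ is the number of offspring of type $j$. Standing assumptions: all $I_i$ and $(\nu_i)_j$ have finite expectation; the total progeny $\|\boldsymbol{\nu}_i\|=\sum_j(\nu_i)_j$ is not a.s. constant for at least one $i$; the matrix $M=(\mathbb{E}[(\nu_i)_j])_{1\le i,j\le d}$ is primitive (some power has strictly positive entries); the matrix $A$ with $A_{i,j}=\mu_i^{-1}(\mathbb{E}[(\nu_i)_j]-\mathbf{1}_{\{i=j\}})$ is irreducible. Process with immigration: $\boldsymbol{Z}(t)=\sum_{i:\,T_i\in(0,t]}\boldsymbol{Z}_\times^{(i)}(t-T_i)$, where the $T_i$ are the atoms of $\Phi$ and $\boldsymbol{Z}_\times^{(i)}$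 are i.i.d. copies of $\boldsymbol{Z}_\times$, independent of $\Phi$. $Z_i$ denotes the $i$-th coordinate of $\boldsymbol{Z}$. Determinantal process: let $\Lambda$ be a locally finite measure on $\mathbb{R}_+$ and $K:\mathbb{R}_+^2\to\mathbb{R}_+$ a symmetric measurable function such that, for every $n$ and $\Lambda^n$-almost all $(x_1,\dots,x_n)$, the matrix $(K(x_i,x_j))_{1\le i,j\le n}$ is non-negative definite, and $\int_B K(x,x)\Lambda(\mathrm{d}x)<\infty$ for each bounded Borel $B\subset\mathbb{R}_+$. A point process $\Phi$ is $(\Lambda,K)$-determinantal if its joint intensities with respect to $\Lambda$ are $\rho_n(x_1,\dots,x_n)=\det(K(x_i,x_j))_{1\le i,j\le n}$, i.e. $\mathbb{E}[\prod_{i=1}^n\Phi(B_i)]=\int_{B_1\times\dots\times B_n}\rho_n\,\mathrm{d}\Lambda^n$ for disjoint Borel $B_1,\dots,B_n$. The law of $\Phi$ is the one determined by the Laplace functional $$\mathbb{E}\left[e^{-\int f\,\mathrm{d}\Phi}\right]=1+\sum_{n\ge1}\frac{(-1)^n}{n!}\int_{\mathbb{R}_+^n}\rho_n(x_1,\dots,x_n)\prod_{i=1}^n(1-e^{-f(x_i)})\Lambda(\mathrm{d}x_1)\cdots\Lambda(\mathrm{d}x_n)$$ for non-negative measurable $f$ with compact support. *)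

theory Defs
  imports "HOL-Probability.Probability" "Jordan_Normal_Form.Determinant"
begin

text \<open>
  The types \<open>1, \<dots>, d\<close> are the elements of a finite type \<open>'d\<close>, so that a vector in \<open>\<nat>\<^sub>0\<^sup>d\<close> is a function
  \<open>'d \<Rightarrow> nat\<close>. The laws of the random vectors \<open>I\<close> and \<open>\<nu>\<^sub>i\<close> are discrete distributions on such
  functions.
\<close>

definition mean_matrix :: "('d::finite \<Rightarrow> ('d \<Rightarrow> nat) pmf) \<Rightarrow> real ^ 'd ^ 'd" where
  "mean_matrix \<nu> = (\<chi> i j. measure_pmf.expectation (\<nu> i) (\<lambda>v. real (v j)))"

definition generator_matrix ::
    "('d::finite \<Rightarrow> real) \<Rightarrow> ('d \<Rightarrow> ('d \<Rightarrow> nat) pmf) \<Rightarrow> real ^ 'd ^ 'd" where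
  "generator_matrix \<mu> \<nu> =
     (\<chi> i j. (measure_pmf.expectation (\<nu> i) (\<lambda>v. real (v j)) - (if i = j then 1 else 0)) / \<mu> i)"

text \<open>
  The power is taken with respect to the matrix product \<open>**\<close> (the type class power on
  \<open>real ^ 'd ^ 'd\<close> is entrywise). The exponent has to be positive: for \<open>d = 1\<close> the zeroth power
  always has a positive entry.
\<close>

definition primitive_matrix :: "real ^ 'd ^ 'd \<Rightarrow> bool" where
  "primitive_matrix A \<longleftrightarrow>
     (\<exists>m\<ge>1. \<forall>i j. 0 < vec_nth (vec_nth ((((**) A) ^^ m) (Finite_Cartesian_Product.mat 1)) i) j)"

text \<open>
  A matrix is reducible if a simultaneous permutation of rows and columns makes it block triangular
  with two nonempty diagonal blocks. In particular every \<open>1 \<times> 1\<close> matrix is irreducible, so that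
  the critical case \<open>A = 0\<close> is included for \<open>d = 1\<close>.
\<close>

definition irreducible_matrix :: "real ^ 'd ^ 'd \<Rightarrow> bool" where
  "irreducible_matrix A \<longleftrightarrow>
     \<not> (\<exists>S. S \<noteq> {} \<and> S \<noteq> UNIV \<and> (\<forall>i\<in>S. \<forall>j\<in>- S. vec_nth (vec_nth A i) j = 0))"

definition branching_parameters ::
    "('d::finite \<Rightarrow> real) \<Rightarrow> ('d \<Rightarrow> nat) pmf \<Rightarrow> ('d \<Rightarrow> ('d \<Rightarrow> nat) pmf) \<Rightarrow> bool" where
  "branching_parameters \<mu> I \<nu> \<longleftrightarrow>
     (\<forall>i. 0 < \<mu> i) \<and>
     (\<forall>i. integrable (measure_pmf I) (\<lambda>v. real (v i))) \<and>
     (\<forall>i j. integrable (measure_pmf (\<nu> i)) (\<lambda>v. real (v j))) \<and>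
     (\<exists>i. \<not> (\<exists>c. AE v in measure_pmf (\<nu> i). (\<Sum>j\<in>UNIV. v j) = c)) \<and>
     primitive_matrix (mean_matrix \<nu>) \<and>
     irreducible_matrix (generator_matrix \<mu> \<nu>)"

definition finite_second_moments ::
    "('d::finite \<Rightarrow> nat) pmf \<Rightarrow> ('d \<Rightarrow> ('d \<Rightarrow> nat) pmf) \<Rightarrow> bool" where
  "finite_second_moments I \<nu> \<longleftrightarrow>
     (\<forall>k. integrable (measure_pmf I) (\<lambda>v. (real (v k))\<^sup>2)) \<and>
     (\<forall>k l. integrable (measure_pmf (\<nu> k)) (\<lambda>v. (real (v l))\<^sup>2))"

text \<open>
  Labels of potential particles: \<open>Root j n\<close> is the \<open>n\<close>-th initial particle of type \<open>j\<close>, and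
  \<open>Child u j n\<close> is the \<open>n\<close>-th child of type \<open>j\<close> of the particle \<open>u\<close> (counting from 0).
\<close>

datatype 'd particle = Root 'd nat | Child "'d particle" 'd nat

primrec particle_type :: "'d particle \<Rightarrow> 'd" where
  "particle_type (Root j n) = j"
| "particle_type (Child u j n) = j"

text \<open>
  A realization of the particle system is a triple \<open>(z, L, N)\<close> of the initial state, the lifetimes
  and the offspring vectors of all potential particles.
\<close>

type_synonym 'd realization = "('d \<Rightarrow> nat) \<times> ('d particle \<Rightarrow> real) \<times> ('d particle \<Rightarrow> 'd \<Rightarrow> nat)"

primrec is_born :: "('d \<Rightarrow> nat) \<Rightarrow> ('d particle \<Rightarrow> 'd \<Rightarrow> nat) \<Rightarrow> 'd particle \<Rightarrow> bool" where
  "is_born z N (Root j n) \<longleftrightarrow> n < z j"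
| "is_born z N (Child u j n) \<longleftrightarrow> is_born z N u \<and> n < N u j"

primrec birth_time :: "('d particle \<Rightarrow> real) \<Rightarrow> 'd particle \<Rightarrow> real" where
  "birth_time L (Root j n) = 0"
| "birth_time L (Child u j n) = birth_time L u + L u"

text \<open>
  The number of particles of type \<open>j\<close> alive at time \<open>t\<close>. It is a priori infinite when the process
  has exploded.
\<close>

definition population :: "real \<Rightarrow> 'd realization \<Rightarrow> 'd \<Rightarrow> enat" where
  "population t = (\<lambda>(z, L, N) j.
     (let S = {u. is_born z N u \<and> particle_type u = j \<and>
                  birth_time L u \<le> t \<and> t < birth_time L u + L u}
      in if finite S then enat (card S) else \<infinity>))"

definition particle_system ::
    "('d::finite \<Rightarrow> real) \<Rightarrow> ('d \<Rightarrow> nat) pmf \<Rightarrow> ('d \<Rightarrow> ('d \<Rightarrow> nat) pmf) \<Rightarrow> 'd realization measure" where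
  "particle_system \<mu> I \<nu> =
     measure_pmf I \<Otimes>\<^sub>M
     ((\<Pi>\<^sub>M u\<in>UNIV. density lborel (exponential_density (1 / \<mu> (particle_type u)))) \<Otimes>\<^sub>M
      (\<Pi>\<^sub>M u\<in>UNIV. measure_pmf (\<nu> (particle_type u))))"

definition path_space :: "(real \<Rightarrow> 'd \<Rightarrow> 'n) measure" where
  "path_space = (\<Pi>\<^sub>M t\<in>{0..}. count_space UNIV)"

definition path :: "(real \<Rightarrow> 'a \<Rightarrow> 'd \<Rightarrow> 'n) \<Rightarrow> 'a \<Rightarrow> real \<Rightarrow> 'd \<Rightarrow> 'n" where
  "path Z \<omega> = (\<lambda>t\<in>{0..}. Z t \<omega>)"

definition jump_process :: "'a measure \<Rightarrow> (real \<Rightarrow> 'a \<Rightarrow> 'd \<Rightarrow> nat) \<Rightarrow> bool" where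
  "jump_process M Z \<longleftrightarrow>
     (\<forall>t\<ge>0. Z t \<in> measurable M (count_space UNIV)) \<and>
     (\<forall>\<omega>\<in>space M. \<forall>t\<ge>0. \<forall>\<^sub>F s in at_right t. Z s \<omega> = Z t \<omega>)"

text \<open>
  The process has the law of the population counts of the particle system. As \<open>population\<close> takes
  values in \<open>enat\<close>, so does the law; under the standing assumptions explosion has
  probability 0 and a version with values in \<open>\<nat>\<^sub>0\<^sup>d\<close> exists.
\<close>

definition branching_process ::
    "('d::finite \<Rightarrow> real) \<Rightarrow> ('d \<Rightarrow> nat) pmf \<Rightarrow> ('d \<Rightarrow> ('d \<Rightarrow> nat) pmf) \<Rightarrow>
     'a measure \<Rightarrow> (real \<Rightarrow> 'a \<Rightarrow> 'd \<Rightarrow> nat) \<Rightarrow> bool" where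
  "branching_process \<mu> I \<nu> M Z \<longleftrightarrow>
     jump_process M Z \<and>
     distr M path_space (path (\<lambda>t \<omega> j. enat (Z t \<omega> j))) =
     distr (particle_system \<mu> I \<nu>) path_space (path population)"

abbreviation borel_nonneg :: "real measure" where
  "borel_nonneg \<equiv> restrict_space borel {0..}"

text \<open>
  A point process with \<open>\<kappa>\<close> atoms \<open>T 0, T 1, \<dots>\<close> in \<open>[0, \<infinity>)\<close>. The values \<open>T i \<omega>\<close> with \<open>i \<ge> \<kappa> \<omega>\<close> are
  irrelevant.
\<close>

definition point_process :: "'a measure \<Rightarrow> ('a \<Rightarrow> enat) \<Rightarrow> (nat \<Rightarrow> 'a \<Rightarrow> real) \<Rightarrow> bool" where
  "point_process M \<kappa> T \<longleftrightarrow>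
     \<kappa> \<in> measurable M (count_space UNIV) \<and>
     (\<forall>i. T i \<in> borel_measurable M) \<and>
     (\<forall>\<omega>\<in>space M. \<forall>i. enat i < \<kappa> \<omega> \<longrightarrow> 0 \<le> T i \<omega>)"

text \<open>The random measure \<open>\<Sum>i<\<kappa>. \<delta>(T i)\<close>, as the image of the counting measure on the indices.\<close>

definition point_measure_of :: "('a \<Rightarrow> enat) \<Rightarrow> (nat \<Rightarrow> 'a \<Rightarrow> real) \<Rightarrow> 'a \<Rightarrow> real measure" where
  "point_measure_of \<kappa> T \<omega> = distr (count_space {i. enat i < \<kappa> \<omega>}) borel_nonneg (\<lambda>i. T i \<omega>)"

definition correlation :: "(real \<Rightarrow> real \<Rightarrow> real) \<Rightarrow> nat \<Rightarrow> (nat \<Rightarrow> real) \<Rightarrow> real" where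
  "correlation K n x = Determinant.det (Matrix.mat n n (\<lambda>(a, b). K (x a) (x b)))"

definition determinantal_kernel :: "real measure \<Rightarrow> (real \<Rightarrow> real \<Rightarrow> real) \<Rightarrow> bool" where
  "determinantal_kernel \<Lambda> K \<longleftrightarrow>
     sets \<Lambda> = sets borel_nonneg \<and>
     (\<forall>B\<in>sets \<Lambda>. bounded B \<longrightarrow> emeasure \<Lambda> B < \<infinity>) \<and>
     (\<lambda>(x, y). K x y) \<in> borel_measurable (borel_nonneg \<Otimes>\<^sub>M borel_nonneg) \<and>
     (\<forall>x\<ge>0. \<forall>y\<ge>0. 0 \<le> K x y \<and> K x y = K y x) \<and>
     (\<forall>n. AE x in (\<Pi>\<^sub>M a\<in>{..<n}. \<Lambda>).
        \<forall>c :: nat \<Rightarrow> real. 0 \<le> (\<Sum>a<n. \<Sum>b<n. c a * K (x a) (x b) * c b)) \<and>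
     (\<forall>B\<in>sets \<Lambda>. bounded B \<longrightarrow> (\<integral>\<^sup>+x\<in>B. ennreal (K x x) \<partial>\<Lambda>) < \<infinity>)"

definition exp_neg :: "ennreal \<Rightarrow> real" where
  "exp_neg a = (if a = \<infinity> then 0 else exp (- enn2real a))"

text \<open>
  The joint intensities only concern disjoint sets and hence do not see multiplicities of atoms
  of the process; the law is pinned down by the Laplace functional. For a kernel as above,
  \<open>correlation K n\<close> is nonnegative almost everywhere, so \<open>ennreal\<close> does not truncate it.
\<close>

definition determinantal_process ::
    "real measure \<Rightarrow> (real \<Rightarrow> real \<Rightarrow> real) \<Rightarrow> 'a measure \<Rightarrow> ('a \<Rightarrow> enat) \<Rightarrow> (nat \<Rightarrow> 'a \<Rightarrow> real) \<Rightarrow> bool" where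
  "determinantal_process \<Lambda> K M \<kappa> T \<longleftrightarrow>
     point_process M \<kappa> T \<and>
     (\<forall>n B. (\<forall>a<n. B a \<in> sets borel_nonneg) \<longrightarrow> disjoint_family_on B {..<n} \<longrightarrow>
        (\<integral>\<^sup>+\<omega>. (\<Prod>a<n. emeasure (point_measure_of \<kappa> T \<omega>) (B a)) \<partial>M) =
        (\<integral>\<^sup>+x\<in>Pi\<^sub>E {..<n} B. ennreal (correlation K n x) \<partial>(\<Pi>\<^sub>M a\<in>{..<n}. \<Lambda>))) \<and>
     (\<forall>f\<in>borel_measurable borel_nonneg. (\<forall>x\<ge>0. 0 \<le> f x) \<longrightarrow> (\<exists>b. \<forall>x>b. f x = 0) \<longrightarrow>
        (\<lambda>m. let n = Suc m in
           (- 1) ^ n / fact n *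
           (\<integral>x. correlation K n x * (\<Prod>a<n. 1 - exp (- f (x a))) \<partial>(\<Pi>\<^sub>M a\<in>{..<n}. \<Lambda>)))
        sums ((\<integral>\<omega>. exp_neg (\<integral>\<^sup>+x. ennreal (f x) \<partial>point_measure_of \<kappa> T \<omega>) \<partial>M) - 1))"

definition iid_copies ::
    "'b measure \<Rightarrow> (real \<Rightarrow> 'b \<Rightarrow> 'd \<Rightarrow> nat) \<Rightarrow> 'a measure \<Rightarrow> (nat \<Rightarrow> real \<Rightarrow> 'a \<Rightarrow> 'd \<Rightarrow> nat) \<Rightarrow> bool" where
  "iid_copies M' Zx M C \<longleftrightarrow>
     (\<forall>k. jump_process M (C k) \<and>
          distr M path_space (path (C k)) = distr M' path_space (path Zx)) \<and>
     prob_space.indep_vars M (\<lambda>_. path_space) (\<lambda>k. path (C k)) UNIV"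

text \<open>
  The copies are independent of the sequence of atoms and not just of the random measure: otherwise
  the enumeration of the atoms could depend on the copies.
\<close>

definition independent_of_atoms ::
    "'a measure \<Rightarrow> ('a \<Rightarrow> enat) \<Rightarrow> (nat \<Rightarrow> 'a \<Rightarrow> real) \<Rightarrow> (nat \<Rightarrow> real \<Rightarrow> 'a \<Rightarrow> 'd \<Rightarrow> nat) \<Rightarrow> bool" where
  "independent_of_atoms M \<kappa> T C \<longleftrightarrow>
     prob_space.indep_set M
       (sets (vimage_algebra (space M) (\<lambda>\<omega>. (\<kappa> \<omega>, \<lambda>i. if enat i < \<kappa> \<omega> then T i \<omega> else 0))
          (count_space UNIV \<Otimes>\<^sub>M (\<Pi>\<^sub>M i\<in>UNIV. borel))))
       (sets (vimage_algebra (space M) (\<lambda>\<omega> k. path (C k) \<omega>) (\<Pi>\<^sub>M k\<in>UNIV. path_space)))"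

definition immigration_process ::
    "('a \<Rightarrow> enat) \<Rightarrow> (nat \<Rightarrow> 'a \<Rightarrow> real) \<Rightarrow> (nat \<Rightarrow> real \<Rightarrow> 'a \<Rightarrow> 'd \<Rightarrow> nat) \<Rightarrow>
     real \<Rightarrow> 'a \<Rightarrow> 'd \<Rightarrow> ennreal" where
  "immigration_process \<kappa> T C t \<omega> j =
     (\<Sum>k. if enat k < \<kappa> \<omega> \<and> T k \<omega> \<in> {0<..t} then of_nat (C k (t - T k \<omega>) \<omega> j) else 0)"

definition covariance :: "'a measure \<Rightarrow> ('a \<Rightarrow> real) \<Rightarrow> ('a \<Rightarrow> real) \<Rightarrow> real" where
  "covariance M X Y =
     (\<integral>\<omega>. (X \<omega> - integral\<^sup>L M X) * (Y \<omega> - integral\<^sup>L M Y) \<partial>M)"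

end

theory Submission
  imports Defs
begin

text \<open>
  Write \<open>Z\<^sub>i(t)\<close> as a sum over the atoms \<open>T\<^sub>k\<close> in \<open>(0, t]\<close> of the sizes of the independent copies at
  time \<open>t - T\<^sub>k\<close>. Conditioning on the atoms turns the first moment into an integral with respect to the
  intensity measure, and the second moment into such an integral (equal indices) plus an integral
  with respect to the second factorial moment measure (distinct indices). The density of the latter is
  \<open>K(x,x) K(y,y) - K(x,y)\<^sup>2\<close>; its first part integrates to the product of the means. Since the joint
  intensities only concern disjoint sets, the factorial moment measure on squares \<open>D \<times> D\<close> is
  obtained from the Laplace functional of \<open>- ln (1 - u) 1\<^sub>D\<close>, whose expansion in \<open>u\<close> has the factorial
  moments of \<open>\<Phi>(D)\<close> as coefficients.

  The moments of the branching process are bounded on \<open>[0, t]\<close> by weighting each particle with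
  \<open>exp (- \<theta> b)\<close>, where \<open>b\<close> is its birth time. For large \<open>\<theta>\<close> the first two moments of the weight of the
  \<open>n\<close>-th generation decay geometrically in \<open>n\<close>.
\<close>

section \<open>Moments of the branching process\<close>

text \<open>All moment identities are proved for integrals with values in
  \<open>[0, \<infinity>]\<close>, where sums, expectations and integrals commute without
  integrability conditions. As subtraction is awkward there, the negative term of the covariance is
  kept on the other side of an equation: it is what has to be added to the pair integral to give the
  product of the means. Real integrals return only at the end, and for that every quantity must be
  finite, which is what the moment bounds for the branching process serve. These bounds come from
  the family tree and not from a semigroup: the law is given by population counts that might a
  priori be infinite, and discounting controls all generations at once, because the Laplace
  transform of an exponential lifetime tends to 0 as \<theta> grows and so beats any finite
  offspring moment. On the side of the point process the expansion in \<open>u\<close> is only known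
  for \<open>0 < u < 1\<close>; its second coefficient is extracted by a limit at 0, with Fatou and
  monotonicity in place of differentiation under the expectation.\<close>

instance particle :: (countable) countable
  by countable_datatype

section \<open>Tonelli for countable sums, and resampling one coordinate of a product
  measure\<close>

lemma nn_integral_count_space_commute:
  fixes f :: "'c \<Rightarrow> 'a \<Rightarrow> ennreal"
  assumes "sigma_finite_measure M" "countable S" and [measurable]: "\<And>u. u \<in> S \<Longrightarrow> f u \<in> borel_measurable M"
  shows "(\<integral>\<^sup>+\<omega>. (\<integral>\<^sup>+u. f u \<omega> \<partial>count_space S) \<partial>M) = (\<integral>\<^sup>+u. (\<integral>\<^sup>+\<omega>. f u \<omega> \<partial>M) \<partial>count_space S)"
proof -
  interpret A: sigma_finite_measure "count_space S"
    using assms by (intro sigma_finite_measure_count_space_countable)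
  interpret B: sigma_finite_measure M by fact
  interpret pair_sigma_finite "count_space S" M ..
  have "case_prod f \<in> borel_measurable (count_space S \<Otimes>\<^sub>M M)"
    by (rule measurable_pair_measure_countable1) (use assms in auto)
  from Fubini'[OF this] show ?thesis by simp
qed

lemma borel_measurable_nn_integral_count_space:
  fixes f :: "'c \<Rightarrow> 'a \<Rightarrow> ennreal"
  assumes "countable S" "\<And>u. u \<in> S \<Longrightarrow> f u \<in> borel_measurable M"
  shows "(\<lambda>\<omega>. \<integral>\<^sup>+u. f u \<omega> \<partial>count_space S) \<in> borel_measurable M"
proof -
  interpret A: sigma_finite_measure "count_space S"
    using assms by (intro sigma_finite_measure_count_space_countable)
  have "(\<lambda>(\<omega>, u). f u \<omega>) \<in> borel_measurable (M \<Otimes>\<^sub>M count_space S)"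
    by (subst measurable_pair_swap_iff)
       (rule measurable_pair_measure_countable1, use assms in auto)
  from A.borel_measurable_nn_integral_fst[OF this] show ?thesis by simp
qed

text \<open>Replacing coordinate \<open>u\<close> by an independent copy does not change the product
  law. As \<open>F\<close> does not see this coordinate, the integral over the new value splits off.
  The index set is infinite, so no finite product formula applies.\<close>

lemma nn_integral_PiM_coordinate:
  fixes Mi :: "'c \<Rightarrow> 'a measure" and F :: "('c \<Rightarrow> 'a) \<Rightarrow> ennreal"
  assumes P: "\<And>i. prob_space (Mi i)"
    and [measurable]: "F \<in> borel_measurable (\<Pi>\<^sub>M i\<in>UNIV. Mi i)" "G \<in> borel_measurable (Mi u)"
    and inv: "\<And>X x. F (X(u := x)) = F X"
  shows "(\<integral>\<^sup>+X. F X * G (X u) \<partial>(\<Pi>\<^sub>M i\<in>UNIV. Mi i)) =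
    (\<integral>\<^sup>+X. F X \<partial>(\<Pi>\<^sub>M i\<in>UNIV. Mi i)) * (\<integral>\<^sup>+x. G x \<partial>Mi u)"
proof -
  interpret U: prob_space "Mi u" by (rule P)
  interpret Q: prob_space "\<Pi>\<^sub>M i\<in>UNIV. Mi i" by (intro prob_space_PiM P)
  interpret pair_sigma_finite "Mi u" "\<Pi>\<^sub>M i\<in>UNIV. Mi i" ..
  have upd[measurable]: "(\<lambda>(x, X). X(u := x)) \<in> Mi u \<Otimes>\<^sub>M (\<Pi>\<^sub>M i\<in>UNIV. Mi i) \<rightarrow>\<^sub>M (\<Pi>\<^sub>M i\<in>UNIV. Mi i)"
    using measurable_fun_upd[of UNIV UNIV u "\<lambda>(x, X). X" "Mi u \<Otimes>\<^sub>M (\<Pi>\<^sub>M i\<in>UNIV. Mi i)" Mi fst]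
    by (simp add: split_beta')
  have "(\<Pi>\<^sub>M i\<in>UNIV. Mi i) =
      distr (Mi u \<Otimes>\<^sub>M (\<Pi>\<^sub>M i\<in>UNIV. Mi i)) (\<Pi>\<^sub>M i\<in>UNIV. Mi i) (\<lambda>(x, X). X(u := x))"
    using distr_pair_PiM_eq_PiM[of UNIV Mi u] P by simp
  then have "(\<integral>\<^sup>+X. F X * G (X u) \<partial>(\<Pi>\<^sub>M i\<in>UNIV. Mi i)) =
     (\<integral>\<^sup>+X. F X * G (X u) \<partial>distr (Mi u \<Otimes>\<^sub>M (\<Pi>\<^sub>M i\<in>UNIV. Mi i)) (\<Pi>\<^sub>M i\<in>UNIV. Mi i) (\<lambda>(x, X). X(u := x)))"
    by simp
  also have "\<dots> = (\<integral>\<^sup>+p. F (snd p) * G (fst p) \<partial>(Mi u \<Otimes>\<^sub>M (\<Pi>\<^sub>M i\<in>UNIV. Mi i)))"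
    by (subst nn_integral_distr) (auto simp: split_beta' inv)
  also have "\<dots> = (\<integral>\<^sup>+x. (\<integral>\<^sup>+X. F X * G x \<partial>(\<Pi>\<^sub>M i\<in>UNIV. Mi i)) \<partial>Mi u)"
    by (subst Q.nn_integral_fst[symmetric]) auto
  also have "\<dots> = (\<integral>\<^sup>+X. F X \<partial>(\<Pi>\<^sub>M i\<in>UNIV. Mi i)) * (\<integral>\<^sup>+x. G x \<partial>Mi u)"
    by (simp add: nn_integral_multc nn_integral_cmult)
  finally show ?thesis .
qed

section \<open>Discounted generations of the family tree\<close>

primrec generation :: "'d particle \<Rightarrow> nat" where
  "generation (Root j n) = 0"
| "generation (Child u j n) = Suc (generation u)"

definition discount :: "real \<Rightarrow> 'd realization \<Rightarrow> 'd particle \<Rightarrow> ennreal" where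
  "discount \<theta> = (\<lambda>(z, L, N) u. of_bool (is_born z N u) * ennreal (exp (- \<theta> * birth_time L u)))"

text \<open>This is the Laplace transform at \<theta> of the reproduction point process of
  \<open>u\<close>: all children are born at once, at the age \<open>L u\<close> at which
  \<open>u\<close> dies.\<close>

definition reproduction :: "real \<Rightarrow> 'd::finite realization \<Rightarrow> 'd particle \<Rightarrow> ennreal" where
  "reproduction \<theta> = (\<lambda>(z, L, N) u. ennreal (exp (- \<theta> * L u)) * of_nat (\<Sum>j\<in>UNIV. N u j))"

definition discounted_generation :: "real \<Rightarrow> nat \<Rightarrow> 'd::finite realization \<Rightarrow> ennreal" where
  "discounted_generation \<theta> n \<omega> = (\<integral>\<^sup>+u. discount \<theta> \<omega> u \<partial>count_space {u. generation u = n})"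

text \<open>Birth of \<open>v\<close> is decided by the offspring vectors of its strict ancestors.
  Their generations are smaller than that of \<open>v\<close>, so \<open>u\<close> is none of
  them.\<close>

lemma is_born_upd: "generation v \<le> generation u \<Longrightarrow> is_born z (N(u := y)) v = is_born z N v"
  by (induction v) auto

lemma birth_time_upd: "generation v \<le> generation u \<Longrightarrow> birth_time (L(u := x)) v = birth_time L v"
  by (induction v) auto

lemma nn_integral_less_nat: "(\<integral>\<^sup>+m. of_bool (m < (k::nat)) \<partial>count_space UNIV) = of_nat k"
proof -
  have "(\<integral>\<^sup>+m. of_bool (m < k) \<partial>count_space UNIV) = (\<Sum>m<k. of_bool (m < k) :: ennreal)"
    by (intro nn_integral_count_space') auto
  then show ?thesis by simp
qed

text \<open>A particle of positive generation determines its parent, its type and its rank among the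
  siblings of that type, so \<open>Child\<close> is a bijection onto the next generation.\<close>

lemma nn_integral_count_space_generation_Suc:
  "(\<integral>\<^sup>+v. g v \<partial>count_space {v. generation v = Suc n}) =
   (\<integral>\<^sup>+u. (\<integral>\<^sup>+j. (\<integral>\<^sup>+m. g (Child u j m) \<partial>count_space UNIV) \<partial>count_space UNIV)
      \<partial>count_space {u. generation u = n})"
proof -
  have *: "bij_betw (\<lambda>(u, j, m). Child u j m) ({u. generation u = n} \<times> UNIV \<times> UNIV) {v. generation v = Suc n}"
    unfolding bij_betw_def
  proof
    show "(\<lambda>(u, j, m). Child u j m) ` ({u. generation u = n} \<times> UNIV \<times> UNIV) = {v. generation v = Suc n}"
    proof (intro equalityI subsetI)
      fix v assume "v \<in> {v. generation v = Suc n}"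
      then show "v \<in> (\<lambda>(u, j, m). Child u j m) ` ({u. generation u = n} \<times> UNIV \<times> UNIV)"
        by (cases v) (auto simp: image_iff)
    qed auto
  qed (auto simp: inj_on_def)
  have "(\<integral>\<^sup>+v. g v \<partial>count_space {v. generation v = Suc n}) =
     (\<integral>\<^sup>+p. g (case p of (u, j, m) \<Rightarrow> Child u j m) \<partial>count_space ({u. generation u = n} \<times> UNIV \<times> UNIV))"
    by (rule nn_integral_bij_count_space[OF *, symmetric])
  also have "\<dots> = (\<integral>\<^sup>+p. (case p of (u, j, m) \<Rightarrow> of_bool (generation u = n) * g (Child u j m)) \<partial>count_space UNIV)"
    by (subst nn_integral_count_space_indicator) (auto intro!: nn_integral_cong split: prod.splits simp: indicator_def)
  also have "\<dots> = (\<integral>\<^sup>+u. (\<integral>\<^sup>+j. (\<integral>\<^sup>+m. of_bool (generation u = n) * g (Child u j m) \<partial>count_space UNIV) \<partial>count_space UNIV) \<partial>count_space UNIV)"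
    by (simp add: nn_integral_fst_count_space[symmetric])
  also have "\<dots> = (\<integral>\<^sup>+u. (\<integral>\<^sup>+j. (\<integral>\<^sup>+m. g (Child u j m) \<partial>count_space UNIV) \<partial>count_space UNIV) \<partial>count_space {u. generation u = n})"
    by (subst (2) nn_integral_count_space_indicator)
       (auto intro!: nn_integral_cong simp: indicator_def)
  finally show ?thesis .
qed

text \<open>A child inherits the weight of its parent times \<open>exp (- \<theta> * L u)\<close>,
  and exactly \<open>N u j\<close> children of type \<open>j\<close> are born. The sum over all
  children of \<open>u\<close> is therefore a product of a term decided at the birth of
  \<open>u\<close> and one decided by the life of \<open>u\<close>.\<close>

lemma discounted_generation_Suc:
  "discounted_generation \<theta> (Suc n) \<omega> =
   (\<integral>\<^sup>+u. discount \<theta> \<omega> u * reproduction \<theta> \<omega> u \<partial>count_space {u. generation u = n})"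
proof -
  obtain z L N where \<omega>: "\<omega> = (z, L, N)" by (cases \<omega>)
  have "(\<integral>\<^sup>+j. (\<integral>\<^sup>+m. discount \<theta> \<omega> (Child u j m) \<partial>count_space UNIV) \<partial>count_space UNIV) =
      discount \<theta> \<omega> u * reproduction \<theta> \<omega> u" for u
  proof -
    have "(\<integral>\<^sup>+m. discount \<theta> \<omega> (Child u j m) \<partial>count_space UNIV) =
       (\<integral>\<^sup>+m. (discount \<theta> \<omega> u * ennreal (exp (- \<theta> * L u))) * of_bool (m < N u j) \<partial>count_space UNIV)" for j
      by (auto intro!: nn_integral_cong simp: discount_def \<omega> ennreal_mult[symmetric] exp_add[symmetric] algebra_simps)
    also have "\<dots> j = (discount \<theta> \<omega> u * ennreal (exp (- \<theta> * L u))) * of_nat (N u j)" for j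
      by (subst nn_integral_cmult) (auto simp: nn_integral_less_nat)
    finally show ?thesis
      by (subst nn_integral_count_space_finite)
         (auto simp: reproduction_def \<omega> sum_distrib_left mult.assoc)
  qed
  then show ?thesis
    unfolding discounted_generation_def nn_integral_count_space_generation_Suc by simp
qed

lemma nn_integral_count_space_generation_UNIV:
  "(\<integral>\<^sup>+u. g u \<partial>count_space UNIV) = (\<Sum>n. \<integral>\<^sup>+u. g u \<partial>count_space {u. generation u = n})"
proof -
  have "(\<integral>\<^sup>+u. g u \<partial>count_space UNIV) =
     (\<integral>\<^sup>+u. (\<Sum>n. g u * of_bool (generation u = n)) \<partial>count_space UNIV)"
  proof (intro nn_integral_cong)
    fix u
    have "(\<Sum>n. g u * of_bool (generation u = n)) = (\<Sum>n\<in>{generation u}. g u * of_bool (generation u = n))"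
      by (rule suminf_finite) auto
    then show "g u = (\<Sum>n. g u * of_bool (generation u = n))" by simp
  qed
  also have "\<dots> = (\<Sum>n. \<integral>\<^sup>+u. g u * of_bool (generation u = n) \<partial>count_space UNIV)"
    by (rule nn_integral_suminf) auto
  also have "\<dots> = (\<Sum>n. \<integral>\<^sup>+u. g u \<partial>count_space {u. generation u = n})"
    by (intro suminf_cong, subst (2) nn_integral_count_space_indicator)
       (auto intro!: nn_integral_cong simp: indicator_def)
  finally show ?thesis .
qed

lemma discounted_generation_0:
  "discounted_generation \<theta> 0 (z :: 'd::finite \<Rightarrow> nat, L, N) = of_nat (\<Sum>j\<in>UNIV. z j)"
proof -
  have *: "bij_betw (\<lambda>(j, m). Root j m) UNIV {u :: 'd particle. generation u = 0}"
    unfolding bij_betw_def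
  proof
    show "range (\<lambda>(j, m). Root j m) = {u :: 'd particle. generation u = 0}"
    proof (intro equalityI subsetI)
      fix u :: "'d particle" assume "u \<in> {u. generation u = 0}"
      then show "u \<in> range (\<lambda>(j, m). Root j m)" by (cases u) (auto simp: image_iff)
    qed auto
  qed (auto simp: inj_on_def)
  have "discounted_generation \<theta> 0 (z, L, N) =
      (\<integral>\<^sup>+p. discount \<theta> (z, L, N) (case p of (j, m) \<Rightarrow> Root j m) \<partial>count_space UNIV)"
    unfolding discounted_generation_def by (rule nn_integral_bij_count_space[OF *, symmetric])
  also have "\<dots> = (\<integral>\<^sup>+j. \<integral>\<^sup>+m. of_bool (m < z j) \<partial>count_space UNIV \<partial>count_space UNIV)"
    by (subst nn_integral_fst_count_space[symmetric]) (simp add: discount_def)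
  finally show ?thesis
    by (simp add: nn_integral_less_nat nn_integral_count_space_finite)
qed

lemma discount_upd_lifetime:
  "generation v \<le> generation u \<Longrightarrow> discount \<theta> (z, L(u := x), N) v = discount \<theta> (z, L, N) v"
  by (simp add: discount_def birth_time_upd)

lemma discount_upd_offspring:
  "generation v \<le> generation u \<Longrightarrow> discount \<theta> (z, L, N(u := y)) v = discount \<theta> (z, L, N) v"
  by (simp add: discount_def is_born_upd)

lemma ennreal_of_enat_population:
  "ennreal_of_enat (population s (z, L, N) j) = (\<integral>\<^sup>+u. of_bool (is_born z N u \<and> particle_type u = j \<and>
    birth_time L u \<le> s \<and> s < birth_time L u + L u) \<partial>count_space UNIV)"
proof -
  let ?S = "{u. is_born z N u \<and> particle_type u = j \<and> birth_time L u \<le> s \<and> s < birth_time L u + L u}"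
  have "ennreal_of_enat (population s (z, L, N) j) = emeasure (count_space UNIV) ?S"
    unfolding population_def by (auto simp: emeasure_count_space)
  also have "\<dots> = (\<integral>\<^sup>+u. indicator ?S u \<partial>count_space UNIV)" by simp
  also have "\<dots> = (\<integral>\<^sup>+u. of_bool (is_born z N u \<and> particle_type u = j \<and>
    birth_time L u \<le> s \<and> s < birth_time L u + L u) \<partial>count_space UNIV)"
    by (rule nn_integral_cong) (auto simp: indicator_def)
  finally show ?thesis .
qed

text \<open>A Chernoff-type bound: whoever is alive at time \<open>s\<close> was born by time
  \<open>t\<close>, so its weight is at least \<open>exp (- \<theta> * t)\<close>.\<close>

lemma population_le_discounted:
  assumes "0 \<le> \<theta>" "s \<le> t"
  shows "ennreal_of_enat (population s \<omega> j) \<le> ennreal (exp (\<theta> * t)) * (\<Sum>n. discounted_generation \<theta> n \<omega>)"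
proof -
  obtain z L N where \<omega>: "\<omega> = (z, L, N)" by (cases \<omega>)
  let ?alive = "\<lambda>u. is_born z N u \<and> particle_type u = j \<and> birth_time L u \<le> s \<and> s < birth_time L u + L u"
  have "ennreal_of_enat (population s \<omega> j) = (\<integral>\<^sup>+u. of_bool (?alive u) \<partial>count_space UNIV)"
    unfolding \<omega> by (rule ennreal_of_enat_population)
  also have "\<dots> \<le> (\<integral>\<^sup>+u. ennreal (exp (\<theta> * t)) * discount \<theta> \<omega> u \<partial>count_space UNIV)"
  proof (rule nn_integral_mono)
    fix u
    have "1 \<le> ennreal (exp (\<theta> * t)) * ennreal (exp (- \<theta> * birth_time L u))" if "birth_time L u \<le> s"
    proof -
      have "\<theta> * birth_time L u \<le> \<theta> * t" using assms that by (intro mult_left_mono) auto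
      then show ?thesis
        by (simp add: ennreal_mult[symmetric] exp_add[symmetric])
    qed
    then show "of_bool (?alive u) \<le> ennreal (exp (\<theta> * t)) * discount \<theta> \<omega> u"
      by (auto simp: discount_def \<omega>)
  qed
  also have "\<dots> = ennreal (exp (\<theta> * t)) * (\<Sum>n. discounted_generation \<theta> n \<omega>)"
    by (simp add: nn_integral_cmult nn_integral_count_space_generation_UNIV discounted_generation_def)
  finally show ?thesis .
qed

section \<open>Inequalities for squares of sums\<close>

lemma square_nn_integral_count_space:
  fixes f :: "'c \<Rightarrow> ennreal"
  shows "(\<integral>\<^sup>+u. f u \<partial>count_space S)\<^sup>2 = (\<integral>\<^sup>+u. \<integral>\<^sup>+v. f u * f v \<partial>count_space S \<partial>count_space S)"
  by (simp add: nn_integral_cmult nn_integral_multc power2_eq_square)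

lemma mult_le_squares_ennreal: "a * b \<le> a\<^sup>2 + b\<^sup>2" for a b :: ennreal
proof (cases "a \<le> b")
  case True
  then have "a * b \<le> b\<^sup>2" by (simp add: power2_eq_square mult_right_mono)
  then show ?thesis using add_increasing[of "a\<^sup>2"] by simp
next
  case False
  then have "a * b \<le> a\<^sup>2" by (simp add: power2_eq_square mult_left_mono)
  then show ?thesis using add_increasing2[of "b\<^sup>2"] by simp
qed

lemma suminf_geometric_ennreal: "0 \<le> x \<Longrightarrow> x < 1 \<Longrightarrow> (\<Sum>n. ennreal x ^ n) = ennreal (1 / (1 - x))"
  by (simp add: ennreal_power suminf_ennreal2 summable_geometric suminf_geometric)

lemma suminf_half_power_mult: "(\<Sum>n. ennreal (1 / 2) ^ n * m) = 2 * m"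
proof -
  have *: "(\<Sum>n. ennreal (1 / 2) ^ n) = ennreal 2"
    by (subst suminf_geometric_ennreal) auto
  have "(\<Sum>n. ennreal (1 / 2) ^ n * m) = (\<Sum>n. ennreal (1 / 2) ^ n) * m"
    by (rule ennreal_suminf_multc)
  then show ?thesis by (simp only: *) simp
qed

text \<open>Cauchy-Schwarz for the factorization of \<open>X n\<close> into \<open>(1/2)^n\<close>
  and \<open>2^n * X n\<close>; the squares of the first factors sum to 4/3, which is rounded up to
  2. The weight \<open>4 ^ n\<close> is the price that the decay of the second moments has to
  pay.\<close>

lemma Cauchy_Schwarz_geometric:
  fixes X :: "nat \<Rightarrow> ennreal"
  shows "(\<Sum>n. X n)\<^sup>2 \<le> 2 * (\<Sum>n. 4 ^ n * (X n)\<^sup>2)"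
proof -
  have h: "ennreal (1 / 2) ^ n * 2 ^ n = 1" for n
  proof -
    have "ennreal (1 / 2) * 2 = ennreal (1 / 2 * 2)"
      by (subst ennreal_mult) auto
    then have "ennreal (1 / 2) * 2 = 1" by simp
    then show ?thesis by (simp flip: power_mult_distrib)
  qed
  have "(\<Sum>n. X n) = (\<integral>\<^sup>+n. ennreal (1 / 2) ^ n * (2 ^ n * X n) \<partial>count_space UNIV)"
  proof -
    have "ennreal (1 / 2) ^ n * (2 ^ n * X n) = X n" for n
      by (metis h mult.assoc mult_1)
    then show ?thesis by (simp only: nn_integral_count_space_nat)
  qed
  also have "\<dots>\<^sup>2 \<le> (\<integral>\<^sup>+n. (ennreal (1 / 2) ^ n)\<^sup>2 \<partial>count_space UNIV) * (\<integral>\<^sup>+n. (2 ^ n * X n)\<^sup>2 \<partial>count_space UNIV)"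
    by (rule Cauchy_Schwarz_nn_integral) auto
  also have "(\<integral>\<^sup>+n. (ennreal (1 / 2) ^ n)\<^sup>2 \<partial>count_space UNIV) = (\<Sum>n. ennreal (1 / 4) ^ n)"
  proof -
    have "(ennreal (1 / 2) ^ n)\<^sup>2 = ((ennreal (1 / 2))\<^sup>2) ^ n" for n
      by (metis power_mult mult.commute)
    moreover have "(ennreal (1 / 2))\<^sup>2 = ennreal ((1 / 2)\<^sup>2)"
      by (rule ennreal_power) simp
    then have "(ennreal (1 / 2))\<^sup>2 = ennreal (1 / 4)"
      by (simp only: power2_eq_square) simp
    ultimately show ?thesis by (simp only: nn_integral_count_space_nat)
  qed
  also have "\<dots> = ennreal (4 / 3)" by (subst suminf_geometric_ennreal) auto
  also have "\<dots> \<le> 2" by (simp flip: ennreal_numeral)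
  also have "(\<integral>\<^sup>+n. (2 ^ n * X n)\<^sup>2 \<partial>count_space UNIV) = (\<Sum>n. 4 ^ n * (X n)\<^sup>2)"
    by (simp add: nn_integral_count_space_nat power_mult_distrib power_mult[symmetric] mult.commute[of _ 2])
       (simp add: power_mult)
  finally show ?thesis by (simp add: mult_right_mono)
qed

section \<open>Expectations over the particle system\<close>

context
  fixes \<mu> :: "'d::finite \<Rightarrow> real" and I :: "('d \<Rightarrow> nat) pmf" and \<nu> :: "'d \<Rightarrow> ('d \<Rightarrow> nat) pmf"
  assumes \<mu>_pos: "\<And>i. 0 < \<mu> i"
begin

abbreviation (input) "lifetime u \<equiv> density lborel (exponential_density (1 / \<mu> (particle_type u)))"
abbreviation (input) "lifetimes \<equiv> \<Pi>\<^sub>M u\<in>UNIV. lifetime u"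
abbreviation (input) "offspring \<equiv> \<Pi>\<^sub>M u\<in>UNIV. measure_pmf (\<nu> (particle_type u))"

lemma prob_space_lifetime: "prob_space (lifetime u)"
  using \<mu>_pos by (intro prob_space_exponential_density) auto

lemma prob_space_lifetimes: "prob_space lifetimes"
  by (intro prob_space_PiM prob_space_lifetime)

lemma prob_space_offspring: "prob_space offspring"
  by (intro prob_space_PiM) (auto intro: prob_space_measure_pmf)

abbreviation (input) "realizations \<equiv> particle_system \<mu> I \<nu>"

lemma prob_space_particle_system: "prob_space realizations"
proof -
  interpret L: prob_space lifetimes by (rule prob_space_lifetimes)
  interpret N: prob_space offspring by (rule prob_space_offspring)
  interpret LN: pair_prob_space lifetimes offspring ..
  interpret Z: prob_space "measure_pmf I" by (rule prob_space_measure_pmf)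
  interpret pair_prob_space "measure_pmf I" "lifetimes \<Otimes>\<^sub>M offspring" ..
  show ?thesis unfolding particle_system_def by unfold_locales
qed

lemma measurable_initial[measurable]:
  "(\<lambda>\<omega>. fst \<omega>) \<in> realizations \<rightarrow>\<^sub>M count_space UNIV"
proof -
  have "fst \<in> realizations \<rightarrow>\<^sub>M measure_pmf I" unfolding particle_system_def by measurable
  then show ?thesis by (simp cong: measurable_cong_sets)
qed

lemma measurable_lifetime[measurable]:
  "(\<lambda>\<omega>. fst (snd \<omega>) u) \<in> realizations \<rightarrow>\<^sub>M borel"
proof -
  have "(\<lambda>\<omega>. fst (snd \<omega>) u) \<in> realizations \<rightarrow>\<^sub>M lifetime u"
    unfolding particle_system_def by measurable
  then show ?thesis by (simp cong: measurable_cong_sets)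
qed

lemma measurable_offspring[measurable]:
  "(\<lambda>\<omega>. snd (snd \<omega>) u) \<in> realizations \<rightarrow>\<^sub>M count_space UNIV"
proof -
  have "(\<lambda>\<omega>. snd (snd \<omega>) u) \<in> realizations \<rightarrow>\<^sub>M measure_pmf (\<nu> (particle_type u))"
    unfolding particle_system_def by measurable
  then show ?thesis by (simp cong: measurable_cong_sets)
qed

lemma measurable_is_born[measurable]:
  "Measurable.pred realizations (\<lambda>\<omega>. is_born (fst \<omega>) (snd (snd \<omega>)) u)"
proof (induction u)
  case (Root j n)
  have "(\<lambda>z. n < z j) \<in> count_space UNIV \<rightarrow>\<^sub>M count_space UNIV" by simp
  from measurable_compose[OF measurable_initial this] show ?case by simp
next
  case (Child u j n)
  note Child[measurable]
  have "(\<lambda>z. n < z j) \<in> count_space UNIV \<rightarrow>\<^sub>M count_space UNIV" by simp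
  from measurable_compose[OF measurable_offspring[of u] this]
  have [measurable]: "Measurable.pred realizations (\<lambda>\<omega>. n < snd (snd \<omega>) u j)" .
  show ?case by simp
qed

lemma measurable_birth_time[measurable]:
  "(\<lambda>\<omega>. birth_time (fst (snd \<omega>)) u) \<in> borel_measurable realizations"
  by (induction u) auto

lemma measurable_discount[measurable]:
  "(\<lambda>\<omega>. discount \<theta> \<omega> u) \<in> borel_measurable realizations"
  unfolding discount_def split_beta' of_bool_def by measurable

lemma measurable_reproduction[measurable]:
  "(\<lambda>\<omega>. reproduction \<theta> \<omega> u) \<in> borel_measurable realizations"
proof -
  have "(\<lambda>v. of_nat (\<Sum>j\<in>UNIV. v j) :: ennreal) \<in> count_space UNIV \<rightarrow>\<^sub>M borel" by simp
  from measurable_compose[OF measurable_offspring[of u] this]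
  have [measurable]: "(\<lambda>\<omega>. of_nat (\<Sum>j\<in>UNIV. snd (snd \<omega>) u j) :: ennreal) \<in> borel_measurable realizations" .
  show ?thesis
    unfolding reproduction_def split_beta' by measurable
qed

lemma measurable_discounted_generation[measurable]:
  "discounted_generation \<theta> n \<in> borel_measurable realizations"
  unfolding discounted_generation_def[abs_def]
  by (intro borel_measurable_nn_integral_count_space) auto

lemma nn_integral_particle_system:
  assumes "f \<in> borel_measurable realizations"
  shows "(\<integral>\<^sup>+\<omega>. f \<omega> \<partial>realizations) =
    (\<integral>\<^sup>+z. \<integral>\<^sup>+L. \<integral>\<^sup>+N. f (z, L, N) \<partial>offspring \<partial>lifetimes \<partial>measure_pmf I)"
proof -
  interpret L: prob_space lifetimes by (rule prob_space_lifetimes)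
  interpret N: prob_space offspring by (rule prob_space_offspring)
  interpret LN: pair_prob_space lifetimes offspring ..
  have [measurable]: "f \<in> borel_measurable (measure_pmf I \<Otimes>\<^sub>M (lifetimes \<Otimes>\<^sub>M offspring))"
    using assms unfolding particle_system_def .
  show ?thesis unfolding particle_system_def
    by (subst LN.nn_integral_fst[symmetric], measurable)
       (intro nn_integral_cong, subst N.nn_integral_fst[symmetric], auto)
qed

text \<open>The life of a particle is independent of everything that happened before its birth.\<close>

lemma nn_integral_particle_system_coordinate:
  assumes F[measurable]: "F \<in> borel_measurable realizations"
    and G[measurable]: "G \<in> borel_measurable borel"
    and invL: "\<And>z L N x. F (z, L(u := x), N) = F (z, L, N)"
    and invN: "\<And>z L N y. F (z, L, N(u := y)) = F (z, L, N)"
  shows "(\<integral>\<^sup>+\<omega>. F \<omega> * (G (fst (snd \<omega>) u) * H (snd (snd \<omega>) u)) \<partial>realizations) =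
    (\<integral>\<^sup>+\<omega>. F \<omega> \<partial>realizations) *
    ((\<integral>\<^sup>+x. G x \<partial>lifetime u) * (\<integral>\<^sup>+v. H v \<partial>measure_pmf (\<nu> (particle_type u))))"
proof -
  interpret L: prob_space lifetimes by (rule prob_space_lifetimes)
  interpret N: prob_space offspring by (rule prob_space_offspring)
  interpret LN: pair_prob_space lifetimes offspring ..
  have F'[measurable]: "F \<in> borel_measurable (measure_pmf I \<Otimes>\<^sub>M (lifetimes \<Otimes>\<^sub>M offspring))"
    using F unfolding particle_system_def .
  have FN: "(\<lambda>N. F (z, L, N)) \<in> borel_measurable offspring" if "L \<in> space lifetimes" for z L
    using that by measurable
  have FL: "(\<lambda>L. \<integral>\<^sup>+N. F (z, L, N) \<partial>offspring) \<in> borel_measurable lifetimes" for z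
    by measurable
  have [measurable]: "(\<lambda>\<omega>. H (snd (snd \<omega>) u)) \<in> borel_measurable realizations"
    by (rule measurable_compose[OF measurable_offspring]) simp
  have "(\<integral>\<^sup>+\<omega>. F \<omega> * (G (fst (snd \<omega>) u) * H (snd (snd \<omega>) u)) \<partial>realizations) =
    (\<integral>\<^sup>+z. \<integral>\<^sup>+L. \<integral>\<^sup>+N. F (z, L, N) * (G (L u) * H (N u)) \<partial>offspring \<partial>lifetimes \<partial>measure_pmf I)"
    by (subst nn_integral_particle_system) auto
  \<comment> \<open>The offspring vector of \<open>u\<close> is integrated out for frozen lifetimes.
    What remains of \<open>F\<close> is a function of the lifetimes that again ignores
    \<open>L u\<close>, so the same argument applies to the lifetime.\<close>
  also have "\<dots> = (\<integral>\<^sup>+z. \<integral>\<^sup>+L. (\<integral>\<^sup>+N. F (z, L, N) \<partial>offspring) * (\<integral>\<^sup>+v. H v \<partial>measure_pmf (\<nu> (particle_type u))) * G (L u) \<partial>lifetimes \<partial>measure_pmf I)"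
  proof (intro nn_integral_cong)
    fix z L assume L: "L \<in> space lifetimes"
    have "(\<integral>\<^sup>+N. F (z, L, N) * (G (L u) * H (N u)) \<partial>offspring) =
       (\<integral>\<^sup>+N. (F (z, L, N) * G (L u)) * H (N u) \<partial>offspring)" by (simp add: mult.assoc)
    also have "\<dots> = (\<integral>\<^sup>+N. F (z, L, N) * G (L u) \<partial>offspring) * (\<integral>\<^sup>+v. H v \<partial>measure_pmf (\<nu> (particle_type u)))"
      using FN[OF L]
      by (intro nn_integral_PiM_coordinate) (auto simp: invN intro: prob_space_measure_pmf)
    also have "(\<integral>\<^sup>+N. F (z, L, N) * G (L u) \<partial>offspring) = (\<integral>\<^sup>+N. F (z, L, N) \<partial>offspring) * G (L u)"
      using FN[OF L] by (intro nn_integral_multc)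
    finally show "(\<integral>\<^sup>+N. F (z, L, N) * (G (L u) * H (N u)) \<partial>offspring) =
       (\<integral>\<^sup>+N. F (z, L, N) \<partial>offspring) * (\<integral>\<^sup>+v. H v \<partial>measure_pmf (\<nu> (particle_type u))) * G (L u)"
      by (simp add: mult_ac)
  qed
  also have "\<dots> = (\<integral>\<^sup>+z. (\<integral>\<^sup>+L. (\<integral>\<^sup>+N. F (z, L, N) \<partial>offspring) * (\<integral>\<^sup>+v. H v \<partial>measure_pmf (\<nu> (particle_type u))) \<partial>lifetimes) *
       (\<integral>\<^sup>+x. G x \<partial>lifetime u) \<partial>measure_pmf I)"
    using FL by (intro nn_integral_cong nn_integral_PiM_coordinate)
      (auto simp: invL intro: prob_space_lifetime)
  also have "\<dots> = (\<integral>\<^sup>+z. (\<integral>\<^sup>+L. (\<integral>\<^sup>+N. F (z, L, N) \<partial>offspring) \<partial>lifetimes) * (\<integral>\<^sup>+v. H v \<partial>measure_pmf (\<nu> (particle_type u))) *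
       (\<integral>\<^sup>+x. G x \<partial>lifetime u) \<partial>measure_pmf I)"
    using FL by (intro nn_integral_cong arg_cong2[where f="(*)"] nn_integral_multc refl)
  also have "\<dots> = (\<integral>\<^sup>+\<omega>. F \<omega> \<partial>realizations) *
    ((\<integral>\<^sup>+x. G x \<partial>lifetime u) * (\<integral>\<^sup>+v. H v \<partial>measure_pmf (\<nu> (particle_type u))))"
    by (simp add: nn_integral_multc nn_integral_cmult mult_ac nn_integral_particle_system)
  finally show ?thesis .
qed


text \<open>Exponential tilting: the density with rate \<open>l\<close> times
  \<open>exp (- \<theta> * x)\<close> is \<open>l / (l + \<theta>)\<close> times the density with
  rate \<open>l + \<theta>\<close>.\<close>

lemma nn_integral_exp_lifetime:
  assumes "0 \<le> \<theta>"
  shows "(\<integral>\<^sup>+x. ennreal (exp (- \<theta> * x)) \<partial>lifetime u) =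
    ennreal (1 / (1 + \<theta> * \<mu> (particle_type u)))"
proof -
  define l where "l = 1 / \<mu> (particle_type u)"
  have l: "0 < l" using \<mu>_pos by (simp add: l_def)
  interpret P: prob_space "density lborel (exponential_density (l + \<theta>))"
    using l assms by (intro prob_space_exponential_density) auto
  have "(\<integral>\<^sup>+x. ennreal (exp (- \<theta> * x)) \<partial>lifetime u) =
      (\<integral>\<^sup>+x. ennreal (exponential_density l x) * ennreal (exp (- \<theta> * x)) \<partial>lborel)"
    unfolding l_def[symmetric] by (subst nn_integral_density) auto
  also have "\<dots> = (\<integral>\<^sup>+x. ennreal (l / (l + \<theta>)) * ennreal (exponential_density (l + \<theta>) x) \<partial>lborel)"
  proof (rule nn_integral_cong)
    fix x
    have "exponential_density l x * exp (- \<theta> * x) = l / (l + \<theta>) * exponential_density (l + \<theta>) x"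
    proof -
      have "exp (- x * (l + \<theta>)) = exp (- x * l) * exp (- \<theta> * x)"
        by (simp add: exp_add[symmetric] algebra_simps)
      then show ?thesis
        using l assms by (simp add: exponential_density_def)
    qed
    moreover have "0 \<le> exponential_density l x" "0 \<le> exponential_density (l + \<theta>) x"
      using l assms by (auto intro!: exponential_density_nonneg)
    ultimately show "ennreal (exponential_density l x) * ennreal (exp (- \<theta> * x)) =
        ennreal (l / (l + \<theta>)) * ennreal (exponential_density (l + \<theta>) x)"
      using l assms by (simp add: ennreal_mult[symmetric])
  qed
  also have "\<dots> = ennreal (l / (l + \<theta>)) * (\<integral>\<^sup>+x. ennreal (exponential_density (l + \<theta>) x) \<partial>lborel)"
    by (rule nn_integral_cmult) auto
  also have "(\<integral>\<^sup>+x. ennreal (exponential_density (l + \<theta>) x) \<partial>lborel) = 1"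
    using P.emeasure_space_1 by (simp add: emeasure_density)
  also have "l / (l + \<theta>) = 1 / (1 + \<theta> * \<mu> (particle_type u))"
    using \<mu>_pos[of "particle_type u"] assms by (simp add: l_def field_simps)
  finally show ?thesis by simp
qed

lemma exists_discount_rate:
  assumes "\<And>i. c i < (\<infinity>::ennreal)" "0 < q"
  shows "\<exists>\<theta>\<ge>0. \<forall>i. ennreal (1 / (1 + \<theta> * \<mu> i)) * c i \<le> ennreal q"
proof (intro exI conjI allI)
  \<comment> \<open>The rate \<open>r i\<close> suffices for type \<open>i\<close> alone, because
    the bound amounts to \<open>c i \<le> q * (1 + \<theta> * \<mu> i)\<close>. The sum over the
    finitely many types serves all of them.\<close>
  define r where "r i = enn2real (c i) / (q * \<mu> i)" for i
  have r: "0 \<le> r i" for i using \<mu>_pos[of i] assms by (simp add: r_def)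
  show "0 \<le> (\<Sum>i\<in>UNIV. r i)" by (intro sum_nonneg r)
  fix i
  have c: "c i = ennreal (enn2real (c i))" using assms(1)[of i] by simp
  have "r i \<le> (\<Sum>i\<in>UNIV. r i)" by (intro member_le_sum) (auto intro: r)
  then have "r i * (q * \<mu> i) \<le> (\<Sum>i\<in>UNIV. r i) * (q * \<mu> i)"
    using \<mu>_pos[of i] assms by (intro mult_right_mono) auto
  then have "enn2real (c i) \<le> (\<Sum>i\<in>UNIV. r i) * (q * \<mu> i)"
    using \<mu>_pos[of i] assms by (simp add: r_def)
  also have "\<dots> \<le> q * (1 + (\<Sum>i\<in>UNIV. r i) * \<mu> i)" using assms by (simp add: algebra_simps)
  finally have "enn2real (c i) \<le> q * (1 + (\<Sum>i\<in>UNIV. r i) * \<mu> i)" .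
  moreover have "0 < 1 + (\<Sum>i\<in>UNIV. r i) * \<mu> i"
    using \<mu>_pos[of i] r by (intro add_pos_nonneg mult_nonneg_nonneg sum_nonneg) auto
  ultimately show "ennreal (1 / (1 + (\<Sum>i\<in>UNIV. r i) * \<mu> i)) * c i \<le> ennreal q"
    by (subst c) (auto simp: ennreal_mult'[symmetric] field_simps intro!: ennreal_leI)
qed

lemma nn_integral_discounted_generation_0:
  "(\<integral>\<^sup>+\<omega>. discounted_generation \<theta> 0 \<omega> ^ k \<partial>realizations) =
   (\<integral>\<^sup>+z. of_nat (\<Sum>j\<in>UNIV. z j) ^ k \<partial>measure_pmf I)"
proof -
  interpret L: prob_space lifetimes by (rule prob_space_lifetimes)
  interpret N: prob_space offspring by (rule prob_space_offspring)
  show ?thesis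
    by (subst nn_integral_particle_system)
       (auto simp: discounted_generation_0 L.emeasure_space_1 N.emeasure_space_1
             simp del: of_nat_sum)
qed

text \<open>A \<open>k\<close>-th power multiplies the discount rate by \<open>k\<close>, hence the
  factor \<open>real k * \<theta>\<close>. The two invariance premises say that \<open>F\<close> is
  decided before the life of \<open>u\<close>.\<close>

lemma nn_integral_reproduction:
  assumes [measurable]: "F \<in> borel_measurable realizations"
    and invL: "\<And>z L N x. F (z, L(u := x), N) = F (z, L, N)"
    and invN: "\<And>z L N y. F (z, L, N(u := y)) = F (z, L, N)"
    and "0 \<le> \<theta>"
  shows "(\<integral>\<^sup>+\<omega>. F \<omega> * reproduction \<theta> \<omega> u ^ k \<partial>realizations) =
    (\<integral>\<^sup>+\<omega>. F \<omega> \<partial>realizations) * (ennreal (1 / (1 + (real k * \<theta>) * \<mu> (particle_type u))) *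
       (\<integral>\<^sup>+v. of_nat (\<Sum>j\<in>UNIV. v j) ^ k \<partial>measure_pmf (\<nu> (particle_type u))))"
proof -
  have "reproduction \<theta> \<omega> u ^ k =
     ennreal (exp (- (real k * \<theta>) * fst (snd \<omega>) u)) * of_nat (\<Sum>j\<in>UNIV. snd (snd \<omega>) u j) ^ k"
    for \<omega> :: "'d realization"
    by (simp add: reproduction_def split_beta' power_mult_distrib ennreal_power exp_of_nat_mult[symmetric] mult_ac
             del: of_nat_sum)
  then show ?thesis
    using nn_integral_particle_system_coordinate[OF assms(1) _ invL invN,
      of "\<lambda>x. ennreal (exp (- (real k * \<theta>) * x))" "\<lambda>v. of_nat (\<Sum>j\<in>UNIV. v j) ^ k"]
      nn_integral_exp_lifetime[of "real k * \<theta>" u] assms(4) by simp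
qed

text \<open>The weight of \<open>u\<close> depends only on its strict ancestors and is independent
  of the reproduction of \<open>u\<close>. The latter has mean at most \<open>q\<close>, so each
  generation costs one factor \<open>q\<close>.\<close>

lemma nn_integral_discounted_generation_le:
  assumes "0 \<le> \<theta>"
    and q: "\<And>i. ennreal (1 / (1 + \<theta> * \<mu> i)) * (\<integral>\<^sup>+v. of_nat (\<Sum>j\<in>UNIV. v j) \<partial>measure_pmf (\<nu> i)) \<le> q"
  shows "(\<integral>\<^sup>+\<omega>. discounted_generation \<theta> n \<omega> \<partial>realizations) \<le>
    q ^ n * (\<integral>\<^sup>+z. of_nat (\<Sum>j\<in>UNIV. z j) \<partial>measure_pmf I)"
proof (induction n)
  case 0
  then show ?case using nn_integral_discounted_generation_0[of \<theta> 1] by simp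
next
  case (Suc n)
  interpret P: prob_space "realizations" by (rule prob_space_particle_system)
  have sf: "sigma_finite_measure realizations" ..
  have "(\<integral>\<^sup>+\<omega>. discounted_generation \<theta> (Suc n) \<omega> \<partial>realizations) =
      (\<integral>\<^sup>+u. (\<integral>\<^sup>+\<omega>. discount \<theta> \<omega> u * reproduction \<theta> \<omega> u \<partial>realizations) \<partial>count_space {u. generation u = n})"
    unfolding discounted_generation_Suc by (rule nn_integral_count_space_commute) (auto intro: sf)
  also have "\<dots> \<le> (\<integral>\<^sup>+u. q * (\<integral>\<^sup>+\<omega>. discount \<theta> \<omega> u \<partial>realizations) \<partial>count_space {u. generation u = n})"
  proof (rule nn_integral_mono)
    fix u :: "'d particle"
    show "(\<integral>\<^sup>+\<omega>. discount \<theta> \<omega> u * reproduction \<theta> \<omega> u \<partial>realizations) \<le>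
        q * (\<integral>\<^sup>+\<omega>. discount \<theta> \<omega> u \<partial>realizations)"
      using nn_integral_reproduction[of "\<lambda>\<omega>. discount \<theta> \<omega> u" u \<theta> 1] assms(1)
        mult_left_mono[OF q[of "particle_type u"], of "\<integral>\<^sup>+\<omega>. discount \<theta> \<omega> u \<partial>realizations"]
      by (simp add: discount_upd_lifetime discount_upd_offspring mult.commute[of q] del: of_nat_sum)
  qed
  also have "\<dots> = q * (\<integral>\<^sup>+u. (\<integral>\<^sup>+\<omega>. discount \<theta> \<omega> u \<partial>realizations) \<partial>count_space {u. generation u = n})"
    by (rule nn_integral_cmult) auto
  also have "(\<integral>\<^sup>+u. (\<integral>\<^sup>+\<omega>. discount \<theta> \<omega> u \<partial>realizations) \<partial>count_space {u. generation u = n}) =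
      (\<integral>\<^sup>+\<omega>. discounted_generation \<theta> n \<omega> \<partial>realizations)"
    unfolding discounted_generation_def by (rule nn_integral_count_space_commute[symmetric]) (auto intro: sf)
  also have "q * \<dots> \<le> q * (q ^ n * (\<integral>\<^sup>+z. of_nat (\<Sum>j\<in>UNIV. z j) \<partial>measure_pmf I))"
    by (intro mult_left_mono Suc) auto
  finally show ?case by (simp add: mult_ac)
qed

text \<open>
  The terms \<open>u = v\<close> and \<open>u \<noteq> v\<close> of the double sum need not be separated, since the reproduction terms
  satisfy \<open>Y\<^sub>u Y\<^sub>v \<le> Y\<^sub>u\<^sup>2 + Y\<^sub>v\<^sup>2\<close> and each of the two squares is independent of both births.
\<close>

lemma nn_integral_discounted_generation_square_le:
  assumes "0 \<le> \<theta>"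
    and q: "\<And>i. ennreal (1 / (1 + (2 * \<theta>) * \<mu> i)) * (\<integral>\<^sup>+v. of_nat (\<Sum>j\<in>UNIV. v j) ^ 2 \<partial>measure_pmf (\<nu> i)) \<le> q"
  shows "(\<integral>\<^sup>+\<omega>. (discounted_generation \<theta> n \<omega>)\<^sup>2 \<partial>realizations) \<le>
    (2 * q) ^ n * (\<integral>\<^sup>+z. of_nat (\<Sum>j\<in>UNIV. z j) ^ 2 \<partial>measure_pmf I)"
proof (induction n)
  case 0
  then show ?case using nn_integral_discounted_generation_0[of \<theta> 2] by simp
next
  case (Suc n)
  interpret P: prob_space "realizations" by (rule prob_space_particle_system)
  have sf: "sigma_finite_measure realizations" ..
  let ?S = "{u::'d particle. generation u = n}" and ?P = "realizations"
  let ?d = "\<lambda>u v \<omega>. discount \<theta> \<omega> u * discount \<theta> \<omega> v"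
  have "(\<integral>\<^sup>+\<omega>. (discounted_generation \<theta> (Suc n) \<omega>)\<^sup>2 \<partial>?P) =
      (\<integral>\<^sup>+\<omega>. (\<integral>\<^sup>+u. \<integral>\<^sup>+v. (discount \<theta> \<omega> u * reproduction \<theta> \<omega> u) * (discount \<theta> \<omega> v * reproduction \<theta> \<omega> v) \<partial>count_space ?S \<partial>count_space ?S) \<partial>?P)"
    unfolding discounted_generation_Suc square_nn_integral_count_space ..
  also have "\<dots> = (\<integral>\<^sup>+u. \<integral>\<^sup>+v. (\<integral>\<^sup>+\<omega>. (discount \<theta> \<omega> u * reproduction \<theta> \<omega> u) * (discount \<theta> \<omega> v * reproduction \<theta> \<omega> v) \<partial>?P) \<partial>count_space ?S \<partial>count_space ?S)"
    by (subst nn_integral_count_space_commute)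
       (auto intro!: nn_integral_cong nn_integral_count_space_commute borel_measurable_nn_integral_count_space sf)
  also have "\<dots> \<le> (\<integral>\<^sup>+u. \<integral>\<^sup>+v. 2 * q * (\<integral>\<^sup>+\<omega>. ?d u v \<omega> \<partial>?P) \<partial>count_space ?S \<partial>count_space ?S)"
  proof (intro nn_integral_mono)
    fix u v :: "'d particle" assume "u \<in> space (count_space ?S)" "v \<in> space (count_space ?S)"
    then have gen: "generation u = n" "generation v = n" by auto
    have *: "(\<integral>\<^sup>+\<omega>. ?d u v \<omega> * reproduction \<theta> \<omega> w ^ 2 \<partial>?P) \<le> q * (\<integral>\<^sup>+\<omega>. ?d u v \<omega> \<partial>?P)"
      if "generation w = n" for w
      using nn_integral_reproduction[of "?d u v" w \<theta> 2] assms(1) gen that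
        mult_left_mono[OF q[of "particle_type w"], of "\<integral>\<^sup>+\<omega>. ?d u v \<omega> \<partial>?P"]
      by (simp add: discount_upd_lifetime discount_upd_offspring mult.commute[of q] del: of_nat_sum)
    have "(\<integral>\<^sup>+\<omega>. (discount \<theta> \<omega> u * reproduction \<theta> \<omega> u) * (discount \<theta> \<omega> v * reproduction \<theta> \<omega> v) \<partial>?P) \<le>
        (\<integral>\<^sup>+\<omega>. ?d u v \<omega> * reproduction \<theta> \<omega> u ^ 2 + ?d u v \<omega> * reproduction \<theta> \<omega> v ^ 2 \<partial>?P)"
    proof (rule nn_integral_mono)
      fix \<omega>
      have "(discount \<theta> \<omega> u * reproduction \<theta> \<omega> u) * (discount \<theta> \<omega> v * reproduction \<theta> \<omega> v) =
          ?d u v \<omega> * (reproduction \<theta> \<omega> u * reproduction \<theta> \<omega> v)" by (simp add: mult_ac)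
      also have "\<dots> \<le> ?d u v \<omega> * (reproduction \<theta> \<omega> u ^ 2 + reproduction \<theta> \<omega> v ^ 2)"
        by (intro mult_left_mono mult_le_squares_ennreal) auto
      finally show "(discount \<theta> \<omega> u * reproduction \<theta> \<omega> u) * (discount \<theta> \<omega> v * reproduction \<theta> \<omega> v) \<le>
          ?d u v \<omega> * reproduction \<theta> \<omega> u ^ 2 + ?d u v \<omega> * reproduction \<theta> \<omega> v ^ 2"
        by (simp add: distrib_left)
    qed
    also have "\<dots> = (\<integral>\<^sup>+\<omega>. ?d u v \<omega> * reproduction \<theta> \<omega> u ^ 2 \<partial>?P) + (\<integral>\<^sup>+\<omega>. ?d u v \<omega> * reproduction \<theta> \<omega> v ^ 2 \<partial>?P)"
      by (rule nn_integral_add) auto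
    also have "\<dots> \<le> q * (\<integral>\<^sup>+\<omega>. ?d u v \<omega> \<partial>?P) + q * (\<integral>\<^sup>+\<omega>. ?d u v \<omega> \<partial>?P)"
      by (intro add_mono * gen)
    finally show "(\<integral>\<^sup>+\<omega>. (discount \<theta> \<omega> u * reproduction \<theta> \<omega> u) * (discount \<theta> \<omega> v * reproduction \<theta> \<omega> v) \<partial>?P) \<le> 2 * q * (\<integral>\<^sup>+\<omega>. ?d u v \<omega> \<partial>?P)"
      by (simp add: mult_2 distrib_right)
  qed
  also have "\<dots> = 2 * q * (\<integral>\<^sup>+u. \<integral>\<^sup>+v. (\<integral>\<^sup>+\<omega>. ?d u v \<omega> \<partial>?P) \<partial>count_space ?S \<partial>count_space ?S)"
    by (simp add: nn_integral_cmult)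
  also have "(\<integral>\<^sup>+u. \<integral>\<^sup>+v. (\<integral>\<^sup>+\<omega>. ?d u v \<omega> \<partial>?P) \<partial>count_space ?S \<partial>count_space ?S) =
     (\<integral>\<^sup>+\<omega>. \<integral>\<^sup>+u. \<integral>\<^sup>+v. ?d u v \<omega> \<partial>count_space ?S \<partial>count_space ?S \<partial>?P)"
    by (subst nn_integral_count_space_commute)
       (auto intro!: nn_integral_cong nn_integral_count_space_commute[symmetric] borel_measurable_nn_integral_count_space sf)
  also have "\<dots> = (\<integral>\<^sup>+\<omega>. (discounted_generation \<theta> n \<omega>)\<^sup>2 \<partial>?P)"
    unfolding discounted_generation_def square_nn_integral_count_space ..
  also have "2 * q * \<dots> \<le> 2 * q * ((2 * q) ^ n * (\<integral>\<^sup>+z. of_nat (\<Sum>j\<in>UNIV. z j) ^ 2 \<partial>measure_pmf I))"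
    by (intro mult_left_mono Suc) auto
  finally show ?case by (simp add: mult_ac)
qed

section \<open>Moment bounds for the population, uniform up to a fixed time\<close>

lemma population_first_moment_bounded:
  assumes "(\<integral>\<^sup>+z. of_nat (\<Sum>j\<in>UNIV. z j) \<partial>measure_pmf I) < \<infinity>"
    and "\<And>i. (\<integral>\<^sup>+v. of_nat (\<Sum>j\<in>UNIV. v j) \<partial>measure_pmf (\<nu> i)) < \<infinity>"
  shows "\<exists>B<\<infinity>. \<forall>s\<le>t. \<forall>j. (\<integral>\<^sup>+\<omega>. ennreal_of_enat (population s \<omega> j) \<partial>realizations) \<le> B"
proof -
  let ?m = "\<integral>\<^sup>+z. of_nat (\<Sum>j\<in>UNIV. z j) \<partial>measure_pmf I"
  \<comment> \<open>Any ratio below 1 makes the generation means summable; with 1/2 they add up to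
    at most \<open>2 * ?m\<close>.\<close>
  have "\<exists>\<theta>\<ge>0. \<forall>i. ennreal (1 / (1 + \<theta> * \<mu> i)) *
      (\<integral>\<^sup>+v. of_nat (\<Sum>j\<in>UNIV. v j) \<partial>measure_pmf (\<nu> i)) \<le> ennreal (1 / 2)"
    by (rule exists_discount_rate) (rule assms(2), simp)
  then obtain \<theta> where \<theta>: "0 \<le> \<theta>"
    "\<And>i. ennreal (1 / (1 + \<theta> * \<mu> i)) * (\<integral>\<^sup>+v. of_nat (\<Sum>j\<in>UNIV. v j) \<partial>measure_pmf (\<nu> i)) \<le> ennreal (1 / 2)"
    by blast
  let ?B = "ennreal (exp (\<theta> * t)) * (2 * ?m)"
  have "(\<integral>\<^sup>+\<omega>. ennreal_of_enat (population s \<omega> j) \<partial>realizations) \<le> ?B" if "s \<le> t" for s j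
  proof -
    have "(\<integral>\<^sup>+\<omega>. ennreal_of_enat (population s \<omega> j) \<partial>realizations) \<le>
       (\<integral>\<^sup>+\<omega>. ennreal (exp (\<theta> * t)) * (\<Sum>n. discounted_generation \<theta> n \<omega>) \<partial>realizations)"
      by (intro nn_integral_mono population_le_discounted \<theta> that)
    also have "\<dots> = ennreal (exp (\<theta> * t)) * (\<Sum>n. \<integral>\<^sup>+\<omega>. discounted_generation \<theta> n \<omega> \<partial>realizations)"
      by (simp add: nn_integral_cmult nn_integral_suminf)
    also have "\<dots> \<le> ennreal (exp (\<theta> * t)) * (\<Sum>n. ennreal (1 / 2) ^ n * ?m)"
      using nn_integral_discounted_generation_le[OF \<theta>] by (intro mult_left_mono suminf_le) auto
    also have "(\<Sum>n. ennreal (1 / 2) ^ n * ?m) = 2 * ?m"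
      by (rule suminf_half_power_mult)
    finally show ?thesis .
  qed
  moreover have "?B < \<infinity>" using assms(1) by (simp add: ennreal_mult_less_top del: of_nat_sum)
  ultimately show ?thesis by blast
qed

lemma population_second_moment_bounded:
  assumes "(\<integral>\<^sup>+z. of_nat (\<Sum>j\<in>UNIV. z j) ^ 2 \<partial>measure_pmf I) < \<infinity>"
    and "\<And>i. (\<integral>\<^sup>+v. of_nat (\<Sum>j\<in>UNIV. v j) ^ 2 \<partial>measure_pmf (\<nu> i)) < \<infinity>"
  shows "\<exists>B<\<infinity>. \<forall>s\<le>t. \<forall>j. (\<integral>\<^sup>+\<omega>. (ennreal_of_enat (population s \<omega> j))\<^sup>2 \<partial>realizations) \<le> B"
proof -
  let ?m = "\<integral>\<^sup>+z. of_nat (\<Sum>j\<in>UNIV. z j) ^ 2 \<partial>measure_pmf I"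
  \<comment> \<open>The second moment of generation \<open>n\<close> is bounded by
    \<open>(2 * q) ^ n\<close>, and Cauchy-Schwarz costs \<open>4 ^ n\<close>. The choice
    \<open>q = 1/16\<close> leaves the ratio \<open>4 * 2 / 16 = 1/2\<close>.\<close>
  have "\<exists>\<eta>\<ge>0. \<forall>i. ennreal (1 / (1 + \<eta> * \<mu> i)) *
      (\<integral>\<^sup>+v. of_nat (\<Sum>j\<in>UNIV. v j) ^ 2 \<partial>measure_pmf (\<nu> i)) \<le> ennreal (1 / 16)"
    by (rule exists_discount_rate) (rule assms(2), simp)
  then obtain \<eta> where \<eta>: "0 \<le> \<eta>"
    "\<And>i. ennreal (1 / (1 + \<eta> * \<mu> i)) * (\<integral>\<^sup>+v. of_nat (\<Sum>j\<in>UNIV. v j) ^ 2 \<partial>measure_pmf (\<nu> i)) \<le> ennreal (1 / 16)"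
    by blast
  \<comment> \<open>Squaring a weight doubles its discount rate, so the rate \<eta> found for the
    squares belongs to half of it for the weights.\<close>
  define \<theta> where "\<theta> = \<eta> / 2"
  have \<theta>: "0 \<le> \<theta>"
    "\<And>i. ennreal (1 / (1 + (2 * \<theta>) * \<mu> i)) * (\<integral>\<^sup>+v. of_nat (\<Sum>j\<in>UNIV. v j) ^ 2 \<partial>measure_pmf (\<nu> i)) \<le> ennreal (1 / 16)"
    using \<eta> by (simp_all add: \<theta>_def)
  have h: "4 ^ n * (2 * ennreal (1 / 16)) ^ n = ennreal (1 / 2) ^ n" for n
  proof -
    have "ennreal (1 / 2) = ennreal (4 * (2 * (1 / 16)))" by simp
    also have "\<dots> = ennreal 4 * ennreal (2 * (1 / 16))" by (rule ennreal_mult) auto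
    also have "ennreal (2 * (1 / 16)) = ennreal 2 * ennreal (1 / 16)" by (rule ennreal_mult) auto
    finally have "ennreal (1 / 2) = 4 * (2 * ennreal (1 / 16))" by (simp only: ennreal_numeral)
    then show ?thesis by (simp only: power_mult_distrib)
  qed
  let ?B = "(ennreal (exp (\<theta> * t)))\<^sup>2 * (2 * (2 * ?m))"
  have "(\<integral>\<^sup>+\<omega>. (ennreal_of_enat (population s \<omega> j))\<^sup>2 \<partial>realizations) \<le> ?B" if "s \<le> t" for s j
  proof -
    have "(\<integral>\<^sup>+\<omega>. (ennreal_of_enat (population s \<omega> j))\<^sup>2 \<partial>realizations) \<le>
       (\<integral>\<^sup>+\<omega>. (ennreal (exp (\<theta> * t)))\<^sup>2 * (2 * (\<Sum>n. 4 ^ n * (discounted_generation \<theta> n \<omega>)\<^sup>2)) \<partial>realizations)"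
    proof (rule nn_integral_mono)
      fix \<omega>
      have "(ennreal_of_enat (population s \<omega> j))\<^sup>2 \<le> (ennreal (exp (\<theta> * t)) * (\<Sum>n. discounted_generation \<theta> n \<omega>))\<^sup>2"
        by (intro power_mono population_le_discounted \<theta> that) auto
      also have "\<dots> \<le> (ennreal (exp (\<theta> * t)))\<^sup>2 * (2 * (\<Sum>n. 4 ^ n * (discounted_generation \<theta> n \<omega>)\<^sup>2))"
        unfolding power_mult_distrib by (intro mult_left_mono Cauchy_Schwarz_geometric) auto
      finally show "(ennreal_of_enat (population s \<omega> j))\<^sup>2 \<le>
        (ennreal (exp (\<theta> * t)))\<^sup>2 * (2 * (\<Sum>n. 4 ^ n * (discounted_generation \<theta> n \<omega>)\<^sup>2))" .
    qed
    also have "\<dots> = (ennreal (exp (\<theta> * t)))\<^sup>2 * (2 * (\<Sum>n. 4 ^ n * (\<integral>\<^sup>+\<omega>. (discounted_generation \<theta> n \<omega>)\<^sup>2 \<partial>realizations)))"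
      by (simp add: nn_integral_cmult nn_integral_suminf)
    also have "\<dots> \<le> (ennreal (exp (\<theta> * t)))\<^sup>2 * (2 * (\<Sum>n. 4 ^ n * ((2 * ennreal (1 / 16)) ^ n * ?m)))"
      using nn_integral_discounted_generation_square_le[OF \<theta>] by (intro mult_left_mono suminf_le) auto
    also have "(\<Sum>n. 4 ^ n * ((2 * ennreal (1 / 16)) ^ n * ?m)) = (\<Sum>n. ennreal (1 / 2) ^ n * ?m)"
      by (simp only: mult.assoc[symmetric] h)
    also have "\<dots> = 2 * ?m"
      by (rule suminf_half_power_mult)
    finally show ?thesis .
  qed
  moreover have "?B < \<infinity>" using assms(1)
    by (simp add: ennreal_mult_less_top power_less_top_ennreal del: of_nat_sum)
  ultimately show ?thesis by blast
qed

text \<open>There are only countably many values, since \<open>'d\<close> is finite and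
  \<open>enat\<close> countable. It is thus enough to consider singletons, and there each coordinate
  is a countable sum of indicators over the particles.\<close>

lemma measurable_population: "population s \<in> realizations \<rightarrow>\<^sub>M count_space UNIV"
proof -
  have "(\<lambda>\<omega>. ennreal_of_enat (population s \<omega> j)) \<in> borel_measurable realizations" for j
  proof -
    have "(\<lambda>\<omega>. \<integral>\<^sup>+u. of_bool (is_born (fst \<omega>) (snd (snd \<omega>)) u \<and> particle_type u = j \<and>
        birth_time (fst (snd \<omega>)) u \<le> s \<and> s < birth_time (fst (snd \<omega>)) u + fst (snd \<omega>) u) \<partial>count_space UNIV)
      \<in> borel_measurable realizations"
      unfolding of_bool_def by (rule borel_measurable_nn_integral_count_space) auto
    also have "(\<lambda>\<omega>. \<integral>\<^sup>+u. of_bool (is_born (fst \<omega>) (snd (snd \<omega>)) u \<and> particle_type u = j \<and>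
        birth_time (fst (snd \<omega>)) u \<le> s \<and> s < birth_time (fst (snd \<omega>)) u + fst (snd \<omega>) u) \<partial>count_space UNIV) =
        (\<lambda>\<omega>. ennreal_of_enat (population s \<omega> j))"
      by (rule ext) (simp flip: ennreal_of_enat_population)
    finally show ?thesis .
  qed
  note [measurable] = this
  have "population s -` {c} \<inter> space realizations \<in> sets realizations" for c
  proof -
    have "population s -` {c} \<inter> space realizations =
      {\<omega> \<in> space realizations. \<forall>j\<in>UNIV. ennreal_of_enat (population s \<omega> j) = ennreal_of_enat (c j)}"
      by (auto simp: fun_eq_iff)
    also have "\<dots> \<in> sets realizations" by measurable
    finally show ?thesis .
  qed
  then show ?thesis by (subst measurable_count_space_eq_countable) auto
qed

text \<open>A moment at one fixed time is a function of a single coordinate of the path, so it is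
  measurable on \<open>path_space\<close> and passes through the equality of the path laws.\<close>

lemma nn_integral_branching_process:
  assumes Z: "branching_process \<mu> I \<nu> M' Z" and "0 \<le> s"
  shows "(\<integral>\<^sup>+\<omega>. of_nat (Z s \<omega> j) ^ k \<partial>M') =
    (\<integral>\<^sup>+\<omega>. ennreal_of_enat (population s \<omega> j) ^ k \<partial>realizations)"
proof -
  have s: "(\<lambda>p. p s) \<in> path_space \<rightarrow>\<^sub>M count_space (UNIV :: ('d \<Rightarrow> enat) set)"
    unfolding path_space_def using \<open>0 \<le> s\<close> by (intro measurable_component_singleton) auto
  have g: "(\<lambda>p. ennreal_of_enat (p s j) ^ k) \<in> path_space \<rightarrow>\<^sub>M borel"
    by (rule measurable_compose[OF s]) simp
  have Zm: "path (\<lambda>t \<omega> j. enat (Z t \<omega> j)) \<in> M' \<rightarrow>\<^sub>M path_space"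
    unfolding path_def path_space_def
  proof (intro measurable_restrict)
    fix r :: real assume "r \<in> {0..}"
    then have "Z r \<in> M' \<rightarrow>\<^sub>M count_space UNIV" using Z by (simp add: branching_process_def jump_process_def)
    then show "(\<lambda>\<omega> j. enat (Z r \<omega> j)) \<in> M' \<rightarrow>\<^sub>M count_space UNIV" by (rule measurable_compose) simp
  qed
  have Pm: "path population \<in> realizations \<rightarrow>\<^sub>M path_space"
    unfolding path_def path_space_def by (intro measurable_restrict measurable_population)
  have "(\<integral>\<^sup>+\<omega>. of_nat (Z s \<omega> j) ^ k \<partial>M') =
      (\<integral>\<^sup>+p. ennreal_of_enat (p s j) ^ k \<partial>distr M' path_space (path (\<lambda>t \<omega> j. enat (Z t \<omega> j))))"
    using \<open>0 \<le> s\<close> by (subst nn_integral_distr[OF Zm]) (use g in \<open>simp_all add: path_def\<close>)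
  also have "\<dots> = (\<integral>\<^sup>+p. ennreal_of_enat (p s j) ^ k \<partial>distr realizations path_space (path population))"
    using Z by (simp add: branching_process_def)
  also have "\<dots> = (\<integral>\<^sup>+\<omega>. ennreal_of_enat (population s \<omega> j) ^ k \<partial>realizations)"
    using \<open>0 \<le> s\<close> by (subst nn_integral_distr[OF Pm]) (use g in \<open>simp_all add: path_def\<close>)
  finally show ?thesis .
qed

end

section \<open>From moments of coordinates to moments of total numbers\<close>

lemma nn_integral_pmf_total_finite:
  fixes p :: "('d::finite \<Rightarrow> nat) pmf"
  assumes "\<And>j. integrable (measure_pmf p) (\<lambda>v. real (v j))"
  shows "(\<integral>\<^sup>+v. of_nat (\<Sum>j\<in>UNIV. v j) \<partial>measure_pmf p) < \<infinity>"
proof -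
  have "integrable (measure_pmf p) (\<lambda>v. \<Sum>j\<in>UNIV. real (v j))" using assms by auto
  then have "(\<integral>\<^sup>+v. ennreal (norm (\<Sum>j\<in>UNIV. real (v j))) \<partial>measure_pmf p) < \<infinity>"
    unfolding integrable_iff_bounded by auto
  also have "(\<lambda>v. ennreal (norm (\<Sum>j\<in>UNIV. real (v j)))) = (\<lambda>v. of_nat (\<Sum>j\<in>UNIV. v j))"
    by (simp add: ennreal_of_nat_eq_real_of_nat flip: of_nat_sum)
  finally show ?thesis .
qed

lemma nn_integral_pmf_total_square_finite:
  fixes p :: "('d::finite \<Rightarrow> nat) pmf"
  assumes "\<And>j. integrable (measure_pmf p) (\<lambda>v. (real (v j))\<^sup>2)"
  shows "(\<integral>\<^sup>+v. of_nat (\<Sum>j\<in>UNIV. v j) ^ 2 \<partial>measure_pmf p) < \<infinity>"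
proof -
  have i: "integrable (measure_pmf p) (\<lambda>v. real (v i) * real (v j))" for i j
  proof (rule Bochner_Integration.integrable_bound)
    show "integrable (measure_pmf p) (\<lambda>v. (real (v i))\<^sup>2 + (real (v j))\<^sup>2)" using assms by auto
    show "AE v in measure_pmf p. norm (real (v i) * real (v j)) \<le> norm ((real (v i))\<^sup>2 + (real (v j))\<^sup>2)"
    proof (rule AE_I2)
      fix v :: "'d \<Rightarrow> nat"
      have "2 * (real (v i) * real (v j)) \<le> (real (v i))\<^sup>2 + (real (v j))\<^sup>2"
        using sum_squares_bound[of "real (v i)" "real (v j)"] by simp
      moreover have "0 \<le> real (v i) * real (v j)" by simp
      ultimately have "real (v i) * real (v j) \<le> (real (v i))\<^sup>2 + (real (v j))\<^sup>2" by linarith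
      then show "norm (real (v i) * real (v j)) \<le> norm ((real (v i))\<^sup>2 + (real (v j))\<^sup>2)"
        by simp
    qed
  qed auto
  have "integrable (measure_pmf p) (\<lambda>v. (\<Sum>j\<in>UNIV. real (v j))\<^sup>2)"
    unfolding power2_eq_square sum_product using i by auto
  then have "(\<integral>\<^sup>+v. ennreal (norm ((\<Sum>j\<in>UNIV. real (v j))\<^sup>2)) \<partial>measure_pmf p) < \<infinity>"
    unfolding integrable_iff_bounded by auto
  also have "(\<lambda>v. ennreal (norm ((\<Sum>j\<in>UNIV. real (v j))\<^sup>2))) = (\<lambda>v. of_nat (\<Sum>j\<in>UNIV. v j) ^ 2)"
    by (simp add: ennreal_of_nat_eq_real_of_nat ennreal_power flip: of_nat_sum)
  finally show ?thesis .
qed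

lemma branching_process_first_moment_bounded:
  assumes "branching_parameters \<mu> I \<nu>" and Z: "branching_process \<mu> I \<nu> M' Z"
  shows "\<exists>B<\<infinity>. \<forall>s\<in>{0..t}. \<forall>j. (\<integral>\<^sup>+\<omega>. of_nat (Z s \<omega> j) \<partial>M') \<le> B"
proof -
  have \<mu>: "0 < \<mu> i" for i using assms(1) by (simp add: branching_parameters_def)
  have "\<exists>B<\<infinity>. \<forall>s\<le>t. \<forall>j. (\<integral>\<^sup>+\<omega>. ennreal_of_enat (population s \<omega> j) \<partial>particle_system \<mu> I \<nu>) \<le> B"
    using assms(1) by (intro population_first_moment_bounded \<mu> nn_integral_pmf_total_finite)
      (auto simp: branching_parameters_def)
  then show ?thesis using nn_integral_branching_process[OF \<mu> Z, where k = 1] by auto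
qed

lemma branching_process_second_moment_bounded:
  assumes "branching_parameters \<mu> I \<nu>" and Z: "branching_process \<mu> I \<nu> M' Z"
    and "finite_second_moments I \<nu>"
  shows "\<exists>B<\<infinity>. \<forall>s\<in>{0..t}. \<forall>j. (\<integral>\<^sup>+\<omega>. (of_nat (Z s \<omega> j))\<^sup>2 \<partial>M') \<le> B"
proof -
  have \<mu>: "0 < \<mu> i" for i using assms(1) by (simp add: branching_parameters_def)
  have "\<exists>B<\<infinity>. \<forall>s\<le>t. \<forall>j. (\<integral>\<^sup>+\<omega>. (ennreal_of_enat (population s \<omega> j))\<^sup>2 \<partial>particle_system \<mu> I \<nu>) \<le> B"
    using assms(3) by (intro population_second_moment_bounded \<mu> nn_integral_pmf_total_square_finite)
      (auto simp: finite_second_moments_def)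
  then show ?thesis using nn_integral_branching_process[OF \<mu> Z, where k = 2] by auto
qed

section \<open>Joint measurability and independence\<close>

text \<open>
  Evaluation of a path is not measurable on \<open>path_space\<close> jointly in time and path. For right-continuous
  paths it agrees with a limit over dyadic times, which is.
\<close>

definition eval_path :: "'d \<Rightarrow> real \<Rightarrow> (real \<Rightarrow> 'd \<Rightarrow> nat) \<Rightarrow> ennreal" where
  "eval_path j s p = liminf (\<lambda>n. of_nat (p (real (nat \<lfloor>s * 2 ^ n\<rfloor> + 1) / 2 ^ n) j))"

lemma measurable_path_component:
  "0 \<le> q \<Longrightarrow> (\<lambda>p. p q) \<in> path_space \<rightarrow>\<^sub>M count_space UNIV"
  unfolding path_space_def by (rule measurable_component_singleton) auto

lemma measurable_eval_path[measurable]: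
  "(\<lambda>x. eval_path (j :: 'd) (fst x) (snd x)) \<in> borel_measurable (borel \<Otimes>\<^sub>M path_space)"
proof -
  have "(\<lambda>x :: real \<times> (real \<Rightarrow> 'd \<Rightarrow> nat). of_nat (snd x (real (nat \<lfloor>fst x * 2 ^ n\<rfloor> + 1) / 2 ^ n) j) :: ennreal)
      \<in> borel_measurable (borel \<Otimes>\<^sub>M path_space)" for n :: nat
  proof (rule measurable_compose_countable[where g = "\<lambda>x. nat \<lfloor>fst x * (2 :: real) ^ n\<rfloor>" and
        f = "\<lambda>m x. of_nat (snd x (real (m + 1) / 2 ^ n) j)"])
    fix m :: nat
    have "(\<lambda>p. p (real (m + 1) / 2 ^ n)) \<in> path_space \<rightarrow>\<^sub>M count_space UNIV"
      by (rule measurable_path_component) auto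
    moreover have "(\<lambda>v. of_nat (v j) :: ennreal) \<in> count_space UNIV \<rightarrow>\<^sub>M borel" by simp
    ultimately have "(\<lambda>p. of_nat (p (real (m + 1) / 2 ^ n) j) :: ennreal) \<in> path_space \<rightarrow>\<^sub>M borel"
      by (rule measurable_compose)
    then show "(\<lambda>x. of_nat (snd x (real (m + 1) / 2 ^ n) j) :: ennreal) \<in> borel_measurable (borel \<Otimes>\<^sub>M path_space)"
      by (rule measurable_compose[OF measurable_snd])
  next
    have "(\<lambda>x. \<lfloor>fst x * (2 :: real) ^ n\<rfloor>) \<in> borel \<Otimes>\<^sub>M path_space \<rightarrow>\<^sub>M count_space UNIV"
      by (rule measurable_compose[OF _ measurable_real_floor]) measurable
    then show "(\<lambda>x. nat \<lfloor>fst x * (2 :: real) ^ n\<rfloor>) \<in> borel \<Otimes>\<^sub>M path_space \<rightarrow>\<^sub>M count_space UNIV"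
      by (rule measurable_compose) simp
  qed
  then show ?thesis unfolding eval_path_def by (intro borel_measurable_liminf)
qed

lemma measurable_path[measurable]:
  "jump_process M Z \<Longrightarrow> path Z \<in> M \<rightarrow>\<^sub>M path_space"
  unfolding jump_process_def path_def path_space_def by (intro measurable_restrict) auto

text \<open>The \<open>+ 1\<close> places the dyadic times strictly to the right of
  \<open>s\<close>, even when \<open>s\<close> is dyadic itself, and within
  \<open>(1 / 2) ^ n\<close> of it. The punctured filter \<open>at_right s\<close> requires this
  strictness.\<close>

lemma dyadic_at_right:
  assumes "0 \<le> s"
  shows "filterlim (\<lambda>n. real (nat \<lfloor>s * 2 ^ n\<rfloor> + 1) / 2 ^ n) (at_right s) sequentially"
  unfolding filterlim_at
proof
  let ?q = "\<lambda>n. real (nat \<lfloor>s * 2 ^ n\<rfloor> + 1) / 2 ^ n"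
  have q: "s < ?q n" "?q n \<le> s + (1 / 2) ^ n" for n
  proof -
    have "0 \<le> \<lfloor>s * 2 ^ n\<rfloor>" using assms by simp
    then have "real (nat \<lfloor>s * 2 ^ n\<rfloor> + 1) = of_int \<lfloor>s * 2 ^ n\<rfloor> + 1" by simp
    with floor_correct[of "s * 2 ^ n"]
    have *: "s * 2 ^ n < real (nat \<lfloor>s * 2 ^ n\<rfloor> + 1)" "real (nat \<lfloor>s * 2 ^ n\<rfloor> + 1) \<le> s * 2 ^ n + 1"
      by linarith+
    from *(1) show "s < ?q n" by (subst pos_less_divide_eq) auto
    have "?q n \<le> (s * 2 ^ n + 1) / 2 ^ n" using *(2) by (rule divide_right_mono) simp
    also have "\<dots> = s + (1 / 2) ^ n" by (simp add: add_divide_distrib power_one_over)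
    finally show "?q n \<le> s + (1 / 2) ^ n" .
  qed
  show "\<forall>\<^sub>F n in sequentially. ?q n \<in> {s<..} \<and> ?q n \<noteq> s"
    using q(1) by (intro always_eventually allI conjI) (auto simp: less_imp_neq[symmetric] intro: less_imp_neq[THEN not_sym])
  show "?q \<longlonglongrightarrow> s"
  proof (rule tendsto_sandwich[where f = "\<lambda>_. s" and h = "\<lambda>n. s + (1 / 2) ^ n"])
    have "(\<lambda>n. s + (1 / 2 :: real) ^ n) \<longlonglongrightarrow> s + 0" by (intro tendsto_intros) auto
    then show "(\<lambda>n. s + (1 / 2) ^ n) \<longlonglongrightarrow> s" by simp
    show "\<forall>\<^sub>F n in sequentially. s \<le> ?q n"
      using q(1) by (intro always_eventually allI less_imp_le)
    show "\<forall>\<^sub>F n in sequentially. ?q n \<le> s + (1 / 2) ^ n"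
      using q(2) by (intro always_eventually allI)
  qed simp
qed

text \<open>A jump path is constant immediately to the right of \<open>s\<close>, so the liminf is
  taken of an eventually constant sequence.\<close>

lemma eval_path_eq:
  assumes Z: "jump_process M Z" and "\<omega> \<in> space M" "0 \<le> s"
  shows "eval_path j s (path Z \<omega>) = of_nat (Z s \<omega> j)"
  unfolding eval_path_def
proof (intro lim_imp_Liminf tendsto_eventually)
  have "\<forall>\<^sub>F r in at_right s. Z r \<omega> = Z s \<omega>" using assms unfolding jump_process_def by auto
  then have "\<forall>\<^sub>F n in sequentially. Z (real (nat \<lfloor>s * 2 ^ n\<rfloor> + 1) / 2 ^ n) \<omega> = Z s \<omega>"
    by (rule eventually_compose_filterlim[OF _ dyadic_at_right[OF \<open>0 \<le> s\<close>]])
  then show "\<forall>\<^sub>F n in sequentially. of_nat (path Z \<omega> (real (nat \<lfloor>s * 2 ^ n\<rfloor> + 1) / 2 ^ n) j) = (of_nat (Z s \<omega> j) :: ennreal)"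
    by eventually_elim (auto simp: path_def)
qed simp

text \<open>Independence of the generated \<sigma>-algebras makes the joint law a product, and
  Tonelli does the rest. The right-hand side, with a second sample \<open>\<omega>'\<close>, is the
  conditional expectation given \<open>X\<close> averaged over \<open>X\<close>.\<close>

lemma (in prob_space) nn_integral_indep_set:
  assumes ind: "indep_set (sets (vimage_algebra (space M) X S)) (sets (vimage_algebra (space M) Y T))"
    and [measurable]: "X \<in> M \<rightarrow>\<^sub>M S" "Y \<in> M \<rightarrow>\<^sub>M T" "F \<in> borel_measurable (S \<Otimes>\<^sub>M T)"
  shows "(\<integral>\<^sup>+\<omega>. F (X \<omega>, Y \<omega>) \<partial>M) = (\<integral>\<^sup>+\<omega>. (\<integral>\<^sup>+\<omega>'. F (X \<omega>, Y \<omega>') \<partial>M) \<partial>M)"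
proof -
  interpret X: prob_space "distr M S X" by (rule prob_space_distr) simp
  interpret Y: prob_space "distr M T Y" by (rule prob_space_distr) simp
  have joint: "distr M S X \<Otimes>\<^sub>M distr M T Y = distr M (S \<Otimes>\<^sub>M T) (\<lambda>\<omega>. (X \<omega>, Y \<omega>))"
  proof (rule pair_measure_eqI)
    show "sigma_finite_measure (distr M S X)" "sigma_finite_measure (distr M T Y)" by unfold_locales
    fix A B assume "A \<in> sets (distr M S X)" "B \<in> sets (distr M T Y)"
    then have [measurable]: "A \<in> sets S" "B \<in> sets T" by auto
    have "X -` A \<inter> space M \<in> sets (vimage_algebra (space M) X S)"
      "Y -` B \<inter> space M \<in> sets (vimage_algebra (space M) Y T)"
      by (auto intro: in_vimage_algebra)
    from indep_setD[OF ind this]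
    have "emeasure M ((X -` A \<inter> space M) \<inter> (Y -` B \<inter> space M)) =
        emeasure M (X -` A \<inter> space M) * emeasure M (Y -` B \<inter> space M)"
      by (simp only: emeasure_eq_measure ennreal_mult measure_nonneg)
    moreover have "(X -` A \<inter> space M) \<inter> (Y -` B \<inter> space M) = (\<lambda>\<omega>. (X \<omega>, Y \<omega>)) -` (A \<times> B) \<inter> space M"
      by auto
    ultimately show "emeasure (distr M S X) A * emeasure (distr M T Y) B =
        emeasure (distr M (S \<Otimes>\<^sub>M T) (\<lambda>\<omega>. (X \<omega>, Y \<omega>))) (A \<times> B)"
      by (simp add: emeasure_distr)
  qed simp
  have meas: "(\<lambda>x. \<integral>\<^sup>+y. F (x, y) \<partial>distr M T Y) \<in> borel_measurable S"
    by measurable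
  have "(\<integral>\<^sup>+\<omega>. F (X \<omega>, Y \<omega>) \<partial>M) = (\<integral>\<^sup>+p. F p \<partial>distr M (S \<Otimes>\<^sub>M T) (\<lambda>\<omega>. (X \<omega>, Y \<omega>)))"
    by (subst nn_integral_distr) auto
  also have "\<dots> = (\<integral>\<^sup>+p. F p \<partial>(distr M S X \<Otimes>\<^sub>M distr M T Y))"
    by (simp add: joint)
  also have "\<dots> = (\<integral>\<^sup>+x. \<integral>\<^sup>+y. F (x, y) \<partial>distr M T Y \<partial>distr M S X)"
    by (subst Y.nn_integral_fst[symmetric]) auto
  also have "\<dots> = (\<integral>\<^sup>+\<omega>. (\<integral>\<^sup>+y. F (X \<omega>, y) \<partial>distr M T Y) \<partial>M)"
    using meas by (subst nn_integral_distr) auto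
  also have "\<dots> = (\<integral>\<^sup>+\<omega>. (\<integral>\<^sup>+\<omega>'. F (X \<omega>, Y \<omega>') \<partial>M) \<partial>M)"
  proof (rule nn_integral_cong)
    fix \<omega> assume "\<omega> \<in> space M"
    then have [measurable]: "X \<omega> \<in> space S" by (rule measurable_space[OF assms(2)])
    show "(\<integral>\<^sup>+y. F (X \<omega>, y) \<partial>distr M T Y) = (\<integral>\<^sup>+\<omega>'. F (X \<omega>, Y \<omega>') \<partial>M)"
      by (subst nn_integral_distr) auto
  qed
  finally show ?thesis .
qed

section \<open>Averaging over the copies with the atoms frozen\<close>

abbreviation (input) atom_space :: "(enat \<times> (nat \<Rightarrow> real)) measure" where
  "atom_space \<equiv> count_space UNIV \<Otimes>\<^sub>M (\<Pi>\<^sub>M i\<in>UNIV. borel)"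

text \<open>
  Beyond the number of atoms the positions are set to 0, so that they do not carry
  any information that could depend on the copies.
\<close>

definition atom :: "('a \<Rightarrow> enat) \<Rightarrow> (nat \<Rightarrow> 'a \<Rightarrow> real) \<Rightarrow> nat \<Rightarrow> 'a \<Rightarrow> real" where
  "atom \<kappa> T k \<omega> = (if enat k < \<kappa> \<omega> then T k \<omega> else 0)"

lemma measurable_atom_count:
  "point_process M \<kappa> T \<Longrightarrow> Measurable.pred M (\<lambda>\<omega>. enat k < \<kappa> \<omega>)"
proof -
  assume "point_process M \<kappa> T"
  then have "\<kappa> \<in> M \<rightarrow>\<^sub>M count_space UNIV" by (simp add: point_process_def)
  moreover have "(\<lambda>n. enat k < n) \<in> count_space UNIV \<rightarrow>\<^sub>M count_space UNIV" by simp
  ultimately show ?thesis by (rule measurable_compose)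
qed

lemma measurable_atom:
  assumes "point_process M \<kappa> T"
  shows "atom \<kappa> T k \<in> borel_measurable M"
proof -
  note [measurable] = measurable_atom_count[OF assms]
  have [measurable]: "T k \<in> borel_measurable M" using assms by (simp add: point_process_def)
  show ?thesis unfolding atom_def[abs_def] by measurable
qed

lemma measurable_atoms:
  assumes "point_process M \<kappa> T"
  shows "(\<lambda>\<omega>. (\<kappa> \<omega>, \<lambda>i. atom \<kappa> T i \<omega>)) \<in> M \<rightarrow>\<^sub>M atom_space"
proof -
  have "\<kappa> \<in> M \<rightarrow>\<^sub>M count_space UNIV" using assms by (simp add: point_process_def)
  moreover have "(\<lambda>\<omega> i. atom \<kappa> T i \<omega>) \<in> M \<rightarrow>\<^sub>M (\<Pi>\<^sub>M i\<in>UNIV. borel)"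
    by (intro measurable_abs_UNIV measurable_atom assms)
  ultimately show ?thesis by simp
qed

context
  fixes M :: "'a measure" and M' :: "'b measure" and \<kappa> :: "'a \<Rightarrow> enat" and T :: "nat \<Rightarrow> 'a \<Rightarrow> real"
    and Zx :: "real \<Rightarrow> 'b \<Rightarrow> 'd::finite \<Rightarrow> nat" and C :: "nat \<Rightarrow> real \<Rightarrow> 'a \<Rightarrow> 'd \<Rightarrow> nat"
  assumes M: "prob_space M" and PP: "point_process M \<kappa> T"
    and iid: "iid_copies M' Zx M C" and indep: "independent_of_atoms M \<kappa> T C"
begin

interpretation prob_space M by (rule M)

abbreviation (input) "path_law \<equiv> distr M' path_space (path Zx)"

lemma measurable_copies: "(\<lambda>\<omega> k. path (C k) \<omega>) \<in> M \<rightarrow>\<^sub>M (\<Pi>\<^sub>M k\<in>UNIV. path_space)"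
  using iid by (intro measurable_abs_UNIV measurable_path) (simp add: iid_copies_def)

lemma nn_integral_atoms_paths:
  assumes [measurable]: "F \<in> borel_measurable (atom_space \<Otimes>\<^sub>M (\<Pi>\<^sub>M k\<in>UNIV. path_space))"
  shows "(\<integral>\<^sup>+\<omega>. F ((\<kappa> \<omega>, \<lambda>i. atom \<kappa> T i \<omega>), \<lambda>k. path (C k) \<omega>) \<partial>M) =
    (\<integral>\<^sup>+\<omega>. \<integral>\<^sup>+\<omega>'. F ((\<kappa> \<omega>, \<lambda>i. atom \<kappa> T i \<omega>), \<lambda>k. path (C k) \<omega>') \<partial>M \<partial>M)"
  using indep measurable_atoms[OF PP] measurable_copies unfolding independent_of_atoms_def
  by (intro nn_integral_indep_set) (auto simp: atom_def)

lemma distr_copy: "distr M path_space (path (C m)) = path_law"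
  and measurable_copy: "path (C m) \<in> M \<rightarrow>\<^sub>M path_space"
  using iid by (auto simp: iid_copies_def measurable_path)

lemma prob_space_path_law: "prob_space path_law"
  using prob_space_distr[OF measurable_copy] distr_copy by metis

lemma nn_integral_atoms_copy:
  assumes F[measurable]: "F \<in> borel_measurable (atom_space \<Otimes>\<^sub>M path_space)"
  shows "(\<integral>\<^sup>+\<omega>. F ((\<kappa> \<omega>, \<lambda>i. atom \<kappa> T i \<omega>), path (C k) \<omega>) \<partial>M) =
    (\<integral>\<^sup>+\<omega>. (\<integral>\<^sup>+p. F ((\<kappa> \<omega>, \<lambda>i. atom \<kappa> T i \<omega>), p) \<partial>path_law) \<partial>M)"
proof -
  have "(\<lambda>x. F (fst x, snd x k)) \<in> borel_measurable (atom_space \<Otimes>\<^sub>M (\<Pi>\<^sub>M k\<in>UNIV. path_space))"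
    by measurable
  from nn_integral_atoms_paths[OF this]
  have "(\<integral>\<^sup>+\<omega>. F ((\<kappa> \<omega>, \<lambda>i. atom \<kappa> T i \<omega>), path (C k) \<omega>) \<partial>M) =
    (\<integral>\<^sup>+\<omega>. (\<integral>\<^sup>+\<omega>'. F ((\<kappa> \<omega>, \<lambda>i. atom \<kappa> T i \<omega>), path (C k) \<omega>') \<partial>M) \<partial>M)" by simp
  also have "\<dots> = (\<integral>\<^sup>+\<omega>. (\<integral>\<^sup>+p. F ((\<kappa> \<omega>, \<lambda>i. atom \<kappa> T i \<omega>), p) \<partial>path_law) \<partial>M)"
  proof (rule nn_integral_cong)
    fix \<omega> assume "\<omega> \<in> space M"
    from measurable_space[OF measurable_atoms[OF PP] this]
    have "(\<lambda>p. F ((\<kappa> \<omega>, \<lambda>i. atom \<kappa> T i \<omega>), p)) \<in> borel_measurable path_space" by measurable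
    then show "(\<integral>\<^sup>+\<omega>'. F ((\<kappa> \<omega>, \<lambda>i. atom \<kappa> T i \<omega>), path (C k) \<omega>') \<partial>M) =
       (\<integral>\<^sup>+p. F ((\<kappa> \<omega>, \<lambda>i. atom \<kappa> T i \<omega>), p) \<partial>path_law)"
      unfolding distr_copy[of k, symmetric] by (subst nn_integral_distr) (auto intro: measurable_copy)
  qed
  finally show ?thesis .
qed

text \<open>Restricting the independent family to two disjoint singletons of indices gives an
  independent pair, whose joint law is the product of the marginals.\<close>

lemma distr_pair_copies:
  assumes "k \<noteq> l"
  shows "distr M (path_space \<Otimes>\<^sub>M path_space) (\<lambda>\<omega>. (path (C k) \<omega>, path (C l) \<omega>)) = path_law \<Otimes>\<^sub>M path_law"
proof -
  have "indep_vars (\<lambda>_. path_space) (\<lambda>k. path (C k)) UNIV"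
    using iid by (simp add: iid_copies_def)
  then have "indep_var (PiM {k} (\<lambda>_. path_space)) (\<lambda>\<omega>. restrict (\<lambda>i. path (C i) \<omega>) {k})
      (PiM {l} (\<lambda>_. path_space)) (\<lambda>\<omega>. restrict (\<lambda>i. path (C i) \<omega>) {l})"
    using \<open>k \<noteq> l\<close> by (intro indep_var_restrict) auto
  then have "indep_var path_space ((\<lambda>f. f k) \<circ> (\<lambda>\<omega>. restrict (\<lambda>i. path (C i) \<omega>) {k}))
      path_space ((\<lambda>f. f l) \<circ> (\<lambda>\<omega>. restrict (\<lambda>i. path (C i) \<omega>) {l}))"
    by (rule indep_var_compose) auto
  then have "indep_var path_space (path (C k)) path_space (path (C l))"
    by (simp add: comp_def)
  then show ?thesis by (simp add: indep_var_distribution_eq distr_copy)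
qed

text \<open>For \<open>k = l\<close> both arguments would be the same path and the inner double
  integral would be wrong. Pairs of indices are therefore treated separately on and off the
  diagonal.\<close>

lemma nn_integral_atoms_copies:
  assumes F[measurable]: "F \<in> borel_measurable (atom_space \<Otimes>\<^sub>M (path_space \<Otimes>\<^sub>M path_space))" and "k \<noteq> l"
  shows "(\<integral>\<^sup>+\<omega>. F ((\<kappa> \<omega>, \<lambda>i. atom \<kappa> T i \<omega>), (path (C k) \<omega>, path (C l) \<omega>)) \<partial>M) =
    (\<integral>\<^sup>+\<omega>. (\<integral>\<^sup>+p. \<integral>\<^sup>+q. F ((\<kappa> \<omega>, \<lambda>i. atom \<kappa> T i \<omega>), (p, q)) \<partial>path_law \<partial>path_law) \<partial>M)"
proof -
  interpret P: prob_space path_law by (rule prob_space_path_law)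
  have "(\<lambda>x. F (fst x, (snd x k, snd x l))) \<in> borel_measurable (atom_space \<Otimes>\<^sub>M (\<Pi>\<^sub>M k\<in>UNIV. path_space))"
    by measurable
  from nn_integral_atoms_paths[OF this]
  have "(\<integral>\<^sup>+\<omega>. F ((\<kappa> \<omega>, \<lambda>i. atom \<kappa> T i \<omega>), (path (C k) \<omega>, path (C l) \<omega>)) \<partial>M) =
    (\<integral>\<^sup>+\<omega>. (\<integral>\<^sup>+\<omega>'. F ((\<kappa> \<omega>, \<lambda>i. atom \<kappa> T i \<omega>), (path (C k) \<omega>', path (C l) \<omega>')) \<partial>M) \<partial>M)" by simp
  also have "\<dots> = (\<integral>\<^sup>+\<omega>. (\<integral>\<^sup>+p. \<integral>\<^sup>+q. F ((\<kappa> \<omega>, \<lambda>i. atom \<kappa> T i \<omega>), (p, q)) \<partial>path_law \<partial>path_law) \<partial>M)"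
  proof (rule nn_integral_cong)
    fix \<omega> assume "\<omega> \<in> space M"
    from measurable_space[OF measurable_atoms[OF PP] this]
    have F': "(\<lambda>y. F ((\<kappa> \<omega>, \<lambda>i. atom \<kappa> T i \<omega>), y)) \<in> borel_measurable (path_space \<Otimes>\<^sub>M path_space)"
      by measurable
    have "sets (path_law \<Otimes>\<^sub>M path_law) = sets (path_space \<Otimes>\<^sub>M path_space)"
      by (rule sets_pair_measure_cong) auto
    then have "(\<lambda>y. F ((\<kappa> \<omega>, \<lambda>i. atom \<kappa> T i \<omega>), y)) \<in> borel_measurable (path_law \<Otimes>\<^sub>M path_law)"
      using F' measurable_cong_sets by blast
    from P.nn_integral_fst[OF this]
    have "(\<integral>\<^sup>+p. \<integral>\<^sup>+q. F ((\<kappa> \<omega>, \<lambda>i. atom \<kappa> T i \<omega>), (p, q)) \<partial>path_law \<partial>path_law) =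
        (\<integral>\<^sup>+y. F ((\<kappa> \<omega>, \<lambda>i. atom \<kappa> T i \<omega>), y) \<partial>(path_law \<Otimes>\<^sub>M path_law))" by simp
    also have "\<dots> = (\<integral>\<^sup>+\<omega>'. F ((\<kappa> \<omega>, \<lambda>i. atom \<kappa> T i \<omega>), (path (C k) \<omega>', path (C l) \<omega>')) \<partial>M)"
      unfolding distr_pair_copies[OF \<open>k \<noteq> l\<close>, symmetric]
      using F' measurable_copy by (subst nn_integral_distr) auto
    finally show "(\<integral>\<^sup>+\<omega>'. F ((\<kappa> \<omega>, \<lambda>i. atom \<kappa> T i \<omega>), (path (C k) \<omega>', path (C l) \<omega>')) \<partial>M) =
        (\<integral>\<^sup>+p. \<integral>\<^sup>+q. F ((\<kappa> \<omega>, \<lambda>i. atom \<kappa> T i \<omega>), (p, q)) \<partial>path_law \<partial>path_law)" ..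
  qed
  finally show ?thesis .
qed

end

section \<open>Moment measures of determinantal processes\<close>

text \<open>The second-order remainder \<open>((1 - u) ^ n - 1 + n * u) / u\<^sup>2\<close>, written
  as a polynomial. In this form it makes sense at \<open>u = 0\<close>, and nonnegativity and
  comparison with the value at 0 hold term by term on \<open>[0, 1]\<close>.\<close>

definition pgf_remainder :: "nat \<Rightarrow> real \<Rightarrow> real" where
  "pgf_remainder n u = (\<Sum>m<n. \<Sum>k<m. (1 - u) ^ k)"

lemma power_one_minus_expansion:
  "(1 - u) ^ n = 1 - u * real n + u\<^sup>2 * pgf_remainder n u"
proof (induction n)
  case (Suc n)
  have "u * (\<Sum>k<n. (1 - u) ^ k) = 1 - (1 - u) ^ n"
    using one_diff_power_eq[of "1 - u" n] by simp
  then have "u\<^sup>2 * pgf_remainder (Suc n) u = u\<^sup>2 * pgf_remainder n u + u * (1 - (1 - u) ^ n)"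
    by (simp add: pgf_remainder_def distrib_left power2_eq_square mult.assoc)
  moreover have "u * (1 - (1 - u) ^ n) = u - u * (1 - u) ^ n" by (simp add: algebra_simps)
  moreover have "(1 - u) ^ Suc n = (1 - u) ^ n - u * (1 - u) ^ n" by (simp add: algebra_simps)
  moreover have "u * real (Suc n) = u * real n + u" by (simp add: algebra_simps)
  ultimately show ?case using Suc.IH by linarith
qed (simp add: pgf_remainder_def)

text \<open>At 0 every summand is 1, so the double sum counts the pairs \<open>k < m < n\<close>;
  its double is the number of ordered pairs of distinct elements.\<close>

lemma pgf_remainder_0: "2 * pgf_remainder n 0 = real (n * n - n)"
proof -
  have "2 * pgf_remainder n 0 + real n = real n * real n"
    by (induction n) (auto simp: pgf_remainder_def algebra_simps)
  moreover have "n \<le> n * n" by simp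
  ultimately show ?thesis by (simp add: of_nat_diff)
qed

lemma pgf_remainder_nonneg: "u \<le> 1 \<Longrightarrow> 0 \<le> pgf_remainder n u"
  unfolding pgf_remainder_def by (intro sum_nonneg zero_le_power) auto

lemma pgf_remainder_le: "0 \<le> u \<Longrightarrow> u \<le> 1 \<Longrightarrow> pgf_remainder n u \<le> pgf_remainder n 0"
  unfolding pgf_remainder_def by (intro sum_mono) (auto intro: power_le_one)

lemma pgf_remainder_tendsto:
  assumes "u \<longlonglongrightarrow> 0"
  shows "(\<lambda>i. pgf_remainder n (u i)) \<longlonglongrightarrow> pgf_remainder n 0"
  unfolding pgf_remainder_def by (intro tendsto_intros assms)

text \<open>
  The second factorial moment is read off a power series expansion of the generating function at 1.
\<close>

lemma (in prob_space) factorial_moment_from_series: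
  fixes N :: "'a \<Rightarrow> nat" and c :: "nat \<Rightarrow> real"
  assumes N[measurable]: "N \<in> M \<rightarrow>\<^sub>M count_space UNIV"
    and int: "integrable M (\<lambda>\<omega>. real (N \<omega>))" and c1: "c 1 = (\<integral>\<omega>. real (N \<omega>) \<partial>M)"
    and series: "\<And>u. 0 < u \<Longrightarrow> u < 1 \<Longrightarrow>
      (\<lambda>m. (- 1) ^ Suc m / fact (Suc m) * (u ^ Suc m * c (Suc m))) sums ((\<integral>\<omega>. (1 - u) ^ N \<omega> \<partial>M) - 1)"
  shows "(\<integral>\<^sup>+\<omega>. of_nat (N \<omega> * N \<omega> - N \<omega>) \<partial>M) = ennreal (c 2)"
proof -
  \<comment> \<open>The coefficients of the series after removal of its constant and linear terms
    and division by \<open>u\<^sup>2\<close>; the shift by two does not change the sign. In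
    particular \<open>b 0 = c 2 / 2\<close>.\<close>
  define b where "b m = (- 1) ^ m / fact (m + 2) * c (m + 2)" for m
  define \<phi> where "\<phi> x = (\<Sum>m. b m * x ^ m)" for x
  have meas[measurable]: "(\<lambda>\<omega>. real (N \<omega>)) \<in> borel_measurable M" "(\<lambda>\<omega>. pgf_remainder (N \<omega>) u) \<in> borel_measurable M"
    "(\<lambda>\<omega>. (1 - u) ^ N \<omega>) \<in> borel_measurable M" for u :: real
    by (rule measurable_compose[OF N], simp)+
  have intp: "integrable M (\<lambda>\<omega>. (1 - u) ^ N \<omega>)" if "0 < u" "u < 1" for u :: real
    by (rule integrable_const_bound[where B = 1]) (use that in \<open>auto intro!: AE_I2 power_le_one\<close>)
  have ps: "(\<lambda>m. b m * u ^ m) sums (\<integral>\<omega>. pgf_remainder (N \<omega>) u \<partial>M)"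
    and intg: "integrable M (\<lambda>\<omega>. pgf_remainder (N \<omega>) u)" if u: "0 < u" "u < 1" for u
  proof -
    have eq: "pgf_remainder (N \<omega>) u = ((1 - u) ^ N \<omega> - 1 + u * real (N \<omega>)) / u\<^sup>2" for \<omega>
      using power_one_minus_expansion[of u "N \<omega>"] u by (simp add: field_simps)
    show "integrable M (\<lambda>\<omega>. pgf_remainder (N \<omega>) u)"
      unfolding eq using intp[OF u] int by auto
    have "(\<integral>\<omega>. pgf_remainder (N \<omega>) u \<partial>M) = ((\<integral>\<omega>. (1 - u) ^ N \<omega> \<partial>M) - 1 + u * c 1) / u\<^sup>2"
      unfolding eq c1 using intp[OF u] int by (simp add: prob_space)
    \<comment> \<open>The term split off is \<open>- u * c 1\<close>. By \<open>c1\<close> it is the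
      linear term of the expansion of \<open>(1 - u) ^ N\<close> in expectation, so only the
      remainder is left.\<close>
    moreover have "(\<lambda>m. (- 1) ^ Suc (Suc m) / fact (Suc (Suc m)) * (u ^ Suc (Suc m) * c (Suc (Suc m)))) sums
       ((\<integral>\<omega>. (1 - u) ^ N \<omega> \<partial>M) - 1 - (- 1) ^ Suc 0 / fact (Suc 0) * (u ^ Suc 0 * c (Suc 0)))"
      using series[OF u] by (subst sums_Suc_iff) simp
    then have "(\<lambda>m. (- 1) ^ Suc (Suc m) / fact (Suc (Suc m)) * (u ^ Suc (Suc m) * c (Suc (Suc m))) / u\<^sup>2) sums
       (((\<integral>\<omega>. (1 - u) ^ N \<omega> \<partial>M) - 1 - (- 1) ^ Suc 0 / fact (Suc 0) * (u ^ Suc 0 * c (Suc 0))) / u\<^sup>2)"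
      by (rule sums_divide)
    moreover have "(- 1) ^ Suc (Suc m) / fact (Suc (Suc m)) * (u ^ Suc (Suc m) * c (Suc (Suc m))) / u\<^sup>2 = b m * u ^ m" for m
      using u by (simp add: b_def power2_eq_square del: fact_Suc)
    ultimately show "(\<lambda>m. b m * u ^ m) sums (\<integral>\<omega>. pgf_remainder (N \<omega>) u \<partial>M)"
      by (simp del: fact_Suc)
  qed
  \<comment> \<open>Convergence at the single point 1/2 gives convergence on a full neighbourhood of
    0, including arguments without a probabilistic meaning. Hence the power series tends to its
    constant coefficient at 0.\<close>
  have "summable (\<lambda>m. b m * (1 / 2) ^ m)" using ps[of "1 / 2"] by (auto simp: sums_iff)
  then have "(\<lambda>m. b m * x ^ m) sums \<phi> x" if "norm x < 1 / 2" for x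
    unfolding \<phi>_def using that by (intro summable_sums powser_inside[of b "1 / 2" x]) auto
  then have lim: "(\<phi> \<longlongrightarrow> b 0) (at 0)" by (intro powser_limit_0[where s = "1 / 2"]) auto
  define u :: "nat \<Rightarrow> real" where "u n = 1 / real (n + 2)" for n
  have u: "0 < u n" "u n < 1" for n by (auto simp: u_def)
  have u0: "u \<longlonglongrightarrow> 0"
    unfolding u_def using LIMSEQ_ignore_initial_segment[OF lim_1_over_n, of 2] by simp
  have "filterlim u (at 0) sequentially"
    unfolding filterlim_at using u0 u by (auto simp: less_imp_neq[symmetric])
  from filterlim_compose[OF lim this]
  have "(\<lambda>n. \<phi> (u n)) \<longlonglongrightarrow> b 0" .
  then have lim': "(\<lambda>n. ennreal (\<phi> (u n))) \<longlonglongrightarrow> ennreal (b 0)" by (rule tendsto_ennrealI)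
  have E: "(\<integral>\<^sup>+\<omega>. ennreal (pgf_remainder (N \<omega>) (u n)) \<partial>M) = ennreal (\<phi> (u n))" for n
    using intg[OF u] ps[OF u] pgf_remainder_nonneg[of "u n"] u[of n]
    by (subst nn_integral_eq_integral) (auto simp: \<phi>_def sums_iff)
  have "(\<integral>\<^sup>+\<omega>. ennreal (pgf_remainder (N \<omega>) 0) \<partial>M) = ennreal (b 0)"
  \<comment> \<open>The upper bound is Fatou along \<open>u n\<close>; the lower bound holds because
    the remainder at \<open>u n\<close> is at most the remainder at 0. Finiteness of the second
    moment is thus a conclusion.\<close>
  proof (rule antisym)
    have "(\<integral>\<^sup>+\<omega>. ennreal (pgf_remainder (N \<omega>) 0) \<partial>M) =
        (\<integral>\<^sup>+\<omega>. liminf (\<lambda>n. ennreal (pgf_remainder (N \<omega>) (u n))) \<partial>M)"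
      by (intro nn_integral_cong lim_imp_Liminf[symmetric] tendsto_ennrealI pgf_remainder_tendsto u0) simp
    also have "\<dots> \<le> liminf (\<lambda>n. \<integral>\<^sup>+\<omega>. ennreal (pgf_remainder (N \<omega>) (u n)) \<partial>M)"
      by (rule nn_integral_liminf) auto
    also have "\<dots> = ennreal (b 0)" unfolding E using lim' by (intro lim_imp_Liminf) auto
    finally show "(\<integral>\<^sup>+\<omega>. ennreal (pgf_remainder (N \<omega>) 0) \<partial>M) \<le> ennreal (b 0)" .
    show "ennreal (b 0) \<le> (\<integral>\<^sup>+\<omega>. ennreal (pgf_remainder (N \<omega>) 0) \<partial>M)"
    proof (rule LIMSEQ_le_const2[OF lim'], intro exI allI impI)
      fix n
      show "ennreal (\<phi> (u n)) \<le> (\<integral>\<^sup>+\<omega>. ennreal (pgf_remainder (N \<omega>) 0) \<partial>M)"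
        unfolding E[symmetric] using u[of n] less_imp_le
        by (intro nn_integral_mono ennreal_leI pgf_remainder_le) auto
    qed
  qed
  then have "2 * (\<integral>\<^sup>+\<omega>. ennreal (pgf_remainder (N \<omega>) 0) \<partial>M) = ennreal 2 * ennreal (b 0)" by simp
  also have "\<dots> = ennreal (c 2)"
    by (subst ennreal_mult'[symmetric]) (auto simp: b_def numeral_2_eq_2)
  also have "2 * (\<integral>\<^sup>+\<omega>. ennreal (pgf_remainder (N \<omega>) 0) \<partial>M) = (\<integral>\<^sup>+\<omega>. ennreal 2 * ennreal (pgf_remainder (N \<omega>) 0) \<partial>M)"
    by (subst nn_integral_cmult) auto
  also have "\<dots> = (\<integral>\<^sup>+\<omega>. of_nat (N \<omega> * N \<omega> - N \<omega>) \<partial>M)"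
    by (intro nn_integral_cong, subst ennreal_mult'[symmetric], simp)
       (simp only: pgf_remainder_0 ennreal_of_nat_eq_real_of_nat)
  finally show ?thesis .
qed

section \<open>Correlation functions of order one and two\<close>

lemma correlation_1: "correlation K 1 x = K (x 0) (x 0)"
  unfolding correlation_def by (subst det_single) auto

text \<open>The off-diagonal product is not yet a square: symmetry of the kernel is only assumed for
  nonnegative arguments, and here \<open>x\<close> is arbitrary.\<close>

lemma correlation_2: "correlation K 2 x = K (x 0) (x 0) * K (x 1) (x 1) - K (x 0) (x 1) * K (x 1) (x 0)"
proof -
  let ?A = "Matrix.mat 2 2 (\<lambda>(a, b). K (x a) (x b))"
  have "Determinant.det ?A = (\<Sum>j<2. ?A $$ (0, j) * cofactor ?A 0 j)"
    by (rule laplace_expansion_row) auto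
  also have "\<dots> = ?A $$ (0, 0) * cofactor ?A 0 0 + ?A $$ (0, 1) * cofactor ?A 0 1"
    by (simp add: numeral_2_eq_2)
  also have "cofactor ?A 0 0 = K (x 1) (x 1)"
    unfolding cofactor_def by (subst det_single) (auto simp: mat_delete_def)
  also have "cofactor ?A 0 1 = - K (x 1) (x 0)"
    unfolding cofactor_def by (subst det_single) (auto simp: mat_delete_def)
  finally show ?thesis by (simp add: correlation_def)
qed

text \<open>The vectors \<open>(d, - b)\<close> and \<open>(b, - a)\<close> evaluate the form to the
  determinant times \<open>d\<close> and times \<open>a\<close>. If both diagonal entries vanish,
  \<open>(1, b)\<close> and \<open>(1, - b)\<close> force \<open>b = 0\<close>.\<close>

lemma psd_two_by_two:
  fixes a b d :: real
  assumes "\<And>s t. 0 \<le> s * a * s + s * b * t + t * b * s + t * d * t"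
  shows "b * b \<le> a * d"
proof -
  have a: "0 \<le> a" using assms[of 1 0] by simp
  have d: "0 \<le> d" using assms[of 0 1] by simp
  show ?thesis
  proof (cases "a = 0 \<and> d = 0")
    case True
    then show ?thesis using assms[of 1 b] assms[of 1 "- b"] by simp
  next
    case False
    have "0 \<le> d * (a * d - b * b)" using assms[of d "- b"] by (simp add: algebra_simps)
    moreover have "0 \<le> a * (a * d - b * b)" using assms[of b "- a"] by (simp add: algebra_simps)
    ultimately show ?thesis using False a d by (auto simp: zero_le_mult_iff)
  qed
qed


lemma borel_nonnegI: "B \<in> sets borel \<Longrightarrow> B \<subseteq> {0..} \<Longrightarrow> B \<in> sets borel_nonneg"
  by (subst sets_restrict_space_iff) auto

lemma nn_integral_distinct_pairs:
  assumes "finite S"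
  shows "(\<integral>\<^sup>+p. of_bool (fst p \<noteq> snd p) * (indicator S (fst p) * indicator S (snd p)) \<partial>count_space UNIV) =
    (of_nat (card S * card S - card S) :: ennreal)"
proof -
  have "(\<integral>\<^sup>+p. of_bool (fst p \<noteq> snd p) * (indicator S (fst p) * indicator S (snd p)) \<partial>count_space UNIV) =
      (\<integral>\<^sup>+p. indicator (S \<times> S - Id_on S) p \<partial>count_space UNIV)"
    by (rule nn_integral_cong) (auto simp: indicator_def split: prod.splits)
  also have "\<dots> = of_nat (card (S \<times> S - Id_on S))"
    using assms by (simp add: emeasure_count_space)
  also have "card (S \<times> S - Id_on S) = card S * card S - card S"
  proof -
    have *: "Id_on S = (\<lambda>x. (x, x)) ` S" by (auto simp: Id_on_def)
    have "card (Id_on S) = card S" unfolding * by (rule card_image) (auto simp: inj_on_def)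
    moreover have "finite (Id_on S)" unfolding * using assms by simp
    ultimately show ?thesis by (subst card_Diff_subset) (auto simp: card_cartesian_product)
  qed
  finally show ?thesis .
qed

text \<open>Cutting both sides of a rectangle \<open>A \<times> B\<close> along
  \<open>A \<inter> B\<close> gives one square and three products of disjoint sets.\<close>

lemma sets_pair_square_or_disjoint:
  fixes X :: "'x measure"
  shows "sets (X \<Otimes>\<^sub>M X) =
    sigma_sets (space X \<times> space X) {A \<times> B | A B. A \<in> sets X \<and> B \<in> sets X \<and> (A = B \<or> A \<inter> B = {})}"
  (is "_ = sigma_sets ?\<Omega> ?E")
  unfolding sets_pair_measure
proof (rule sigma_sets_eqI)
  fix R assume "R \<in> {a \<times> b |a b. a \<in> sets X \<and> b \<in> sets X}"
  then obtain A B where R: "R = A \<times> B" and [simp]: "A \<in> sets X" "B \<in> sets X" by auto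
  have in_E: "A' \<times> B' \<in> sigma_sets ?\<Omega> ?E"
    if "A' \<in> sets X" "B' \<in> sets X" "A' = B' \<or> A' \<inter> B' = {}" for A' B'
    using that by (intro sigma_sets.Basic) blast
  have "R = ((A \<inter> B) \<times> (A \<inter> B) \<union> (A \<inter> B) \<times> (B - A)) \<union> ((A - B) \<times> (A \<inter> B) \<union> (A - B) \<times> (B - A))"
    unfolding R by auto
  also have "\<dots> \<in> sigma_sets ?\<Omega> ?E"
    by (intro sigma_sets_Un in_E sets.Int sets.Diff) auto
  finally show "R \<in> sigma_sets ?\<Omega> ?E" .
next
  fix R assume "R \<in> ?E"
  then show "R \<in> sigma_sets ?\<Omega> {a \<times> b |a b. a \<in> sets X \<and> b \<in> sets X}"
    by (intro sigma_sets.Basic) blast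
qed

text \<open>The two-point correlation function of a symmetric kernel, on pairs instead of families
  indexed by \<open>{..<2}\<close>, so that it can serve as a density with respect to
  \<open>\<Lambda> \<Otimes>\<^sub>M \<Lambda>\<close>.\<close>

definition pair_correlation :: "(real \<Rightarrow> real \<Rightarrow> real) \<Rightarrow> real \<times> real \<Rightarrow> real" where
  "pair_correlation K p = K (fst p) (fst p) * K (snd p) (snd p) - (K (fst p) (snd p))\<^sup>2"

section \<open>Consequences of the kernel axioms\<close>

context
  fixes \<Lambda> :: "real measure" and K :: "real \<Rightarrow> real \<Rightarrow> real"
  assumes kernel: "determinantal_kernel \<Lambda> K"
begin

lemma sets_intensity[measurable_cong]: "sets \<Lambda> = sets borel_nonneg"
  using kernel by (simp add: determinantal_kernel_def)

lemma space_intensity: "space \<Lambda> = {0..}"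
  using sets_eq_imp_space_eq[OF sets_intensity] by (simp add: space_restrict_space)

lemma kernel_nonneg: "0 \<le> x \<Longrightarrow> 0 \<le> y \<Longrightarrow> 0 \<le> K x y"
  and kernel_sym: "0 \<le> x \<Longrightarrow> 0 \<le> y \<Longrightarrow> K x y = K y x"
  using kernel unfolding determinantal_kernel_def by blast+

lemma measurable_kernel[measurable]:
  "(\<lambda>p. K (fst p) (snd p)) \<in> borel_measurable (borel_nonneg \<Otimes>\<^sub>M borel_nonneg)"
  using kernel by (simp add: determinantal_kernel_def split_beta')

lemma measurable_kernel_diag[measurable]: "(\<lambda>x. K x x) \<in> borel_measurable borel_nonneg"
proof -
  have "(\<lambda>x. (x, x)) \<in> borel_nonneg \<rightarrow>\<^sub>M borel_nonneg \<Otimes>\<^sub>M borel_nonneg" by simp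
  from measurable_compose[OF this measurable_kernel] show ?thesis by simp
qed

lemma sigma_finite_intensity: "sigma_finite_measure \<Lambda>"
proof
  have "{0..real n} \<in> sets \<Lambda>" for n :: nat
    unfolding sets_intensity by (intro borel_nonnegI) auto
  moreover have "emeasure \<Lambda> {0..real n} \<noteq> \<infinity>" for n :: nat
    using kernel calculation[of n] by (auto simp: determinantal_kernel_def less_top)
  moreover have "(\<Union>n::nat. {0..real n}) = space \<Lambda>"
    unfolding space_intensity using real_arch_simple by auto
  ultimately show "\<exists>A. countable A \<and> A \<subseteq> sets \<Lambda> \<and> \<Union> A = space \<Lambda> \<and> (\<forall>a\<in>A. emeasure \<Lambda> a \<noteq> \<infinity>)"
    by (intro exI[of _ "range (\<lambda>n::nat. {0..real n})"]) auto
qed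

interpretation \<Lambda>: sigma_finite_measure \<Lambda> by (rule sigma_finite_intensity)
interpretation \<Lambda>\<Lambda>: pair_sigma_finite \<Lambda> \<Lambda> ..
interpretation product_sigma_finite "\<lambda>_::nat. \<Lambda>" by unfold_locales

lemma sets_intensity_pair[measurable_cong]: "sets (\<Lambda> \<Otimes>\<^sub>M \<Lambda>) = sets (borel_nonneg \<Otimes>\<^sub>M borel_nonneg)"
  by (intro sets_pair_measure_cong sets_intensity)

lemma nn_integral_PiM_2:
  assumes "f \<in> borel_measurable (borel_nonneg \<Otimes>\<^sub>M borel_nonneg)"
  shows "(\<integral>\<^sup>+x. f (x 0, x 1) \<partial>(\<Pi>\<^sub>M a\<in>{..<2::nat}. \<Lambda>)) = (\<integral>\<^sup>+p. f p \<partial>(\<Lambda> \<Otimes>\<^sub>M \<Lambda>))"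
proof -
  have "f \<in> borel_measurable (\<Lambda> \<Otimes>\<^sub>M \<Lambda>)"
    using assms measurable_cong_sets[OF sets_intensity_pair refl] by blast
  then have "(\<integral>\<^sup>+x. f (x 0, x 1) \<partial>(\<Pi>\<^sub>M a\<in>{0,1::nat}. \<Lambda>)) = (\<integral>\<^sup>+p. f p \<partial>(\<Lambda> \<Otimes>\<^sub>M \<Lambda>))"
    using product_nn_integral_pair[of "\<lambda>x y. f (x, y)" 0 1] by (simp add: split_beta')
  moreover have "{..<2::nat} = {0, 1}" by auto
  ultimately show ?thesis by simp
qed

lemma nn_integral_PiM_1:
  assumes "f \<in> borel_measurable borel_nonneg"
  shows "(\<integral>\<^sup>+x. f (x 0) \<partial>(\<Pi>\<^sub>M a\<in>{..<1::nat}. \<Lambda>)) = (\<integral>\<^sup>+x. f x \<partial>\<Lambda>)"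
proof -
  have "f \<in> borel_measurable \<Lambda>"
    using assms measurable_cong_sets[OF sets_intensity refl] by blast
  then have "(\<integral>\<^sup>+x. f (x 0) \<partial>(\<Pi>\<^sub>M a\<in>{0::nat}. \<Lambda>)) = (\<integral>\<^sup>+x. f x \<partial>\<Lambda>)"
    using product_nn_integral_singleton[of f 0] by simp
  moreover have "{..<1::nat} = {0}" by auto
  ultimately show ?thesis by simp
qed

lemma measurable_pair_correlation[measurable]: "pair_correlation K \<in> borel_measurable (borel_nonneg \<Otimes>\<^sub>M borel_nonneg)"
proof -
  have [measurable]: "(\<lambda>p. K (fst p) (fst p)) \<in> borel_measurable (borel_nonneg \<Otimes>\<^sub>M borel_nonneg)"
    "(\<lambda>p. K (snd p) (snd p)) \<in> borel_measurable (borel_nonneg \<Otimes>\<^sub>M borel_nonneg)"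
    by (rule measurable_compose[OF _ measurable_kernel_diag], simp)+
  show ?thesis unfolding pair_correlation_def[abs_def] by measurable
qed

lemma correlation_2_pair_correlation:
  "x \<in> space (\<Pi>\<^sub>M a\<in>{..<2::nat}. \<Lambda>) \<Longrightarrow> correlation K 2 x = pair_correlation K (x 0, x 1)"
  using kernel_sym[of "x 1" "x 0"]
  by (auto simp: correlation_2 pair_correlation_def space_PiM space_intensity power2_eq_square PiE_iff)

lemma AE_pair_correlation_nonneg_PiM: "AE x in (\<Pi>\<^sub>M a\<in>{..<2::nat}. \<Lambda>). 0 \<le> pair_correlation K (x 0, x 1)"
proof -
  have "AE x in (\<Pi>\<^sub>M a\<in>{..<2::nat}. \<Lambda>). \<forall>c :: nat \<Rightarrow> real. 0 \<le> (\<Sum>a<2. \<Sum>b<2. c a * K (x a) (x b) * c b)"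
    using kernel unfolding determinantal_kernel_def by blast
  moreover have "AE x in (\<Pi>\<^sub>M a\<in>{..<2::nat}. \<Lambda>). x \<in> space (\<Pi>\<^sub>M a\<in>{..<2::nat}. \<Lambda>)" by (rule AE_space)
  ultimately show ?thesis
  proof eventually_elim
    fix x assume c: "\<forall>c :: nat \<Rightarrow> real. 0 \<le> (\<Sum>a<2. \<Sum>b<2. c a * K (x a) (x b) * c b)"
      and "x \<in> space (\<Pi>\<^sub>M a\<in>{..<2::nat}. \<Lambda>)"
    then have sym: "K (x 1) (x 0) = K (x 0) (x 1)"
      by (intro kernel_sym) (auto simp: space_PiM space_intensity PiE_iff)
    have "0 \<le> s * K (x 0) (x 0) * s + s * K (x 0) (x 1) * t + t * K (x 0) (x 1) * s + t * K (x 1) (x 1) * t" for s t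
      using c[THEN spec, of "\<lambda>a. if a = 0 then s else t"] by (simp add: numeral_2_eq_2 sym[simplified])
    from psd_two_by_two[OF this] show "0 \<le> pair_correlation K (x 0, x 1)" by (simp add: pair_correlation_def power2_eq_square)
  qed
qed

text \<open>The null set is carried from the indexed product to the product of pairs by an integral:
  the negative part integrates to 0 over the former, hence over the latter.\<close>

lemma AE_pair_correlation_nonneg: "AE p in \<Lambda> \<Otimes>\<^sub>M \<Lambda>. 0 \<le> pair_correlation K p"
proof -
  have "(\<integral>\<^sup>+x. ennreal (- pair_correlation K (x 0, x 1)) \<partial>(\<Pi>\<^sub>M a\<in>{..<2::nat}. \<Lambda>)) = (\<integral>\<^sup>+x. 0 \<partial>(\<Pi>\<^sub>M a\<in>{..<2::nat}. \<Lambda>))"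
    by (rule nn_integral_cong_AE) (use AE_pair_correlation_nonneg_PiM in eventually_elim, simp add: ennreal_neg)
  then have "(\<integral>\<^sup>+p. ennreal (- pair_correlation K p) \<partial>(\<Lambda> \<Otimes>\<^sub>M \<Lambda>)) = 0"
    using nn_integral_PiM_2[of "\<lambda>p. ennreal (- pair_correlation K p)"] by simp
  then have "AE p in \<Lambda> \<Otimes>\<^sub>M \<Lambda>. ennreal (- pair_correlation K p) = 0"
    by (subst (asm) nn_integral_0_iff_AE) auto
  then show ?thesis by eventually_elim (simp add: ennreal_eq_0_iff)
qed

lemma nn_integral_intensity_finite:
  assumes "B \<in> sets borel_nonneg" "bounded B"
  shows "(\<integral>\<^sup>+x. ennreal (K x x) * indicator B x \<partial>\<Lambda>) < \<infinity>"
  using kernel assms by (simp add: determinantal_kernel_def)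

text \<open>Dropping the subtracted square of the kernel only increases the density, and the
  integral of the diagonal terms factorizes.\<close>

lemma nn_integral_pair_correlation_finite:
  assumes B: "B \<in> sets borel_nonneg" "bounded B"
  shows "(\<integral>\<^sup>+p. ennreal (pair_correlation K p) * indicator (B \<times> B) p \<partial>(\<Lambda> \<Otimes>\<^sub>M \<Lambda>)) < \<infinity>"
proof -
  note [measurable] = B(1)
  let ?I = "\<integral>\<^sup>+x. ennreal (K x x) * indicator B x \<partial>\<Lambda>"
  have [measurable]: "(\<lambda>p. K (fst p) (fst p)) \<in> borel_measurable (\<Lambda> \<Otimes>\<^sub>M \<Lambda>)"
    "(\<lambda>p. K (snd p) (snd p)) \<in> borel_measurable (\<Lambda> \<Otimes>\<^sub>M \<Lambda>)"
    by (rule measurable_compose[OF _ measurable_kernel_diag], simp)+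
  have "(\<integral>\<^sup>+p. ennreal (pair_correlation K p) * indicator (B \<times> B) p \<partial>(\<Lambda> \<Otimes>\<^sub>M \<Lambda>)) \<le>
    (\<integral>\<^sup>+p. (ennreal (K (fst p) (fst p)) * indicator B (fst p)) * (ennreal (K (snd p) (snd p)) * indicator B (snd p)) \<partial>(\<Lambda> \<Otimes>\<^sub>M \<Lambda>))"
  proof (rule nn_integral_mono)
    fix p assume "p \<in> space (\<Lambda> \<Otimes>\<^sub>M \<Lambda>)"
    then have "0 \<le> fst p" "0 \<le> snd p" by (auto simp: space_pair_measure space_intensity)
    then have "ennreal (pair_correlation K p) \<le> ennreal (K (fst p) (fst p)) * ennreal (K (snd p) (snd p))"
      by (subst ennreal_mult[symmetric]) (auto simp: pair_correlation_def kernel_nonneg intro!: ennreal_leI)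
    then show "ennreal (pair_correlation K p) * indicator (B \<times> B) p \<le>
      (ennreal (K (fst p) (fst p)) * indicator B (fst p)) * (ennreal (K (snd p) (snd p)) * indicator B (snd p))"
      by (cases p) (auto simp: indicator_def)
  qed
  also have "\<dots> = (\<integral>\<^sup>+x. \<integral>\<^sup>+y. (ennreal (K x x) * indicator B x) * (ennreal (K y y) * indicator B y) \<partial>\<Lambda> \<partial>\<Lambda>)"
    by (subst \<Lambda>.nn_integral_fst[symmetric]) auto
  also have "\<dots> = ?I * ?I"
    by (simp add: nn_integral_cmult nn_integral_multc)
  also have "\<dots> < \<infinity>" using nn_integral_intensity_finite[OF B] by (simp add: ennreal_mult_less_top)
  finally show ?thesis .
qed


section \<open>Campbell formulas of first and second order\<close>

context
  fixes M :: "'a measure" and \<kappa> :: "'a \<Rightarrow> enat" and T :: "nat \<Rightarrow> 'a \<Rightarrow> real"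
  assumes M: "prob_space M" and process: "determinantal_process \<Lambda> K M \<kappa> T"
begin

interpretation prob_space M by (rule M)

lemma point_process: "point_process M \<kappa> T"
  using process by (simp add: determinantal_process_def)

lemmas measurable_active[measurable] = measurable_atom_count[OF point_process]

lemma atom_nonneg: "\<omega> \<in> space M \<Longrightarrow> 0 \<le> atom \<kappa> T k \<omega>"
  using point_process by (simp add: atom_def point_process_def)

lemma measurable_atom_nonneg[measurable]: "atom \<kappa> T k \<in> M \<rightarrow>\<^sub>M borel_nonneg"
  using measurable_atom[OF point_process] atom_nonneg
  by (intro measurable_restrict_space2) auto

text \<open>The random index set is replaced by all of \<open>nat\<close> with an indicator, so that
  sum and expectation can be exchanged.\<close>

lemma nn_integral_point_measure:
  assumes [measurable]: "g \<in> borel_measurable borel_nonneg" and \<omega>: "\<omega> \<in> space M"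
  shows "(\<integral>\<^sup>+x. g x \<partial>point_measure_of \<kappa> T \<omega>) =
    (\<integral>\<^sup>+k. of_bool (enat k < \<kappa> \<omega>) * g (atom \<kappa> T k \<omega>) \<partial>count_space UNIV)"
proof -
  have "(\<lambda>i. T i \<omega>) \<in> count_space {i. enat i < \<kappa> \<omega>} \<rightarrow>\<^sub>M borel_nonneg"
    using point_process \<omega> by (auto simp: point_process_def space_restrict_space)
  then have "(\<integral>\<^sup>+x. g x \<partial>point_measure_of \<kappa> T \<omega>) = (\<integral>\<^sup>+i. g (T i \<omega>) \<partial>count_space {i. enat i < \<kappa> \<omega>})"
    unfolding point_measure_of_def by (rule nn_integral_distr) simp
  also have "\<dots> = (\<integral>\<^sup>+k. of_bool (enat k < \<kappa> \<omega>) * g (atom \<kappa> T k \<omega>) \<partial>count_space UNIV)"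
    by (subst nn_integral_count_space_indicator)
       (auto intro!: nn_integral_cong simp: atom_def indicator_def)
  finally show ?thesis .
qed

lemma emeasure_point_measure:
  assumes "B \<in> sets borel_nonneg" "\<omega> \<in> space M"
  shows "emeasure (point_measure_of \<kappa> T \<omega>) B =
    (\<integral>\<^sup>+k. of_bool (enat k < \<kappa> \<omega>) * indicator B (atom \<kappa> T k \<omega>) \<partial>count_space UNIV)"
  using nn_integral_point_measure[of "indicator B" \<omega>] assms
  by (simp add: point_measure_of_def)

lemma intensities:
  assumes "\<And>a. a < n \<Longrightarrow> B a \<in> sets borel_nonneg" "disjoint_family_on B {..<n}"
  shows "(\<integral>\<^sup>+\<omega>. (\<Prod>a<n. \<integral>\<^sup>+k. of_bool (enat k < \<kappa> \<omega>) * indicator (B a) (atom \<kappa> T k \<omega>) \<partial>count_space UNIV) \<partial>M) =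
    (\<integral>\<^sup>+x. ennreal (correlation K n x) * (\<Prod>a<n. indicator (B a) (x a)) \<partial>(\<Pi>\<^sub>M a\<in>{..<n}. \<Lambda>))"
proof -
  have "(\<integral>\<^sup>+\<omega>. (\<Prod>a<n. \<integral>\<^sup>+k. of_bool (enat k < \<kappa> \<omega>) * indicator (B a) (atom \<kappa> T k \<omega>) \<partial>count_space UNIV) \<partial>M) =
      (\<integral>\<^sup>+\<omega>. (\<Prod>a<n. emeasure (point_measure_of \<kappa> T \<omega>) (B a)) \<partial>M)"
    by (intro nn_integral_cong prod.cong refl emeasure_point_measure[symmetric] assms) auto
  also have "\<dots> = (\<integral>\<^sup>+x\<in>Pi\<^sub>E {..<n} B. ennreal (correlation K n x) \<partial>(\<Pi>\<^sub>M a\<in>{..<n}. \<Lambda>))"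
    using process assms unfolding determinantal_process_def by blast
  also have "\<dots> = (\<integral>\<^sup>+x. ennreal (correlation K n x) * (\<Prod>a<n. indicator (B a) (x a)) \<partial>(\<Pi>\<^sub>M a\<in>{..<n}. \<Lambda>))"
  proof (rule nn_integral_cong)
    fix x assume "x \<in> space (\<Pi>\<^sub>M a\<in>{..<n}. \<Lambda>)"
    then have x: "x \<in> extensional {..<n}" by (auto simp: space_PiM PiE_def)
    show "ennreal (correlation K n x) * indicator (Pi\<^sub>E {..<n} B) x =
      ennreal (correlation K n x) * (\<Prod>a<n. indicator (B a) (x a))"
    proof (cases "x \<in> Pi\<^sub>E {..<n} B")
      case True
      then have "(\<Prod>a<n. indicator (B a) (x a)) = (1 :: ennreal)"
        by (intro prod.neutral) (auto simp: PiE_iff)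
      with True show ?thesis by simp
    next
      case False
      with x obtain a where "a < n" "x a \<notin> B a" by (auto simp: PiE_iff)
      then have "(\<Prod>a<n. indicator (B a) (x a)) = (0 :: ennreal)"
        by (intro prod_zero) (auto intro!: bexI[of _ a])
      with False show ?thesis by simp
    qed
  qed
  finally show ?thesis .
qed

text \<open>The intensity measure of a family of random points, each of which may be absent.\<close>

definition intensity_measure :: "'x measure \<Rightarrow> ('c \<Rightarrow> 'a \<Rightarrow> bool) \<Rightarrow> ('c \<Rightarrow> 'a \<Rightarrow> 'x) \<Rightarrow> 'x measure" where
  "intensity_measure X P S =
    distr (density (count_space UNIV \<Otimes>\<^sub>M M) (\<lambda>(c, \<omega>). of_bool (P c \<omega>))) X (\<lambda>(c, \<omega>). S c \<omega>)"

lemma nn_integral_intensity_measure: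
  fixes P :: "'c::countable \<Rightarrow> 'a \<Rightarrow> bool"
  assumes P: "\<And>c. Measurable.pred M (P c)" and S: "\<And>c. S c \<in> M \<rightarrow>\<^sub>M X"
    and [measurable]: "h \<in> borel_measurable X"
  shows "(\<integral>\<^sup>+x. h x \<partial>intensity_measure X P S) =
    (\<integral>\<^sup>+\<omega>. (\<integral>\<^sup>+c. of_bool (P c \<omega>) * h (S c \<omega>) \<partial>count_space UNIV) \<partial>M)"
proof -
  interpret C: sigma_finite_measure "count_space (UNIV :: 'c set)"
    by (intro sigma_finite_measure_count_space_countable) auto
  interpret pair_sigma_finite "count_space (UNIV :: 'c set)" M ..
  note P[measurable] S[measurable]
  have [measurable]: "(\<lambda>(c, \<omega>). of_bool (P c \<omega>) :: ennreal) \<in> borel_measurable (count_space UNIV \<Otimes>\<^sub>M M)"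
    unfolding of_bool_def by (rule measurable_pair_measure_countable1) auto
  have [measurable]: "(\<lambda>(c, \<omega>). S c \<omega>) \<in> count_space UNIV \<Otimes>\<^sub>M M \<rightarrow>\<^sub>M X"
    by (rule measurable_pair_measure_countable1) auto
  have "(\<integral>\<^sup>+x. h x \<partial>intensity_measure X P S) =
      (\<integral>\<^sup>+p. (\<lambda>(c, \<omega>). of_bool (P c \<omega>)) p * h ((\<lambda>(c, \<omega>). S c \<omega>) p) \<partial>(count_space UNIV \<Otimes>\<^sub>M M))"
    unfolding intensity_measure_def by (subst nn_integral_distr, simp, simp, subst nn_integral_density) auto
  also have "\<dots> = (\<integral>\<^sup>+\<omega>. (\<integral>\<^sup>+c. of_bool (P c \<omega>) * h (S c \<omega>) \<partial>count_space UNIV) \<partial>M)"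
    by (subst nn_integral_snd[symmetric]) (auto simp: split_beta')
  finally show ?thesis .
qed

lemma sets_intensity_measure[simp, measurable_cong]: "sets (intensity_measure X P S) = sets X"
  by (simp add: intensity_measure_def)

text \<open>A family of one set is disjoint, so the joint intensity with \<open>n = 1\<close> covers
  every measurable set. The two measures coincide outright, and the formula follows for all
  \<open>h\<close> at once.\<close>

theorem first_Campbell:
  assumes h: "h \<in> borel_measurable borel_nonneg"
  shows "(\<integral>\<^sup>+\<omega>. (\<integral>\<^sup>+k. of_bool (enat k < \<kappa> \<omega>) * h (atom \<kappa> T k \<omega>) \<partial>count_space UNIV) \<partial>M) =
    (\<integral>\<^sup>+x. ennreal (K x x) * h x \<partial>\<Lambda>)"
proof -
  have "intensity_measure borel_nonneg (\<lambda>k \<omega>. enat k < \<kappa> \<omega>) (atom \<kappa> T) = density \<Lambda> (\<lambda>x. ennreal (K x x))"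
  proof (rule measure_eqI)
    fix B assume "B \<in> sets (intensity_measure borel_nonneg (\<lambda>k \<omega>. enat k < \<kappa> \<omega>) (atom \<kappa> T))"
    then have B[measurable]: "B \<in> sets borel_nonneg" by simp
    have "emeasure (intensity_measure borel_nonneg (\<lambda>k \<omega>. enat k < \<kappa> \<omega>) (atom \<kappa> T)) B =
        (\<integral>\<^sup>+\<omega>. (\<integral>\<^sup>+k. of_bool (enat k < \<kappa> \<omega>) * indicator B (atom \<kappa> T k \<omega>) \<partial>count_space UNIV) \<partial>M)"
      by (subst nn_integral_indicator[symmetric], simp, subst nn_integral_intensity_measure) auto
    also have "\<dots> = (\<integral>\<^sup>+x. ennreal (K (x 0) (x 0)) * indicator B (x 0) \<partial>(\<Pi>\<^sub>M a\<in>{..<1::nat}. \<Lambda>))"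
      using intensities[of 1 "\<lambda>_. B"] B by (simp add: correlation_1[unfolded One_nat_def] disjoint_family_on_def)
    also have "\<dots> = (\<integral>\<^sup>+x. ennreal (K x x) * indicator B x \<partial>\<Lambda>)"
      by (rule nn_integral_PiM_1[of "\<lambda>x. ennreal (K x x) * indicator B x"]) measurable
    also have "\<dots> = emeasure (density \<Lambda> (\<lambda>x. ennreal (K x x))) B"
      by (subst emeasure_density) auto
    finally show "emeasure (intensity_measure borel_nonneg (\<lambda>k \<omega>. enat k < \<kappa> \<omega>) (atom \<kappa> T)) B =
        emeasure (density \<Lambda> (\<lambda>x. ennreal (K x x))) B" .
  qed (simp add: sets_intensity)
  then have "(\<integral>\<^sup>+x. h x \<partial>intensity_measure borel_nonneg (\<lambda>k \<omega>. enat k < \<kappa> \<omega>) (atom \<kappa> T)) =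
      (\<integral>\<^sup>+x. h x \<partial>density \<Lambda> (\<lambda>x. ennreal (K x x)))" by simp
  with h show ?thesis
    by (subst (asm) nn_integral_intensity_measure, simp, simp, simp, subst (asm) nn_integral_density) auto
qed


lemma intensity_disjoint:
  assumes A[measurable]: "A \<in> sets borel_nonneg" and B[measurable]: "B \<in> sets borel_nonneg" and "A \<inter> B = {}"
  shows "(\<integral>\<^sup>+\<omega>. (\<integral>\<^sup>+k. of_bool (enat k < \<kappa> \<omega>) * indicator A (atom \<kappa> T k \<omega>) \<partial>count_space UNIV) *
      (\<integral>\<^sup>+l. of_bool (enat l < \<kappa> \<omega>) * indicator B (atom \<kappa> T l \<omega>) \<partial>count_space UNIV) \<partial>M) =
    (\<integral>\<^sup>+p. ennreal (pair_correlation K p) * (indicator A (fst p) * indicator B (snd p)) \<partial>(\<Lambda> \<Otimes>\<^sub>M \<Lambda>))"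
proof -
  let ?B = "\<lambda>a::nat. if a = 0 then A else B"
  have two: "{..<2::nat} = {0, 1}" by auto
  have "disjoint_family_on ?B {..<2}" using \<open>A \<inter> B = {}\<close> by (auto simp: disjoint_family_on_def two)
  then have "(\<integral>\<^sup>+\<omega>. (\<Prod>a<2. \<integral>\<^sup>+k. of_bool (enat k < \<kappa> \<omega>) * indicator (?B a) (atom \<kappa> T k \<omega>) \<partial>count_space UNIV) \<partial>M) =
      (\<integral>\<^sup>+x. ennreal (correlation K 2 x) * (\<Prod>a<2. indicator (?B a) (x a)) \<partial>(\<Pi>\<^sub>M a\<in>{..<2::nat}. \<Lambda>))"
    by (intro intensities) auto
  also have "\<dots> = (\<integral>\<^sup>+x. ennreal (pair_correlation K (x 0, x 1)) * (indicator A (x 0) * indicator B (x 1)) \<partial>(\<Pi>\<^sub>M a\<in>{..<2::nat}. \<Lambda>))"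
    by (rule nn_integral_cong) (simp add: correlation_2_pair_correlation two)
  also have "\<dots> = (\<integral>\<^sup>+p. ennreal (pair_correlation K p) * (indicator A (fst p) * indicator B (snd p)) \<partial>(\<Lambda> \<Otimes>\<^sub>M \<Lambda>))"
    using nn_integral_PiM_2[of "\<lambda>p. ennreal (pair_correlation K p) * (indicator A (fst p) * indicator B (snd p))"] by simp
  finally show ?thesis by (simp add: two)
qed

text \<open>If \<open>D\<close> contains \<open>N\<close> atoms, counted with multiplicity, there
  are \<open>N * N - N\<close> ordered pairs of distinct indices with both atoms in
  \<open>D\<close>. The left-hand side is therefore a second factorial moment, also when atoms
  coincide.\<close>

lemma intensity_square:
  assumes D[measurable]: "D \<in> sets borel_nonneg" and "bounded D"
  shows "(\<integral>\<^sup>+\<omega>. (\<integral>\<^sup>+p. of_bool (fst p \<noteq> snd p \<and> enat (fst p) < \<kappa> \<omega> \<and> enat (snd p) < \<kappa> \<omega>) *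
      (indicator D (atom \<kappa> T (fst p) \<omega>) * indicator D (atom \<kappa> T (snd p) \<omega>)) \<partial>count_space UNIV) \<partial>M) =
    (\<integral>\<^sup>+p. ennreal (pair_correlation K p) * indicator (D \<times> D) p \<partial>(\<Lambda> \<Otimes>\<^sub>M \<Lambda>))"
proof -
  define S where "S \<omega> = {k. enat k < \<kappa> \<omega> \<and> atom \<kappa> T k \<omega> \<in> D}" for \<omega>
  define N where "N \<omega> = card (S \<omega>)" for \<omega>
  define \<Phi> where "\<Phi> \<omega> = (\<integral>\<^sup>+k. of_bool (enat k < \<kappa> \<omega>) * indicator D (atom \<kappa> T k \<omega>) \<partial>count_space UNIV :: ennreal)" for \<omega>
  define c where "c n = (\<integral>x. correlation K n x * (\<Prod>a<n. indicator D (x a)) \<partial>(\<Pi>\<^sub>M a\<in>{..<n}. \<Lambda>))" for n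
  have \<Phi>_meas[measurable]: "\<Phi> \<in> borel_measurable M"
    unfolding \<Phi>_def of_bool_def by (rule borel_measurable_nn_integral_count_space) auto
  have \<Phi>: "\<Phi> \<omega> = emeasure (count_space UNIV) (S \<omega>)" for \<omega>
  proof -
    have "\<Phi> \<omega> = (\<integral>\<^sup>+k. indicator (S \<omega>) k \<partial>count_space UNIV)"
      unfolding \<Phi>_def by (rule nn_integral_cong) (auto simp: S_def indicator_def)
    then show ?thesis by simp
  qed
  have \<Phi>_card: "\<Phi> \<omega> = of_nat (N \<omega>)" if "finite (S \<omega>)" for \<omega>
    using that by (simp add: \<Phi> N_def emeasure_count_space)
  \<comment> \<open>Measurability of the cardinality is inherited from \<Phi>. The defaults match:
    an infinite set has \<open>card\<close> 0 and \<open>enn2real\<close> maps \<infinity> to 0.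
    This case has probability 0 by the finite first moment.\<close>
  have N_eq: "N \<omega> = nat \<lfloor>enn2real (\<Phi> \<omega>)\<rfloor>" for \<omega>
    by (cases "finite (S \<omega>)") (auto simp: \<Phi> N_def emeasure_count_space)
  have N[measurable]: "N \<in> M \<rightarrow>\<^sub>M count_space UNIV"
  proof -
    have "(\<lambda>\<omega>. enn2real (\<Phi> \<omega>)) \<in> borel_measurable M" by measurable
    from measurable_compose[OF this measurable_real_floor]
    have "(\<lambda>\<omega>. nat \<lfloor>enn2real (\<Phi> \<omega>)\<rfloor>) \<in> M \<rightarrow>\<^sub>M count_space UNIV"
      by (rule measurable_compose) simp
    then show ?thesis unfolding N_eq[abs_def] .
  qed
  have E\<Phi>: "(\<integral>\<^sup>+\<omega>. \<Phi> \<omega> \<partial>M) = (\<integral>\<^sup>+x. ennreal (K x x) * indicator D x \<partial>\<Lambda>)"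
    unfolding \<Phi>_def by (rule first_Campbell) measurable
  have fin: "AE \<omega> in M. finite (S \<omega>)"
  proof -
    have "AE \<omega> in M. \<Phi> \<omega> \<noteq> \<infinity>"
      using nn_integral_intensity_finite[OF assms] by (intro nn_integral_noteq_infinite) (auto simp: E\<Phi> less_top)
    then show ?thesis by eventually_elim (auto simp: \<Phi> emeasure_count_space split: if_splits)
  qed
  have EN: "(\<integral>\<^sup>+\<omega>. ennreal (real (N \<omega>)) \<partial>M) = (\<integral>\<^sup>+x. ennreal (K x x) * indicator D x \<partial>\<Lambda>)"
    unfolding E\<Phi>[symmetric]
    by (rule nn_integral_cong_AE) (use fin in eventually_elim, simp add: \<Phi>_card ennreal_of_nat_eq_real_of_nat)
  have Nr[measurable]: "(\<lambda>\<omega>. real (N \<omega>)) \<in> borel_measurable M"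
    by (rule measurable_compose[OF N]) simp
  have intN: "integrable M (\<lambda>\<omega>. real (N \<omega>))"
    using nn_integral_intensity_finite[OF assms] by (intro integrableI_nonneg) (auto simp: EN)
  \<comment> \<open>Only the coefficients of order one and two are evaluated. The higher ones enter
    the series merely as numbers.\<close>
  have meas_c: "(\<lambda>x. correlation K n x * (\<Prod>a<n. indicator D (x a))) \<in> borel_measurable (\<Pi>\<^sub>M a\<in>{..<n}. \<Lambda>)"
    if "n = 1 \<or> n = 2" for n
  proof -
    have x: "(\<lambda>x. x a) \<in> (\<Pi>\<^sub>M a\<in>{..<n}. \<Lambda>) \<rightarrow>\<^sub>M borel_nonneg" if "a < n" for a
      using measurable_component_singleton[of a "{..<n}" "\<lambda>_. \<Lambda>"] that sets_intensity
      by (simp cong: measurable_cong_sets)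
    have k: "(\<lambda>x. K (x a) (x b)) \<in> borel_measurable (\<Pi>\<^sub>M a\<in>{..<n}. \<Lambda>)" if "a < n" "b < n" for a b
      using measurable_compose[OF measurable_Pair[OF x[OF that(1)] x[OF that(2)]] measurable_kernel] by simp
    have "(\<lambda>x. correlation K n x) \<in> borel_measurable (\<Pi>\<^sub>M a\<in>{..<n}. \<Lambda>)"
      using that
    proof
      assume n: "n = 1"
      show ?thesis unfolding n correlation_1 using k[of 0 0] by (simp add: n)
    next
      assume n: "n = 2"
      have "(\<lambda>x. K (x 0) (x 0) * K (x 1) (x 1) - K (x 0) (x 1) * K (x 1) (x 0))
          \<in> borel_measurable (\<Pi>\<^sub>M a\<in>{..<n}. \<Lambda>)"
        by (intro borel_measurable_diff borel_measurable_times k) (auto simp: n)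
      then show ?thesis by (simp only: n correlation_2)
    qed
    moreover have "(\<lambda>x. \<Prod>a<n. indicator D (x a) :: real) \<in> borel_measurable (\<Pi>\<^sub>M a\<in>{..<n}. \<Lambda>)"
      by (rule borel_measurable_prod, rule measurable_compose[OF x]) auto
    ultimately show ?thesis by (rule borel_measurable_times)
  qed
  have c1: "c 1 = (\<integral>\<omega>. real (N \<omega>) \<partial>M)"
  proof -
    have "c 1 = enn2real (\<integral>\<^sup>+x. ennreal (correlation K 1 x * (\<Prod>a<1. indicator D (x a))) \<partial>(\<Pi>\<^sub>M a\<in>{..<1::nat}. \<Lambda>))"
      unfolding c_def
    proof (rule integral_eq_nn_integral)
      show "AE x in Pi\<^sub>M {..<1::nat} (\<lambda>a. \<Lambda>). 0 \<le> correlation K 1 x * (\<Prod>a<1. indicator D (x a))"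
        by (rule AE_I2)
           (auto simp: correlation_1[unfolded One_nat_def] space_PiM space_intensity PiE_iff intro!: mult_nonneg_nonneg kernel_nonneg)
    qed (use meas_c[of 1] in simp)
    also have "(\<integral>\<^sup>+x. ennreal (correlation K 1 x * (\<Prod>a<1. indicator D (x a))) \<partial>(\<Pi>\<^sub>M a\<in>{..<1::nat}. \<Lambda>)) =
        (\<integral>\<^sup>+x. ennreal (K (x 0) (x 0)) * indicator D (x 0) \<partial>(\<Pi>\<^sub>M a\<in>{..<1::nat}. \<Lambda>))"
      by (rule nn_integral_cong) (simp add: correlation_1[unfolded One_nat_def] indicator_def)
    also have "\<dots> = (\<integral>\<^sup>+x. ennreal (K x x) * indicator D x \<partial>\<Lambda>)"
      by (rule nn_integral_PiM_1[of "\<lambda>x. ennreal (K x x) * indicator D x"]) measurable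
    finally show ?thesis
      using EN by (subst integral_eq_nn_integral) auto
  qed
  have c2: "ennreal (c 2) = (\<integral>\<^sup>+p. ennreal (pair_correlation K p) * indicator (D \<times> D) p \<partial>(\<Lambda> \<Otimes>\<^sub>M \<Lambda>))"
  proof -
    have "c 2 = enn2real (\<integral>\<^sup>+x. ennreal (correlation K 2 x * (\<Prod>a<2. indicator D (x a))) \<partial>(\<Pi>\<^sub>M a\<in>{..<2::nat}. \<Lambda>))"
      unfolding c_def
    proof (rule integral_eq_nn_integral)
      have "AE x in Pi\<^sub>M {..<2::nat} (\<lambda>a. \<Lambda>). x \<in> space (Pi\<^sub>M {..<2::nat} (\<lambda>a. \<Lambda>))" by (rule AE_space)
      with AE_pair_correlation_nonneg_PiM
      show "AE x in Pi\<^sub>M {..<2::nat} (\<lambda>a. \<Lambda>). 0 \<le> correlation K 2 x * (\<Prod>a<2. indicator D (x a))"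
        by eventually_elim (auto simp: correlation_2_pair_correlation intro!: mult_nonneg_nonneg prod_nonneg)
    qed (use meas_c[of 2] in simp)
    also have "(\<integral>\<^sup>+x. ennreal (correlation K 2 x * (\<Prod>a<2. indicator D (x a))) \<partial>(\<Pi>\<^sub>M a\<in>{..<2::nat}. \<Lambda>)) =
        (\<integral>\<^sup>+x. ennreal (pair_correlation K (x 0, x 1)) * indicator (D \<times> D) (x 0, x 1) \<partial>(\<Pi>\<^sub>M a\<in>{..<2::nat}. \<Lambda>))"
    proof (rule nn_integral_cong)
      have two: "{..<2::nat} = {0, 1}" by auto
      fix x assume "x \<in> space (\<Pi>\<^sub>M a\<in>{..<2::nat}. \<Lambda>)"
      then show "ennreal (correlation K 2 x * (\<Prod>a<2. indicator D (x a))) =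
          ennreal (pair_correlation K (x 0, x 1)) * indicator (D \<times> D) (x 0, x 1)"
        by (simp add: correlation_2_pair_correlation two indicator_def)
    qed
    also have "\<dots> = (\<integral>\<^sup>+p. ennreal (pair_correlation K p) * indicator (D \<times> D) p \<partial>(\<Lambda> \<Otimes>\<^sub>M \<Lambda>))"
      by (rule nn_integral_PiM_2[of "\<lambda>p. ennreal (pair_correlation K p) * indicator (D \<times> D) p"]) measurable
    finally show ?thesis using nn_integral_pair_correlation_finite[OF assms] by simp
  qed
  have "(\<lambda>m. (- 1) ^ Suc m / fact (Suc m) * (u ^ Suc m * c (Suc m))) sums ((\<integral>\<omega>. (1 - u) ^ N \<omega> \<partial>M) - 1)"
    if u: "0 < u" "u < 1" for u
  proof -
    \<comment> \<open>This choice makes \<open>1 - exp (- f x)\<close> equal to \<open>u\<close> on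
      \<open>D\<close> and 0 elsewhere, while the exponential of minus the integral of
      \<open>f\<close> is \<open>(1 - u) ^ N\<close>: the Laplace functional becomes the generating
      function of the count.\<close>
    define f where "f x = (if x \<in> D then - ln (1 - u) else 0)" for x
    have f[measurable]: "f \<in> borel_measurable borel_nonneg"
      unfolding f_def by measurable
    have f_nonneg: "0 \<le> f x" for x using u by (simp add: f_def)
    obtain b where b: "x \<le> b" if "x \<in> D" for x
      using \<open>bounded D\<close> by (auto simp: bounded_iff abs_le_iff)
    have "\<forall>x>b. f x = 0" using b by (force simp: f_def)
    then have "(\<lambda>m. let n = Suc m in (- 1) ^ n / fact n *
           (\<integral>x. correlation K n x * (\<Prod>a<n. 1 - exp (- f (x a))) \<partial>(\<Pi>\<^sub>M a\<in>{..<n}. \<Lambda>)))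
        sums ((\<integral>\<omega>. exp_neg (\<integral>\<^sup>+x. ennreal (f x) \<partial>point_measure_of \<kappa> T \<omega>) \<partial>M) - 1)"
      using process f f_nonneg unfolding determinantal_process_def by blast
    moreover have "(\<integral>x. correlation K n x * (\<Prod>a<n. 1 - exp (- f (x a))) \<partial>(\<Pi>\<^sub>M a\<in>{..<n}. \<Lambda>)) = u ^ n * c n" for n
    proof -
      have "1 - exp (- f y) = u * indicator D y" for y using u by (simp add: f_def)
      then have "correlation K n x * (\<Prod>a<n. 1 - exp (- f (x a))) = u ^ n * (correlation K n x * (\<Prod>a<n. indicator D (x a)))" for x
        by (simp add: prod.distrib)
      then show ?thesis by (simp only: c_def integral_mult_right_zero)
    qed
    moreover have "(\<integral>\<omega>. exp_neg (\<integral>\<^sup>+x. ennreal (f x) \<partial>point_measure_of \<kappa> T \<omega>) \<partial>M) = (\<integral>\<omega>. (1 - u) ^ N \<omega> \<partial>M)"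
    proof -
      have I: "(\<integral>\<^sup>+x. ennreal (f x) \<partial>point_measure_of \<kappa> T \<omega>) = ennreal (- ln (1 - u)) * \<Phi> \<omega>" if "\<omega> \<in> space M" for \<omega>
      proof -
        have "(\<integral>\<^sup>+x. ennreal (f x) \<partial>point_measure_of \<kappa> T \<omega>) =
            (\<integral>\<^sup>+k. ennreal (- ln (1 - u)) * (of_bool (enat k < \<kappa> \<omega>) * indicator D (atom \<kappa> T k \<omega>)) \<partial>count_space UNIV)"
          using that by (subst nn_integral_point_measure) (auto intro!: nn_integral_cong simp: f_def indicator_def)
        also have "\<dots> = ennreal (- ln (1 - u)) * \<Phi> \<omega>" unfolding \<Phi>_def by (rule nn_integral_cmult) simp
        finally show ?thesis .
      qed
      have [measurable]: "exp_neg \<in> borel_measurable borel"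
        unfolding exp_neg_def[abs_def] by measurable
      have "(\<integral>\<omega>. exp_neg (\<integral>\<^sup>+x. ennreal (f x) \<partial>point_measure_of \<kappa> T \<omega>) \<partial>M) =
          (\<integral>\<omega>. exp_neg (ennreal (- ln (1 - u)) * \<Phi> \<omega>) \<partial>M)"
        by (rule Bochner_Integration.integral_cong) (auto simp: I)
      also have "\<dots> = (\<integral>\<omega>. (1 - u) ^ N \<omega> \<partial>M)"
      proof (rule integral_cong_AE)
        show "(\<lambda>\<omega>. (1 - u) ^ N \<omega>) \<in> borel_measurable M" by (rule measurable_compose[OF N]) simp
        show "AE \<omega> in M. exp_neg (ennreal (- ln (1 - u)) * \<Phi> \<omega>) = (1 - u) ^ N \<omega>"
          using fin
        proof eventually_elim
          case (elim \<omega>)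
          have "0 \<le> - ln (1 - u)" using u by simp
          then have "ennreal (- ln (1 - u)) * \<Phi> \<omega> = ennreal (- ln (1 - u) * real (N \<omega>))"
            unfolding \<Phi>_card[OF elim] ennreal_of_nat_eq_real_of_nat by (rule ennreal_mult'[symmetric])
          moreover have "0 \<le> - ln (1 - u) * real (N \<omega>)"
            using \<open>0 \<le> - ln (1 - u)\<close> by (intro mult_nonneg_nonneg) auto
          ultimately have "exp_neg (ennreal (- ln (1 - u)) * \<Phi> \<omega>) = exp (real (N \<omega>) * ln (1 - u))"
            by (simp only: exp_neg_def enn2real_ennreal) (simp add: mult.commute)
          also have "\<dots> = (1 - u) ^ N \<omega>" using u by (simp add: exp_of_nat_mult)
          finally show ?case .
        qed
      qed measurable
      finally show ?thesis .
    qed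
    ultimately show ?thesis by (simp only: Let_def)
  qed
  from factorial_moment_from_series[OF N intN c1 this]
  have "(\<integral>\<^sup>+\<omega>. of_nat (N \<omega> * N \<omega> - N \<omega>) \<partial>M) = (\<integral>\<^sup>+p. ennreal (pair_correlation K p) * indicator (D \<times> D) p \<partial>(\<Lambda> \<Otimes>\<^sub>M \<Lambda>))"
    by (simp add: c2)
  moreover have "(\<integral>\<^sup>+\<omega>. of_nat (N \<omega> * N \<omega> - N \<omega>) \<partial>M) =
    (\<integral>\<^sup>+\<omega>. (\<integral>\<^sup>+p. of_bool (fst p \<noteq> snd p \<and> enat (fst p) < \<kappa> \<omega> \<and> enat (snd p) < \<kappa> \<omega>) *
      (indicator D (atom \<kappa> T (fst p) \<omega>) * indicator D (atom \<kappa> T (snd p) \<omega>)) \<partial>count_space UNIV) \<partial>M)"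
  proof (rule nn_integral_cong_AE, use fin in eventually_elim)
    case (elim \<omega>)
    have "(\<integral>\<^sup>+p. of_bool (fst p \<noteq> snd p \<and> enat (fst p) < \<kappa> \<omega> \<and> enat (snd p) < \<kappa> \<omega>) *
      (indicator D (atom \<kappa> T (fst p) \<omega>) * indicator D (atom \<kappa> T (snd p) \<omega>)) \<partial>count_space UNIV) =
      (\<integral>\<^sup>+p. of_bool (fst p \<noteq> snd p) * (indicator (S \<omega>) (fst p) * indicator (S \<omega>) (snd p)) \<partial>count_space UNIV :: ennreal)"
      by (rule nn_integral_cong) (auto simp: S_def indicator_def)
    then show ?case by (simp only: nn_integral_distinct_pairs[OF elim] N_def)
  qed
  ultimately show ?thesis by simp
qed


text \<open>
  The squares and the products of disjoint sets form a generator closed under intersections. On the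
  former the measures agree by the Laplace functional, on the latter by the joint intensities.
\<close>

theorem second_Campbell:
  assumes W[measurable]: "W \<in> sets borel_nonneg" and "bounded W"
    and h[measurable]: "h \<in> borel_measurable (borel_nonneg \<Otimes>\<^sub>M borel_nonneg)"
  shows "(\<integral>\<^sup>+\<omega>. (\<integral>\<^sup>+p. of_bool (fst p \<noteq> snd p \<and> enat (fst p) < \<kappa> \<omega> \<and> enat (snd p) < \<kappa> \<omega> \<and>
        atom \<kappa> T (fst p) \<omega> \<in> W \<and> atom \<kappa> T (snd p) \<omega> \<in> W) *
      h (atom \<kappa> T (fst p) \<omega>, atom \<kappa> T (snd p) \<omega>) \<partial>count_space UNIV) \<partial>M) =
    (\<integral>\<^sup>+p. ennreal (pair_correlation K p) * indicator (W \<times> W) p * h p \<partial>(\<Lambda> \<Otimes>\<^sub>M \<Lambda>))"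
proof -
  \<comment> \<open>The window \<open>W\<close> is built into the condition on the pair, so that
    both measures compared below have finite total mass, as uniqueness on a generator
    demands.\<close>
  define P where "P p \<omega> \<longleftrightarrow> fst p \<noteq> snd p \<and> enat (fst p) < \<kappa> \<omega> \<and> enat (snd p) < \<kappa> \<omega> \<and>
        atom \<kappa> T (fst p) \<omega> \<in> W \<and> atom \<kappa> T (snd p) \<omega> \<in> W" for p :: "nat \<times> nat" and \<omega>
  define S where "S p \<omega> = (atom \<kappa> T (fst p) \<omega>, atom \<kappa> T (snd p) \<omega>)" for p \<omega>
  have P: "Measurable.pred M (P p)" for p
    unfolding P_def[abs_def] by measurable
  have S: "S p \<in> M \<rightarrow>\<^sub>M borel_nonneg \<Otimes>\<^sub>M borel_nonneg" for p
    unfolding S_def[abs_def] by measurable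
  let ?X = "borel_nonneg \<Otimes>\<^sub>M borel_nonneg"
  let ?\<mu> = "intensity_measure ?X P S"
  let ?\<nu> = "density (\<Lambda> \<Otimes>\<^sub>M \<Lambda>) (\<lambda>p. ennreal (pair_correlation K p) * indicator (W \<times> W) p)"
  let ?E = "{A \<times> B | A B. A \<in> sets borel_nonneg \<and> B \<in> sets borel_nonneg \<and> (A = B \<or> A \<inter> B = {})}"
  let ?\<Omega> = "space borel_nonneg \<times> space borel_nonneg"
  have \<nu>: "emeasure ?\<nu> R = (\<integral>\<^sup>+p. ennreal (pair_correlation K p) * indicator (W \<times> W) p * indicator R p \<partial>(\<Lambda> \<Otimes>\<^sub>M \<Lambda>))"
    if [measurable]: "R \<in> sets ?X" for R
    by (subst emeasure_density) (auto simp: sets_intensity_pair)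
  have \<mu>: "emeasure ?\<mu> R = (\<integral>\<^sup>+\<omega>. (\<integral>\<^sup>+p. of_bool (P p \<omega>) * indicator R (S p \<omega>) \<partial>count_space UNIV) \<partial>M)"
    if "R \<in> sets ?X" for R
    using that by (subst nn_integral_indicator[symmetric], simp, subst nn_integral_intensity_measure[OF P S]) auto
  have eq: "emeasure ?\<mu> (A \<times> B) = emeasure ?\<nu> (A \<times> B)"
    if [measurable]: "A \<in> sets borel_nonneg" "B \<in> sets borel_nonneg" and AB: "A = B \<or> A \<inter> B = {}" for A B
    using AB
  proof
    assume "A = B"
    have "emeasure ?\<mu> (A \<times> A) = (\<integral>\<^sup>+\<omega>. (\<integral>\<^sup>+p. of_bool (fst p \<noteq> snd p \<and> enat (fst p) < \<kappa> \<omega> \<and> enat (snd p) < \<kappa> \<omega>) *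
      (indicator (A \<inter> W) (atom \<kappa> T (fst p) \<omega>) * indicator (A \<inter> W) (atom \<kappa> T (snd p) \<omega>)) \<partial>count_space UNIV) \<partial>M)"
      by (subst \<mu>) (auto intro!: nn_integral_cong simp: P_def S_def indicator_def)
    also have "\<dots> = (\<integral>\<^sup>+p. ennreal (pair_correlation K p) * indicator ((A \<inter> W) \<times> (A \<inter> W)) p \<partial>(\<Lambda> \<Otimes>\<^sub>M \<Lambda>))"
      using \<open>bounded W\<close> by (intro intensity_square) (auto intro: bounded_subset)
    also have "\<dots> = emeasure ?\<nu> (A \<times> A)"
      by (subst \<nu>) (auto intro!: nn_integral_cong simp: indicator_def)
    finally show ?thesis using \<open>A = B\<close> by simp
  next
    assume disj: "A \<inter> B = {}"
    let ?a = "\<lambda>\<omega> k. of_bool (enat k < \<kappa> \<omega>) * indicator (A \<inter> W) (atom \<kappa> T k \<omega>) :: ennreal"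
    let ?b = "\<lambda>\<omega> k. of_bool (enat k < \<kappa> \<omega>) * indicator (B \<inter> W) (atom \<kappa> T k \<omega>) :: ennreal"
    have "emeasure ?\<mu> (A \<times> B) = (\<integral>\<^sup>+\<omega>. (\<integral>\<^sup>+p. ?a \<omega> (fst p) * ?b \<omega> (snd p) \<partial>count_space UNIV) \<partial>M)"
    proof (subst \<mu>)
      \<comment> \<open>Equal indices would put one atom into both \<open>A\<close> and
        \<open>B\<close>. For disjoint sets the restriction to distinct indices is automatic, and
        the double sum becomes a product of counts.\<close>
      have "of_bool (P p \<omega>) * indicator (A \<times> B) (S p \<omega>) = ?a \<omega> (fst p) * ?b \<omega> (snd p)" for p \<omega>
        using disj by (cases "fst p = snd p") (auto simp: P_def S_def indicator_def)
      then show "(\<integral>\<^sup>+\<omega>. (\<integral>\<^sup>+p. of_bool (P p \<omega>) * indicator (A \<times> B) (S p \<omega>) \<partial>count_space UNIV) \<partial>M) =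
          (\<integral>\<^sup>+\<omega>. (\<integral>\<^sup>+p. ?a \<omega> (fst p) * ?b \<omega> (snd p) \<partial>count_space UNIV) \<partial>M)" by simp
    qed simp
    also have "\<dots> = (\<integral>\<^sup>+\<omega>. (\<integral>\<^sup>+k. ?a \<omega> k \<partial>count_space UNIV) * (\<integral>\<^sup>+l. ?b \<omega> l \<partial>count_space UNIV) \<partial>M)"
      by (intro nn_integral_cong, subst nn_integral_fst_count_space[symmetric])
         (simp add: nn_integral_cmult nn_integral_multc)
    also have "\<dots> = (\<integral>\<^sup>+p. ennreal (pair_correlation K p) * (indicator (A \<inter> W) (fst p) * indicator (B \<inter> W) (snd p)) \<partial>(\<Lambda> \<Otimes>\<^sub>M \<Lambda>))"
      using disj by (intro intensity_disjoint) auto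
    also have "\<dots> = emeasure ?\<nu> (A \<times> B)"
      by (subst \<nu>) (auto intro!: nn_integral_cong simp: indicator_def)
    finally show ?thesis .
  qed
  have "?\<mu> = ?\<nu>"
  proof (rule measure_eqI_generator_eq[where E = ?E and \<Omega> = ?\<Omega> and A = "\<lambda>_. ?\<Omega>"])
    show "Int_stable ?E"
    proof (rule Int_stableI)
      fix R R' assume "R \<in> ?E" "R' \<in> ?E"
      then obtain A B A' B' where *: "R = A \<times> B" "R' = A' \<times> B'"
        "A \<in> sets borel_nonneg" "B \<in> sets borel_nonneg" "A' \<in> sets borel_nonneg" "B' \<in> sets borel_nonneg"
        "A = B \<or> A \<inter> B = {}" "A' = B' \<or> A' \<inter> B' = {}" by blast
      have "R \<inter> R' = (A \<inter> A') \<times> (B \<inter> B')" using * by auto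
      moreover have "A \<inter> A' = B \<inter> B' \<or> (A \<inter> A') \<inter> (B \<inter> B') = {}" using * by blast
      moreover have "A \<inter> A' \<in> sets borel_nonneg" "B \<inter> B' \<in> sets borel_nonneg"
        using * by auto
      ultimately show "R \<inter> R' \<in> ?E" by blast
    qed
    show "?E \<subseteq> Pow ?\<Omega>" using sets.sets_into_space by blast
    show "emeasure ?\<mu> R = emeasure ?\<nu> R" if "R \<in> ?E" for R using that eq by blast
    show "sets ?\<mu> = sigma_sets ?\<Omega> ?E" "sets ?\<nu> = sigma_sets ?\<Omega> ?E"
      using sets_pair_square_or_disjoint[of borel_nonneg]
      by (simp_all only: sets_density sets_intensity_measure sets_intensity_pair)
    show "range (\<lambda>_. ?\<Omega>) \<subseteq> ?E" by blast
    show "(\<Union>i::nat. ?\<Omega>) = ?\<Omega>" by simp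
    have top: "space borel_nonneg \<in> sets borel_nonneg" by (rule sets.top)
    have "emeasure ?\<mu> ?\<Omega> = emeasure ?\<nu> ?\<Omega>" by (rule eq[OF top top]) simp
    also have "\<dots> \<le> (\<integral>\<^sup>+p. ennreal (pair_correlation K p) * indicator (W \<times> W) p \<partial>(\<Lambda> \<Otimes>\<^sub>M \<Lambda>))"
      by (subst \<nu>, rule pair_measureI[OF top top])
        (auto intro!: nn_integral_mono simp: indicator_def)
    also have "\<dots> < \<infinity>" by (rule nn_integral_pair_correlation_finite) fact+
    finally show "emeasure ?\<mu> ?\<Omega> \<noteq> \<infinity>" for i :: nat by simp
  qed
  then have "(\<integral>\<^sup>+p. h p \<partial>?\<mu>) = (\<integral>\<^sup>+p. h p \<partial>?\<nu>)" by simp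
  then have "(\<integral>\<^sup>+\<omega>. (\<integral>\<^sup>+p. of_bool (P p \<omega>) * h (S p \<omega>) \<partial>count_space UNIV) \<partial>M) = (\<integral>\<^sup>+p. h p \<partial>?\<nu>)"
    by (simp only: nn_integral_intensity_measure[OF P S h])
  also have "\<dots> = (\<integral>\<^sup>+p. ennreal (pair_correlation K p) * indicator (W \<times> W) p * h p \<partial>(\<Lambda> \<Otimes>\<^sub>M \<Lambda>))"
    by (rule nn_integral_density) measurable
  finally show ?thesis by (simp only: P_def S_def)
qed

end

end

text \<open>
  Outside their context these rules have a premise on \<open>K\<close>, which the method \<open>measurable\<close> instantiates wrongly.
\<close>

declare measurable_active[measurable del] measurable_atom_nonneg[measurable del]
  measurable_kernel[measurable del] measurable_kernel_diag[measurable del] measurable_pair_correlation[measurable del]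

section \<open>Moments of the process with immigration\<close>

lemma nn_integral_diagonal:
  fixes F :: "'x::countable \<times> 'x \<Rightarrow> ennreal"
  shows "(\<integral>\<^sup>+p. of_bool (fst p = snd p) * F p \<partial>count_space UNIV) = (\<integral>\<^sup>+k. F (k, k) \<partial>count_space UNIV)"
proof -
  have "(\<integral>\<^sup>+l. of_bool (k = l) * F (k, l) \<partial>count_space UNIV) = F (k, k)" for k
    by (subst nn_integral_count_space'[of "{k}"]) auto
  then show ?thesis by (subst nn_integral_fst_count_space[symmetric]) simp
qed

lemma integral_eq_enn2real:
  fixes f :: "'x \<Rightarrow> real"
  assumes "f \<in> borel_measurable N" "AE x in N. 0 \<le> f x \<and> ennreal (f x) = G x" "(\<integral>\<^sup>+x. G x \<partial>N) < \<infinity>"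
  shows "integrable N f" "(\<integral>x. f x \<partial>N) = enn2real (\<integral>\<^sup>+x. G x \<partial>N)"
proof -
  have eq: "(\<integral>\<^sup>+x. ennreal (f x) \<partial>N) = (\<integral>\<^sup>+x. G x \<partial>N)"
    by (rule nn_integral_cong_AE) (use assms(2) in eventually_elim, simp)
  have nonneg: "AE x in N. 0 \<le> f x" using assms(2) by eventually_elim simp
  show "integrable N f" using assms(1,3) nonneg by (intro integrableI_nonneg) (auto simp: eq)
  show "(\<integral>x. f x \<partial>N) = enn2real (\<integral>\<^sup>+x. G x \<partial>N)"
    using integral_eq_nn_integral[OF assms(1) nonneg] by (simp add: eq)
qed

text \<open>Measurability is asked of \<open>G\<close> instead of \<open>f\<close>, because the
  integrands to which this is applied contain an expectation over \<open>M'\<close> at a time that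
  varies with the integration variable.\<close>

lemma integral_eq_enn2real':
  fixes f :: "'x \<Rightarrow> real"
  assumes "G \<in> borel_measurable N" "\<And>x. x \<in> space N \<Longrightarrow> 0 \<le> f x \<and> ennreal (f x) = G x" "(\<integral>\<^sup>+x. G x \<partial>N) < \<infinity>"
  shows "integrable N f" "(\<integral>x. f x \<partial>N) = enn2real (\<integral>\<^sup>+x. G x \<partial>N)"
proof -
  have "(\<lambda>x. enn2real (G x)) \<in> borel_measurable N" using assms(1) by measurable
  moreover have "f x = enn2real (G x)" if "x \<in> space N" for x
    using assms(2)[OF that] by (metis enn2real_ennreal)
  ultimately have f: "f \<in> borel_measurable N" using measurable_cong[of N f "\<lambda>x. enn2real (G x)"] by simp
  have "AE x in N. 0 \<le> f x \<and> ennreal (f x) = G x" by (rule AE_I2) (rule assms(2))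
  from integral_eq_enn2real[OF f this assms(3)]
  show "integrable N f" "(\<integral>x. f x \<partial>N) = enn2real (\<integral>\<^sup>+x. G x \<partial>N)" by auto
qed

context
  fixes \<mu> :: "'d::finite \<Rightarrow> real" and I :: "('d \<Rightarrow> nat) pmf" and \<nu> :: "'d \<Rightarrow> ('d \<Rightarrow> nat) pmf"
    and M' :: "'b measure" and Zx :: "real \<Rightarrow> 'b \<Rightarrow> 'd \<Rightarrow> nat"
    and \<Lambda> :: "real measure" and K :: "real \<Rightarrow> real \<Rightarrow> real"
    and M :: "'a measure" and \<kappa> :: "'a \<Rightarrow> enat" and T :: "nat \<Rightarrow> 'a \<Rightarrow> real"
    and C :: "nat \<Rightarrow> real \<Rightarrow> 'a \<Rightarrow> 'd \<Rightarrow> nat" and t :: real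
  assumes parameters: "branching_parameters \<mu> I \<nu>"
    and M': "prob_space M'" and branching: "branching_process \<mu> I \<nu> M' Zx"
    and kernel: "determinantal_kernel \<Lambda> K"
    and M: "prob_space M" and process: "determinantal_process \<Lambda> K M \<kappa> T"
    and iid: "iid_copies M' Zx M C" and indep: "independent_of_atoms M \<kappa> T C"
begin

interpretation M: prob_space M by (rule M)
interpretation M': prob_space M' by (rule M')
lemma jump_Zx: "jump_process M' Zx"
  using branching by (simp add: branching_process_def)

interpretation P: prob_space "path_law M' Zx"
  using M'.prob_space_distr[OF measurable_path[OF jump_Zx]] .
interpretation \<Lambda>: sigma_finite_measure \<Lambda> by (rule sigma_finite_intensity[OF kernel])
interpretation \<Lambda>\<Lambda>: pair_sigma_finite \<Lambda> \<Lambda> ..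

lemmas point_process' = point_process[OF kernel M process]
lemmas [measurable_cong] = sets_intensity[OF kernel] sets_intensity_pair[OF kernel]
lemmas [measurable] = measurable_atom_count[OF point_process'] measurable_atom[OF point_process']
  measurable_kernel[OF kernel] measurable_kernel_diag[OF kernel] measurable_pair_correlation[OF kernel]

lemma jump_C: "jump_process M (C k)"
  using iid by (simp add: iid_copies_def)

lemma measurable_Zx[measurable]: "0 \<le> s \<Longrightarrow> (\<lambda>\<omega>. real (Zx s \<omega> i)) \<in> borel_measurable M'"
  using jump_Zx unfolding jump_process_def by (auto intro: measurable_compose[of "Zx s"])

text \<open>The expectation is taken over the path law and through \<open>eval_path\<close>, since
  in this form it is measurable in the time \<open>s\<close>. For \<open>0 \<le> s\<close> it is the
  mean of \<open>Zx s\<close>.\<close>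

definition mean :: "'d \<Rightarrow> real \<Rightarrow> ennreal" where
  "mean i s = (\<integral>\<^sup>+p. eval_path i s p \<partial>path_law M' Zx)"

definition moment2 :: "'d \<Rightarrow> 'd \<Rightarrow> real \<Rightarrow> ennreal" where
  "moment2 i j s = (\<integral>\<^sup>+p. eval_path i s p * eval_path j s p \<partial>path_law M' Zx)"

lemma measurable_eval_path2[measurable]:
  "(\<lambda>x. eval_path (i :: 'd) (fst x) (snd x)) \<in> borel_measurable (borel \<Otimes>\<^sub>M path_law M' Zx)"
  using measurable_eval_path[of i] by (simp cong: measurable_cong_sets sets_pair_measure_cong)

lemma measurable_mean[measurable]: "mean i \<in> borel_measurable borel"
  using P.borel_measurable_nn_integral_fst[OF measurable_eval_path2[of i]]
  unfolding mean_def[abs_def] by simp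

lemma measurable_moment2[measurable]: "moment2 i j \<in> borel_measurable borel"
proof -
  have "(\<lambda>x. eval_path i (fst x) (snd x) * eval_path j (fst x) (snd x)) \<in>
      borel_measurable (borel \<Otimes>\<^sub>M path_law M' Zx)" by measurable
  from P.borel_measurable_nn_integral_fst[OF this]
  show ?thesis unfolding moment2_def[abs_def] by simp
qed

lemma measurable_eval_path_at: "eval_path (i :: 'd) s \<in> borel_measurable path_space"
proof -
  have "(\<lambda>p. (s, p)) \<in> path_space \<rightarrow>\<^sub>M borel \<Otimes>\<^sub>M path_space" by simp
  from measurable_compose[OF this measurable_eval_path] show ?thesis by simp
qed

lemma mean_eq: "0 \<le> s \<Longrightarrow> mean i s = (\<integral>\<^sup>+\<omega>. of_nat (Zx s \<omega> i) \<partial>M')"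
  unfolding mean_def using measurable_eval_path_at[of i s]
  by (subst nn_integral_distr[OF measurable_path[OF jump_Zx]])
     (auto intro!: nn_integral_cong simp: eval_path_eq[OF jump_Zx])

lemma moment2_eq: "0 \<le> s \<Longrightarrow> moment2 i j s = (\<integral>\<^sup>+\<omega>. of_nat (Zx s \<omega> i) * of_nat (Zx s \<omega> j) \<partial>M')"
  unfolding moment2_def using measurable_eval_path_at[of i s] measurable_eval_path_at[of j s]
  by (subst nn_integral_distr[OF measurable_path[OF jump_Zx]])
     (auto intro!: nn_integral_cong simp: eval_path_eq[OF jump_Zx])

lemma mean_bounded: "\<exists>B<\<infinity>. \<forall>s\<in>{0..t}. \<forall>i. mean i s \<le> B"
proof -
  obtain B where "B < \<infinity>" "\<forall>s\<in>{0..t}. \<forall>j. (\<integral>\<^sup>+\<omega>. of_nat (Zx s \<omega> j) \<partial>M') \<le> B"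
    using branching_process_first_moment_bounded[OF parameters branching] by blast
  then show ?thesis by (intro exI[of _ B]) (simp add: mean_eq)
qed

text \<open>The product is dominated by the sum of the squares. The horizon \<open>r\<close> is free
  because the bound is also used at arbitrary times beyond \<open>t\<close>.\<close>

lemma moment2_bounded:
  assumes "finite_second_moments I \<nu>"
  shows "\<exists>B<\<infinity>. \<forall>s\<in>{0..r}. \<forall>i j. moment2 i j s \<le> B"
proof -
  obtain B where B: "B < \<infinity>" "\<forall>s\<in>{0..r}. \<forall>j. (\<integral>\<^sup>+\<omega>. (of_nat (Zx s \<omega> j))\<^sup>2 \<partial>M') \<le> B"
    using branching_process_second_moment_bounded[OF parameters branching assms] by blast
  have "moment2 i j s \<le> B + B" if "s \<in> {0..r}" for i j s
  proof -
    have [measurable]: "(\<lambda>\<omega>. of_nat (Zx s \<omega> i) :: ennreal) \<in> borel_measurable M'" for i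
      using measurable_Zx[of s i] that by (simp add: ennreal_of_nat_eq_real_of_nat)
    have "moment2 i j s \<le> (\<integral>\<^sup>+\<omega>. (of_nat (Zx s \<omega> i))\<^sup>2 + (of_nat (Zx s \<omega> j))\<^sup>2 \<partial>M')"
      using that by (subst moment2_eq) (auto intro!: nn_integral_mono mult_le_squares_ennreal)
    also have "\<dots> = (\<integral>\<^sup>+\<omega>. (of_nat (Zx s \<omega> i))\<^sup>2 \<partial>M') + (\<integral>\<^sup>+\<omega>. (of_nat (Zx s \<omega> j))\<^sup>2 \<partial>M')"
      by (rule nn_integral_add) auto
    also have "\<dots> \<le> B + B" using B that by (intro add_mono) auto
    finally show ?thesis .
  qed
  moreover have "B + B < \<infinity>" using B by simp
  ultimately show ?thesis by blast
qed

lemma integral_Zx: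
  assumes "s \<in> {0..t}"
  shows "ennreal (\<integral>\<omega>. real (Zx s \<omega> i) \<partial>M') = mean i s"
proof -
  obtain B where "B < \<infinity>" "mean i s \<le> B" using mean_bounded assms by blast
  then have "mean i s < \<infinity>" by (rule le_less_trans[rotated])
  then show ?thesis
    using assms integral_eq_enn2real(2)[of "\<lambda>\<omega>. real (Zx s \<omega> i)" M' "\<lambda>\<omega>. of_nat (Zx s \<omega> i)"]
    by (simp add: mean_eq ennreal_of_nat_eq_real_of_nat)
qed

lemma Zx_second_moment:
  assumes "finite_second_moments I \<nu>" "0 \<le> s"
  shows "integrable M' (\<lambda>\<omega>. real (Zx s \<omega> i) * real (Zx s \<omega> j))"
    and "ennreal (\<integral>\<omega>. real (Zx s \<omega> i) * real (Zx s \<omega> j) \<partial>M') = moment2 i j s"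
proof -
  obtain B where "B < \<infinity>" "moment2 i j s \<le> B"
    using moment2_bounded[OF assms(1), of s] assms(2) by fastforce
  then have fin: "moment2 i j s < \<infinity>" by (rule le_less_trans[rotated])
  have "(\<lambda>\<omega>. real (Zx s \<omega> i) * real (Zx s \<omega> j)) \<in> borel_measurable M'"
    using assms(2) by measurable
  moreover have "AE \<omega> in M'. 0 \<le> real (Zx s \<omega> i) * real (Zx s \<omega> j) \<and>
      ennreal (real (Zx s \<omega> i) * real (Zx s \<omega> j)) = of_nat (Zx s \<omega> i) * of_nat (Zx s \<omega> j)"
    by (rule AE_I2) (simp add: ennreal_mult ennreal_of_nat_eq_real_of_nat)
  moreover have "(\<integral>\<^sup>+\<omega>. of_nat (Zx s \<omega> i) * of_nat (Zx s \<omega> j) \<partial>M') < \<infinity>"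
    using fin assms(2) by (simp add: moment2_eq)
  ultimately have *: "integrable M' (\<lambda>\<omega>. real (Zx s \<omega> i) * real (Zx s \<omega> j))"
    "(\<integral>\<omega>. real (Zx s \<omega> i) * real (Zx s \<omega> j) \<partial>M') =
      enn2real (\<integral>\<^sup>+\<omega>. of_nat (Zx s \<omega> i) * of_nat (Zx s \<omega> j) \<partial>M')"
    by (rule integral_eq_enn2real)+
  show "integrable M' (\<lambda>\<omega>. real (Zx s \<omega> i) * real (Zx s \<omega> j))" by (rule *)
  show "ennreal (\<integral>\<omega>. real (Zx s \<omega> i) * real (Zx s \<omega> j) \<partial>M') = moment2 i j s"
    using fin assms(2) by (simp only: *(2) moment2_eq[symmetric]) simp
qed

text \<open>The summand of the immigration process in a form that is visibly measurable in
  \<open>\<omega>\<close>. Outside the window the indicator is 0, so \<open>eval_path\<close> at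
  negative times has no influence.\<close>

definition contribution :: "'d \<Rightarrow> nat \<Rightarrow> 'a \<Rightarrow> ennreal" where
  "contribution i k \<omega> = of_bool (enat k < \<kappa> \<omega> \<and> atom \<kappa> T k \<omega> \<in> {0<..t}) *
     eval_path i (t - atom \<kappa> T k \<omega>) (path (C k) \<omega>)"

lemma measurable_contribution[measurable]: "contribution i k \<in> borel_measurable M"
proof -
  have "(\<lambda>\<omega>. (t - atom \<kappa> T k \<omega>, path (C k) \<omega>)) \<in> M \<rightarrow>\<^sub>M borel \<Otimes>\<^sub>M path_space"
    using measurable_path[OF jump_C] by measurable
  from measurable_compose[OF this measurable_eval_path[of i]]
  have [measurable]: "(\<lambda>\<omega>. eval_path i (t - atom \<kappa> T k \<omega>) (path (C k) \<omega>)) \<in> borel_measurable M" by simp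
  show ?thesis unfolding contribution_def[abs_def] of_bool_def by measurable
qed

abbreviation (input) immigrants :: "'d \<Rightarrow> 'a \<Rightarrow> ennreal" where
  "immigrants i \<omega> \<equiv> immigration_process \<kappa> T C t \<omega> i"

lemma immigration_process_eq:
  assumes "\<omega> \<in> space M"
  shows "immigrants i \<omega> = (\<integral>\<^sup>+k. contribution i k \<omega> \<partial>count_space UNIV)"
  unfolding immigration_process_def nn_integral_count_space_nat
proof (rule suminf_cong)
  fix k
  show "(if enat k < \<kappa> \<omega> \<and> T k \<omega> \<in> {0<..t} then of_nat (C k (t - T k \<omega>) \<omega> i) else 0) = contribution i k \<omega>"
    using assms by (auto simp: contribution_def atom_def eval_path_eq[OF jump_C])
qed

lemma measurable_immigration_process[measurable]:
  "(\<lambda>\<omega>. immigrants i \<omega>) \<in> borel_measurable M"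
proof -
  have "(\<lambda>\<omega>. \<integral>\<^sup>+k. contribution i k \<omega> \<partial>count_space UNIV) \<in> borel_measurable M"
    by (rule borel_measurable_nn_integral_count_space) auto
  then show ?thesis by (simp cong: measurable_cong add: immigration_process_eq)
qed

text \<open>The same summand as a deterministic function of the atoms and of one path, which is the
  shape that averaging over a copy with frozen atoms requires.\<close>

definition contribution_law :: "'d \<Rightarrow> nat \<Rightarrow> (enat \<times> (nat \<Rightarrow> real)) \<times> (real \<Rightarrow> 'd \<Rightarrow> nat) \<Rightarrow> ennreal" where
  "contribution_law i k x = of_bool (enat k < fst (fst x) \<and> snd (fst x) k \<in> {0<..t}) *
     eval_path i (t - snd (fst x) k) (snd x)"

lemma measurable_contribution_law[measurable]:
  "contribution_law i k \<in> borel_measurable (atom_space \<Otimes>\<^sub>M path_space)"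
proof -
  have "(\<lambda>x. (t - snd (fst x) k, snd x)) \<in> atom_space \<Otimes>\<^sub>M path_space \<rightarrow>\<^sub>M borel \<Otimes>\<^sub>M path_space"
    by measurable
  from measurable_compose[OF this measurable_eval_path[of i]]
  have [measurable]: "(\<lambda>x. eval_path i (t - snd (fst x) k) (snd x)) \<in> borel_measurable (atom_space \<Otimes>\<^sub>M path_space)" by simp
  have [measurable]: "Measurable.pred (atom_space \<Otimes>\<^sub>M path_space) (\<lambda>x. enat k < fst (fst x))"
    by (rule measurable_compose[of "\<lambda>x. fst (fst x)" _ "count_space UNIV"]) auto
  show ?thesis unfolding contribution_law_def[abs_def] of_bool_def by measurable
qed

lemma contribution_eq_law:
  "contribution i k \<omega> = contribution_law i k ((\<kappa> \<omega>, \<lambda>i. atom \<kappa> T i \<omega>), path (C k) \<omega>)"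
  by (simp add: contribution_def contribution_law_def)

lemma measurable_contribution_law_path:
  "(\<lambda>p. contribution_law i k ((n, f), p)) \<in> borel_measurable (path_law M' Zx)"
  unfolding contribution_law_def using measurable_eval_path_at by simp

lemma nn_integral_contribution_law:
  "(\<integral>\<^sup>+p. contribution_law i k ((n, f), p) \<partial>path_law M' Zx) =
    of_bool (enat k < n \<and> f k \<in> {0<..t}) * mean i (t - f k)"
  unfolding contribution_law_def mean_def fst_conv snd_conv
  using measurable_eval_path_at by (subst nn_integral_cmult) auto

lemma nn_integral_contribution_law_square:
  "(\<integral>\<^sup>+p. contribution_law i k ((n, f), p) * contribution_law j k ((n, f), p) \<partial>path_law M' Zx) =
    of_bool (enat k < n \<and> f k \<in> {0<..t}) * moment2 i j (t - f k)"
proof (cases "enat k < n \<and> f k \<in> {0<..t}")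
  case True
  then show ?thesis by (simp add: contribution_law_def moment2_def)
next
  case False
  then have "contribution_law i k ((n, f), p) = 0" for p by (simp only: contribution_law_def fst_conv snd_conv) simp
  moreover have "of_bool (enat k < n \<and> f k \<in> {0<..t}) = (0 :: ennreal)" using False by (simp only: of_bool_eq)
  ultimately show ?thesis by (simp only: mult_zero_left nn_integral_const)
qed

lemma nn_integral_contribution:
  "(\<integral>\<^sup>+\<omega>. contribution i k \<omega> \<partial>M) =
   (\<integral>\<^sup>+\<omega>. of_bool (enat k < \<kappa> \<omega> \<and> atom \<kappa> T k \<omega> \<in> {0<..t}) * mean i (t - atom \<kappa> T k \<omega>) \<partial>M)"
  unfolding contribution_eq_law
    nn_integral_atoms_copy[OF M point_process' iid indep measurable_contribution_law]
    nn_integral_contribution_law ..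

lemma nn_integral_contribution_same:
  "(\<integral>\<^sup>+\<omega>. contribution i k \<omega> * contribution j k \<omega> \<partial>M) =
   (\<integral>\<^sup>+\<omega>. of_bool (enat k < \<kappa> \<omega> \<and> atom \<kappa> T k \<omega> \<in> {0<..t}) * moment2 i j (t - atom \<kappa> T k \<omega>) \<partial>M)"
proof -
  have "(\<lambda>x. contribution_law i k x * contribution_law j k x) \<in> borel_measurable (atom_space \<Otimes>\<^sub>M path_space)"
    by (intro borel_measurable_times_ennreal measurable_contribution_law)
  from nn_integral_atoms_copy[OF M point_process' iid indep this, of k]
  show ?thesis unfolding contribution_eq_law nn_integral_contribution_law_square .
qed

lemma nn_integral_contribution_distinct:
  assumes "k \<noteq> l"
  shows "(\<integral>\<^sup>+\<omega>. contribution i k \<omega> * contribution j l \<omega> \<partial>M) =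
   (\<integral>\<^sup>+\<omega>. of_bool (enat k < \<kappa> \<omega> \<and> atom \<kappa> T k \<omega> \<in> {0<..t}) * mean i (t - atom \<kappa> T k \<omega>) *
     (of_bool (enat l < \<kappa> \<omega> \<and> atom \<kappa> T l \<omega> \<in> {0<..t}) * mean j (t - atom \<kappa> T l \<omega>)) \<partial>M)"
proof -
  let ?F = "\<lambda>x. contribution_law i k (fst x, fst (snd x)) * contribution_law j l (fst x, snd (snd x))"
  have "(\<lambda>x. contribution_law i k (fst x, fst (snd x))) \<in> borel_measurable (atom_space \<Otimes>\<^sub>M (path_space \<Otimes>\<^sub>M path_space))"
    by (rule measurable_compose[OF _ measurable_contribution_law]) measurable
  moreover have "(\<lambda>x. contribution_law j l (fst x, snd (snd x))) \<in> borel_measurable (atom_space \<Otimes>\<^sub>M (path_space \<Otimes>\<^sub>M path_space))"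
    by (rule measurable_compose[OF _ measurable_contribution_law]) measurable
  ultimately have "?F \<in> borel_measurable (atom_space \<Otimes>\<^sub>M (path_space \<Otimes>\<^sub>M path_space))"
    by (rule borel_measurable_times_ennreal)
  from nn_integral_atoms_copies[OF M point_process' iid indep this assms]
  show ?thesis
    unfolding contribution_eq_law fst_conv snd_conv
    by (simp only: nn_integral_cmult nn_integral_multc measurable_contribution_law_path nn_integral_contribution_law)
qed

lemma measurable_shifted:
  "(\<lambda>x. mean i (t - x)) \<in> borel_measurable borel_nonneg"
  "(\<lambda>x. moment2 i j (t - x)) \<in> borel_measurable borel_nonneg"
  by (intro measurable_restrict_space1, measurable)+

lemma window_sets: "{0<..t} \<in> sets borel_nonneg" and window_bounded: "bounded {0<..t}"
  by (auto intro: borel_nonnegI)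

text \<open>Sum and expectation are exchanged twice: outwards, to average over one copy at a time,
  and back, to apply the Campbell formula to the whole point process.\<close>

lemma first_moment:
  "(\<integral>\<^sup>+\<omega>. immigrants i \<omega> \<partial>M) =
   (\<integral>\<^sup>+x. ennreal (K x x) * (indicator {0<..t} x * mean i (t - x)) \<partial>\<Lambda>)"
proof -
  have h: "(\<lambda>x. indicator {0<..t} x * mean i (t - x)) \<in> borel_measurable borel_nonneg"
    by (intro borel_measurable_times_ennreal borel_measurable_indicator window_sets measurable_shifted)
  have "(\<integral>\<^sup>+\<omega>. immigrants i \<omega> \<partial>M) = (\<integral>\<^sup>+\<omega>. \<integral>\<^sup>+k. contribution i k \<omega> \<partial>count_space UNIV \<partial>M)"
    by (rule nn_integral_cong) (rule immigration_process_eq)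
  also have "\<dots> = (\<integral>\<^sup>+k. \<integral>\<^sup>+\<omega>. contribution i k \<omega> \<partial>M \<partial>count_space UNIV)"
    by (rule nn_integral_count_space_commute) (auto intro: M.sigma_finite_measure_axioms)
  also have "\<dots> = (\<integral>\<^sup>+k. \<integral>\<^sup>+\<omega>. of_bool (enat k < \<kappa> \<omega>) * (indicator {0<..t} (atom \<kappa> T k \<omega>) * mean i (t - atom \<kappa> T k \<omega>)) \<partial>M \<partial>count_space UNIV)"
    unfolding nn_integral_contribution
    by (intro nn_integral_cong) (auto simp: indicator_def)
  also have "\<dots> = (\<integral>\<^sup>+\<omega>. \<integral>\<^sup>+k. of_bool (enat k < \<kappa> \<omega>) * (indicator {0<..t} (atom \<kappa> T k \<omega>) * mean i (t - atom \<kappa> T k \<omega>)) \<partial>count_space UNIV \<partial>M)"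
  proof (rule nn_integral_count_space_commute[symmetric])
    fix k
    show "(\<lambda>\<omega>. of_bool (enat k < \<kappa> \<omega>) * (indicator {0<..t} (atom \<kappa> T k \<omega>) * mean i (t - atom \<kappa> T k \<omega>))) \<in> borel_measurable M"
      unfolding of_bool_def by measurable
  qed (auto intro: M.sigma_finite_measure_axioms)
  also have "\<dots> = (\<integral>\<^sup>+x. ennreal (K x x) * (indicator {0<..t} x * mean i (t - x)) \<partial>\<Lambda>)"
    by (rule first_Campbell[OF kernel M process h])
  finally show ?thesis .
qed

text \<open>On the diagonal both factors come from the same copy, which gives \<open>moment2\<close>
  and a first-order Campbell formula. Off the diagonal the copies are independent given the atoms,
  which gives a product of means and a second-order one.\<close>

lemma second_moment:
  "(\<integral>\<^sup>+\<omega>. immigrants i \<omega> * immigrants j \<omega> \<partial>M) =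
   (\<integral>\<^sup>+x. ennreal (K x x) * (indicator {0<..t} x * moment2 i j (t - x)) \<partial>\<Lambda>) +
   (\<integral>\<^sup>+p. ennreal (pair_correlation K p) * indicator ({0<..t} \<times> {0<..t}) p * (mean i (t - fst p) * mean j (t - snd p)) \<partial>(\<Lambda> \<Otimes>\<^sub>M \<Lambda>))"
proof -
  let ?W = "{0<..t}"
  let ?a = "\<lambda>k. atom \<kappa> T k"
  have sf: "sigma_finite_measure M" ..
  have h1: "(\<lambda>x. indicator ?W x * moment2 i j (t - x)) \<in> borel_measurable borel_nonneg"
    by (intro borel_measurable_times_ennreal borel_measurable_indicator window_sets measurable_shifted)
  have h2: "(\<lambda>p. mean i (t - fst p) * mean j (t - snd p)) \<in> borel_measurable (borel_nonneg \<Otimes>\<^sub>M borel_nonneg)"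
    by (intro borel_measurable_times_ennreal measurable_compose[OF measurable_fst] measurable_compose[OF measurable_snd] measurable_shifted)
  have diag: "(\<integral>\<^sup>+\<omega>. contribution i k \<omega> * contribution j k \<omega> \<partial>M) =
      (\<integral>\<^sup>+\<omega>. of_bool (enat k < \<kappa> \<omega>) * (indicator ?W (?a k \<omega>) * moment2 i j (t - ?a k \<omega>)) \<partial>M)" for k
    unfolding nn_integral_contribution_same by (rule nn_integral_cong) (auto simp: indicator_def)
  have off: "of_bool (fst p \<noteq> snd p) * (\<integral>\<^sup>+\<omega>. contribution i (fst p) \<omega> * contribution j (snd p) \<omega> \<partial>M) =
      (\<integral>\<^sup>+\<omega>. of_bool (fst p \<noteq> snd p \<and> enat (fst p) < \<kappa> \<omega> \<and> enat (snd p) < \<kappa> \<omega> \<and> ?a (fst p) \<omega> \<in> ?W \<and> ?a (snd p) \<omega> \<in> ?W) *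
        (mean i (t - ?a (fst p) \<omega>) * mean j (t - ?a (snd p) \<omega>)) \<partial>M)" for p :: "nat \<times> nat"
  proof (cases "fst p = snd p")
    case False
    then show ?thesis
      by (simp add: nn_integral_contribution_distinct) (auto intro!: nn_integral_cong)
  qed simp
  have "(\<integral>\<^sup>+\<omega>. immigrants i \<omega> * immigrants j \<omega> \<partial>M) =
      (\<integral>\<^sup>+\<omega>. \<integral>\<^sup>+p. contribution i (fst p) \<omega> * contribution j (snd p) \<omega> \<partial>count_space UNIV \<partial>M)"
    by (rule nn_integral_cong, subst nn_integral_fst_count_space[symmetric])
       (simp add: immigration_process_eq nn_integral_cmult nn_integral_multc)
  also have "\<dots> = (\<integral>\<^sup>+p. \<integral>\<^sup>+\<omega>. contribution i (fst p) \<omega> * contribution j (snd p) \<omega> \<partial>M \<partial>count_space UNIV)"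
    by (rule nn_integral_count_space_commute[OF sf]) auto
  also have "\<dots> = (\<integral>\<^sup>+p. of_bool (fst p = snd p) * (\<integral>\<^sup>+\<omega>. contribution i (fst p) \<omega> * contribution j (snd p) \<omega> \<partial>M) +
      of_bool (fst p \<noteq> snd p) * (\<integral>\<^sup>+\<omega>. contribution i (fst p) \<omega> * contribution j (snd p) \<omega> \<partial>M) \<partial>count_space UNIV)"
    by (rule nn_integral_cong) auto
  also have "\<dots> = (\<integral>\<^sup>+p. of_bool (fst p = snd p) * (\<integral>\<^sup>+\<omega>. contribution i (fst p) \<omega> * contribution j (snd p) \<omega> \<partial>M) \<partial>count_space UNIV) +
      (\<integral>\<^sup>+p. of_bool (fst p \<noteq> snd p) * (\<integral>\<^sup>+\<omega>. contribution i (fst p) \<omega> * contribution j (snd p) \<omega> \<partial>M) \<partial>count_space UNIV)"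
    by (rule nn_integral_add) auto
  also have "(\<integral>\<^sup>+p. of_bool (fst p = snd p) * (\<integral>\<^sup>+\<omega>. contribution i (fst p) \<omega> * contribution j (snd p) \<omega> \<partial>M) \<partial>count_space UNIV) =
      (\<integral>\<^sup>+x. ennreal (K x x) * (indicator ?W x * moment2 i j (t - x)) \<partial>\<Lambda>)"
  proof -
    have "(\<integral>\<^sup>+p. of_bool (fst p = snd p) * (\<integral>\<^sup>+\<omega>. contribution i (fst p) \<omega> * contribution j (snd p) \<omega> \<partial>M) \<partial>count_space UNIV) =
        (\<integral>\<^sup>+k. \<integral>\<^sup>+\<omega>. of_bool (enat k < \<kappa> \<omega>) * (indicator ?W (?a k \<omega>) * moment2 i j (t - ?a k \<omega>)) \<partial>M \<partial>count_space UNIV)"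
      by (subst nn_integral_diagonal) (simp only: fst_conv snd_conv diag)
    also have "\<dots> = (\<integral>\<^sup>+\<omega>. \<integral>\<^sup>+k. of_bool (enat k < \<kappa> \<omega>) * (indicator ?W (?a k \<omega>) * moment2 i j (t - ?a k \<omega>)) \<partial>count_space UNIV \<partial>M)"
    proof (rule nn_integral_count_space_commute[OF sf, symmetric])
      fix k
      show "(\<lambda>\<omega>. of_bool (enat k < \<kappa> \<omega>) * (indicator ?W (?a k \<omega>) * moment2 i j (t - ?a k \<omega>))) \<in> borel_measurable M"
        unfolding of_bool_def by measurable
    qed auto
    also have "\<dots> = (\<integral>\<^sup>+x. ennreal (K x x) * (indicator ?W x * moment2 i j (t - x)) \<partial>\<Lambda>)"
      by (rule first_Campbell[OF kernel M process h1])
    finally show ?thesis .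
  qed
  also have "(\<integral>\<^sup>+p. of_bool (fst p \<noteq> snd p) * (\<integral>\<^sup>+\<omega>. contribution i (fst p) \<omega> * contribution j (snd p) \<omega> \<partial>M) \<partial>count_space UNIV) =
      (\<integral>\<^sup>+p. ennreal (pair_correlation K p) * indicator (?W \<times> ?W) p * (mean i (t - fst p) * mean j (t - snd p)) \<partial>(\<Lambda> \<Otimes>\<^sub>M \<Lambda>))"
    unfolding off second_Campbell[OF kernel M process window_sets window_bounded h2, symmetric, unfolded fst_conv snd_conv]
  proof (rule nn_integral_count_space_commute[OF sf, symmetric])
    fix p
    show "(\<lambda>\<omega>. of_bool (fst p \<noteq> snd p \<and> enat (fst p) < \<kappa> \<omega> \<and> enat (snd p) < \<kappa> \<omega> \<and> ?a (fst p) \<omega> \<in> ?W \<and> ?a (snd p) \<omega> \<in> ?W) *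
        (mean i (t - ?a (fst p) \<omega>) * mean j (t - ?a (snd p) \<omega>))) \<in> borel_measurable M"
      unfolding of_bool_def by measurable
  qed auto
  finally show ?thesis .
qed


section \<open>Finiteness and the return to real integrals\<close>

lemma measurable_window_mean[measurable]:
  "(\<lambda>x. ennreal (K x x) * (indicator {0<..t} x * mean i (t - x))) \<in> borel_measurable \<Lambda>"
  "(\<lambda>x. ennreal (K x x) * (indicator {0<..t} x * moment2 i j (t - x))) \<in> borel_measurable \<Lambda>"
  unfolding measurable_cong_sets[OF sets_intensity[OF kernel] refl]
  using measurable_kernel_diag[OF kernel]
  by (intro borel_measurable_times_ennreal borel_measurable_indicator window_sets measurable_shifted measurable_compose[OF _ measurable_ennreal], simp)+

lemma nn_integral_window_finite:
  assumes "B < \<infinity>" "\<And>s. s \<in> {0..t} \<Longrightarrow> g s \<le> B"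
  shows "(\<integral>\<^sup>+x. ennreal (K x x) * (indicator {0<..t} x * g (t - x)) \<partial>\<Lambda>) < \<infinity>"
proof -
  have meas: "(\<lambda>x. ennreal (K x x) * indicator {0<..t} x) \<in> borel_measurable \<Lambda>"
    unfolding measurable_cong_sets[OF sets_intensity[OF kernel] refl]
    using measurable_kernel_diag[OF kernel]
    by (intro borel_measurable_times_ennreal borel_measurable_indicator window_sets measurable_compose[OF _ measurable_ennreal])
  have "(\<integral>\<^sup>+x. ennreal (K x x) * (indicator {0<..t} x * g (t - x)) \<partial>\<Lambda>) \<le>
      (\<integral>\<^sup>+x. (ennreal (K x x) * indicator {0<..t} x) * B \<partial>\<Lambda>)"
    using assms(2) by (intro nn_integral_mono) (auto simp: indicator_def intro!: mult_left_mono)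
  also have "\<dots> = (\<integral>\<^sup>+x. ennreal (K x x) * indicator {0<..t} x \<partial>\<Lambda>) * B"
    by (rule nn_integral_multc[OF meas])
  also have "\<dots> < \<infinity>"
    using nn_integral_intensity_finite[OF kernel window_sets window_bounded] assms(1)
    by (simp add: ennreal_mult_less_top)
  finally show ?thesis .
qed

lemma first_moment_finite: "(\<integral>\<^sup>+\<omega>. immigrants i \<omega> \<partial>M) < \<infinity>"
proof -
  obtain B where "B < \<infinity>" "\<forall>s\<in>{0..t}. \<forall>i. mean i s \<le> B" using mean_bounded by blast
  then show ?thesis unfolding first_moment by (intro nn_integral_window_finite) auto
qed

lemma first_moment_formula:
  "(\<integral>\<^sup>+\<omega>. immigrants i \<omega> \<partial>M) =
   (\<integral>\<^sup>+x\<in>{0<..t}. ennreal (K x x) * (\<integral>\<^sup>+\<omega>. of_nat (Zx (t - x) \<omega> i) \<partial>M') \<partial>\<Lambda>)"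
  unfolding first_moment by (rule nn_integral_cong) (auto simp: indicator_def mean_eq)

text \<open>The amount by which the pair integral falls short of its value for a Poisson process
  with the same intensity; it becomes the subtracted term of the covariance.\<close>

definition repulsion :: "'d \<Rightarrow> 'd \<Rightarrow> ennreal" where
  "repulsion i j = (\<integral>\<^sup>+p. ennreal ((K (fst p) (snd p))\<^sup>2) * indicator ({0<..t} \<times> {0<..t}) p *
      (mean i (t - fst p) * mean j (t - snd p)) \<partial>(\<Lambda> \<Otimes>\<^sub>M \<Lambda>))"

lemma measurable_pair_window:
  assumes "f \<in> borel_measurable (borel_nonneg \<Otimes>\<^sub>M borel_nonneg)"
  shows "(\<lambda>p. ennreal (f p) * indicator ({0<..t} \<times> {0<..t}) p * (mean i (t - fst p) * mean j (t - snd p)))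
    \<in> borel_measurable (\<Lambda> \<Otimes>\<^sub>M \<Lambda>)"
  unfolding measurable_cong_sets[OF sets_intensity_pair[OF kernel] refl]
  by (intro borel_measurable_times_ennreal borel_measurable_indicator pair_measureI window_sets
      measurable_compose[OF assms measurable_ennreal]
      measurable_compose[OF measurable_fst] measurable_compose[OF measurable_snd] measurable_shifted)

lemma measurable_kernel_square:
  "(\<lambda>p. (K (fst p) (snd p))\<^sup>2) \<in> borel_measurable (borel_nonneg \<Otimes>\<^sub>M borel_nonneg)"
  using measurable_kernel[OF kernel] by (rule borel_measurable_power)

text \<open>Adding the square of the kernel to the pair correlation leaves the product of the
  diagonal values, and the double integral factorizes into the two means. \<open>ennreal\<close> is
  additive here only because the pair correlation is nonnegative almost everywhere, which is where
  non-negative definiteness enters.\<close>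

lemma pair_correlation_plus_repulsion:
  "(\<integral>\<^sup>+p. ennreal (pair_correlation K p) * indicator ({0<..t} \<times> {0<..t}) p * (mean i (t - fst p) * mean j (t - snd p)) \<partial>(\<Lambda> \<Otimes>\<^sub>M \<Lambda>)) +
   repulsion i j =
   (\<integral>\<^sup>+\<omega>. immigrants i \<omega> \<partial>M) * (\<integral>\<^sup>+\<omega>. immigrants j \<omega> \<partial>M)"
proof -
  let ?W = "{0<..t}"
  let ?G = "\<lambda>i x. ennreal (K x x) * (indicator ?W x * mean i (t - x))"
  let ?m = "\<lambda>p. mean i (t - fst p) * mean j (t - snd p)"
  have "(\<integral>\<^sup>+p. ennreal (pair_correlation K p) * indicator (?W \<times> ?W) p * ?m p \<partial>(\<Lambda> \<Otimes>\<^sub>M \<Lambda>)) + repulsion i j =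
      (\<integral>\<^sup>+p. ennreal (pair_correlation K p) * indicator (?W \<times> ?W) p * ?m p +
         ennreal ((K (fst p) (snd p))\<^sup>2) * indicator (?W \<times> ?W) p * ?m p \<partial>(\<Lambda> \<Otimes>\<^sub>M \<Lambda>))"
    unfolding repulsion_def
    by (intro nn_integral_add[symmetric] measurable_pair_window measurable_kernel_square measurable_pair_correlation[OF kernel])
  also have "\<dots> = (\<integral>\<^sup>+p. ?G i (fst p) * ?G j (snd p) \<partial>(\<Lambda> \<Otimes>\<^sub>M \<Lambda>))"
  proof (rule nn_integral_cong_AE)
    have "AE p in \<Lambda> \<Otimes>\<^sub>M \<Lambda>. p \<in> space (\<Lambda> \<Otimes>\<^sub>M \<Lambda>)" by (rule AE_space)
    with AE_pair_correlation_nonneg[OF kernel]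
    show "AE p in \<Lambda> \<Otimes>\<^sub>M \<Lambda>. ennreal (pair_correlation K p) * indicator (?W \<times> ?W) p * ?m p +
         ennreal ((K (fst p) (snd p))\<^sup>2) * indicator (?W \<times> ?W) p * ?m p = ?G i (fst p) * ?G j (snd p)"
    proof eventually_elim
      case (elim p)
      have "0 \<le> fst p" "0 \<le> snd p"
        using elim(2) by (auto simp: space_pair_measure space_intensity[OF kernel])
      then have "0 \<le> K (fst p) (fst p)" "0 \<le> K (snd p) (snd p)"
        by (auto intro: kernel_nonneg[OF kernel])
      then have "ennreal (K (fst p) (fst p)) * ennreal (K (snd p) (snd p)) =
          ennreal (K (fst p) (fst p) * K (snd p) (snd p))" by (simp only: ennreal_mult)
      also have "\<dots> = ennreal (pair_correlation K p + (K (fst p) (snd p))\<^sup>2)" by (simp add: pair_correlation_def)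
      also have "\<dots> = ennreal (pair_correlation K p) + ennreal ((K (fst p) (snd p))\<^sup>2)"
        using elim(1) by (rule ennreal_plus) simp
      finally have K: "ennreal (pair_correlation K p) + ennreal ((K (fst p) (snd p))\<^sup>2) =
          ennreal (K (fst p) (fst p)) * ennreal (K (snd p) (snd p))" by simp
      show ?case
      proof (cases "fst p \<in> ?W \<and> snd p \<in> ?W")
        case True
        then have "p \<in> ?W \<times> ?W" by (cases p) auto
        then have "ennreal (pair_correlation K p) * indicator (?W \<times> ?W) p * ?m p +
         ennreal ((K (fst p) (snd p))\<^sup>2) * indicator (?W \<times> ?W) p * ?m p =
          (ennreal (pair_correlation K p) + ennreal ((K (fst p) (snd p))\<^sup>2)) * ?m p"
          by (simp add: distrib_right)
        also have "\<dots> = ?G i (fst p) * ?G j (snd p)" unfolding K using True by (simp add: mult_ac)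
        finally show ?thesis .
      next
        case False
        then have "p \<notin> ?W \<times> ?W" by (cases p) auto
        then have "indicator (?W \<times> ?W) p = (0 :: ennreal)" by (rule indicator_simps(2))
        moreover have "indicator ?W (fst p) = (0 :: ennreal) \<or> indicator ?W (snd p) = (0 :: ennreal)"
          using False by (metis indicator_simps(2))
        ultimately show ?thesis by (elim disjE) (simp_all only: mult_zero_left mult_zero_right add_0)
      qed
    qed
  qed
  also have "\<dots> = (\<integral>\<^sup>+x. \<integral>\<^sup>+y. ?G i x * ?G j y \<partial>\<Lambda> \<partial>\<Lambda>)"
  proof -
    have "(\<lambda>p. ?G i (fst p) * ?G j (snd p)) \<in> borel_measurable (\<Lambda> \<Otimes>\<^sub>M \<Lambda>)"
      by (intro borel_measurable_times_ennreal measurable_compose[OF measurable_fst measurable_window_mean(1)]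
          measurable_compose[OF measurable_snd measurable_window_mean(1)])
    from \<Lambda>.nn_integral_fst[OF this] show ?thesis by (simp only: fst_conv snd_conv)
  qed
  also have "\<dots> = (\<integral>\<^sup>+x. ?G i x \<partial>\<Lambda>) * (\<integral>\<^sup>+x. ?G j x \<partial>\<Lambda>)"
    by (simp only: nn_integral_cmult[OF measurable_window_mean(1)] nn_integral_multc[OF measurable_window_mean(1)])
  finally show ?thesis by (simp only: first_moment)
qed

text \<open>Both terms of the preceding sum are nonnegative, so the product of the means bounds each
  of them; first moments suffice.\<close>

lemma repulsion_finite: "repulsion i j < \<infinity>"
proof -
  have "repulsion i j \<le> (\<integral>\<^sup>+\<omega>. immigrants i \<omega> \<partial>M) * (\<integral>\<^sup>+\<omega>. immigrants j \<omega> \<partial>M)"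
    unfolding pair_correlation_plus_repulsion[symmetric] by simp
  also have "\<dots> < \<infinity>" using first_moment_finite by (simp add: ennreal_mult_less_top)
  finally show ?thesis .
qed

lemma set_integral_repulsion:
  fixes i j :: 'd
  defines "f \<equiv> \<lambda>(x, y). (K x y)\<^sup>2 * (\<integral>\<omega>. real (Zx (t - x) \<omega> i) \<partial>M') * (\<integral>\<omega>. real (Zx (t - y) \<omega> j) \<partial>M')"
  shows "set_integrable (\<Lambda> \<Otimes>\<^sub>M \<Lambda>) ({0<..t} \<times> {0<..t}) f"
    and "set_lebesgue_integral (\<Lambda> \<Otimes>\<^sub>M \<Lambda>) ({0<..t} \<times> {0<..t}) f = enn2real (repulsion i j)"
proof -
  let ?G = "\<lambda>p. ennreal ((K (fst p) (snd p))\<^sup>2) * indicator ({0<..t} \<times> {0<..t}) p * (mean i (t - fst p) * mean j (t - snd p))"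
  have "0 \<le> indicator ({0<..t} \<times> {0<..t}) p *\<^sub>R f p \<and> ennreal (indicator ({0<..t} \<times> {0<..t}) p *\<^sub>R f p) = ?G p" for p
  proof (cases "p \<in> {0<..t} \<times> {0<..t}")
    case True
    then have "t - fst p \<in> {0..t}" "t - snd p \<in> {0..t}" by auto
    note m = integral_Zx[OF this(1), of i] integral_Zx[OF this(2), of j]
    have "0 \<le> (\<integral>\<omega>. real (Zx (t - fst p) \<omega> i) \<partial>M')" "0 \<le> (\<integral>\<omega>. real (Zx (t - snd p) \<omega> j) \<partial>M')"
      by (auto intro: Bochner_Integration.integral_nonneg)
    then show ?thesis
      using True by (simp add: f_def split_beta' m[symmetric] ennreal_mult mult.assoc)
  qed simp
  note nonneg = this
  have meas: "?G \<in> borel_measurable (\<Lambda> \<Otimes>\<^sub>M \<Lambda>)"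
    by (rule measurable_pair_window[OF measurable_kernel_square])
  have "(\<integral>\<^sup>+p. ?G p \<partial>(\<Lambda> \<Otimes>\<^sub>M \<Lambda>)) < \<infinity>"
    using repulsion_finite[of i j] unfolding repulsion_def .
  from integral_eq_enn2real'[OF meas nonneg this]
  show "set_integrable (\<Lambda> \<Otimes>\<^sub>M \<Lambda>) ({0<..t} \<times> {0<..t}) f"
    and "set_lebesgue_integral (\<Lambda> \<Otimes>\<^sub>M \<Lambda>) ({0<..t} \<times> {0<..t}) f = enn2real (repulsion i j)"
    unfolding set_integrable_def set_lebesgue_integral_def repulsion_def by auto
qed

lemma immigration_process_AE_finite: "AE \<omega> in M. immigrants i \<omega> < \<infinity>"
  using nn_integral_noteq_infinite[OF measurable_immigration_process] first_moment_finite
  by (auto simp: less_top)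

lemma integrable_immigration:
  "integrable M (\<lambda>\<omega>. enn2real (immigrants i \<omega>))"
  "(\<integral>\<omega>. enn2real (immigrants i \<omega>) \<partial>M) = enn2real (\<integral>\<^sup>+\<omega>. immigrants i \<omega> \<partial>M)"
proof -
  have "AE \<omega> in M. 0 \<le> enn2real (immigrants i \<omega>) \<and>
      ennreal (enn2real (immigrants i \<omega>)) = immigrants i \<omega>"
    using immigration_process_AE_finite[of i] by eventually_elim simp
  from integral_eq_enn2real[OF _ this first_moment_finite]
  show "integrable M (\<lambda>\<omega>. enn2real (immigrants i \<omega>))"
    "(\<integral>\<omega>. enn2real (immigrants i \<omega>) \<partial>M) = enn2real (\<integral>\<^sup>+\<omega>. immigrants i \<omega> \<partial>M)"
    by auto
qed

section \<open>Covariance under finite second moments\<close>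

context
  assumes moments: "finite_second_moments I \<nu>"
begin

lemma diagonal_finite:
  "(\<integral>\<^sup>+x. ennreal (K x x) * (indicator {0<..t} x * moment2 i j (t - x)) \<partial>\<Lambda>) < \<infinity>"
proof -
  obtain B where "B < \<infinity>" "\<forall>s\<in>{0..t}. \<forall>i j. moment2 i j s \<le> B" using moment2_bounded[OF moments] by blast
  then show ?thesis by (intro nn_integral_window_finite) auto
qed

lemma set_integral_diagonal:
  fixes i j :: 'd
  defines "f \<equiv> \<lambda>x. K x x * (\<integral>\<omega>. real (Zx (t - x) \<omega> i) * real (Zx (t - x) \<omega> j) \<partial>M')"
  shows "set_integrable \<Lambda> {0<..t} f"
    and "set_lebesgue_integral \<Lambda> {0<..t} f =
      enn2real (\<integral>\<^sup>+x. ennreal (K x x) * (indicator {0<..t} x * moment2 i j (t - x)) \<partial>\<Lambda>)"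
proof -
  let ?G = "\<lambda>x. ennreal (K x x) * (indicator {0<..t} x * moment2 i j (t - x))"
  have "0 \<le> indicator {0<..t} x *\<^sub>R f x \<and> ennreal (indicator {0<..t} x *\<^sub>R f x) = ?G x" for x
  proof (cases "x \<in> {0<..t}")
    case True
    then have "0 \<le> t - x" "0 \<le> K x x" by (auto intro: kernel_nonneg[OF kernel])
    moreover have "0 \<le> (\<integral>\<omega>. real (Zx (t - x) \<omega> i) * real (Zx (t - x) \<omega> j) \<partial>M')"
      by (intro Bochner_Integration.integral_nonneg) simp
    ultimately show ?thesis
      using True by (simp add: f_def Zx_second_moment(2)[OF moments, symmetric] ennreal_mult)
  qed simp
  from integral_eq_enn2real'[OF measurable_window_mean(2) this diagonal_finite]
  show "set_integrable \<Lambda> {0<..t} f"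
    and "set_lebesgue_integral \<Lambda> {0<..t} f =
      enn2real (\<integral>\<^sup>+x. ennreal (K x x) * (indicator {0<..t} x * moment2 i j (t - x)) \<partial>\<Lambda>)"
    unfolding set_integrable_def set_lebesgue_integral_def by auto
qed

lemma second_moment_finite:
  "(\<integral>\<^sup>+\<omega>. immigrants i \<omega> * immigrants j \<omega> \<partial>M) < \<infinity>"
proof -
  let ?R = "\<integral>\<^sup>+p. ennreal (pair_correlation K p) * indicator ({0<..t} \<times> {0<..t}) p * (mean i (t - fst p) * mean j (t - snd p)) \<partial>(\<Lambda> \<Otimes>\<^sub>M \<Lambda>)"
  have "?R \<le> ?R + repulsion i j" by simp
  also have "\<dots> < \<infinity>"
    unfolding pair_correlation_plus_repulsion using first_moment_finite by (simp add: ennreal_mult_less_top)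
  finally show ?thesis unfolding second_moment using diagonal_finite[of i j] by simp
qed

lemma integrable_immigration_product:
  "integrable M (\<lambda>\<omega>. enn2real (immigrants i \<omega>) * enn2real (immigrants j \<omega>))"
  "(\<integral>\<omega>. enn2real (immigrants i \<omega>) * enn2real (immigrants j \<omega>) \<partial>M) =
    enn2real (\<integral>\<^sup>+\<omega>. immigrants i \<omega> * immigrants j \<omega> \<partial>M)"
proof -
  have "AE \<omega> in M. 0 \<le> enn2real (immigrants i \<omega>) * enn2real (immigrants j \<omega>) \<and>
      ennreal (enn2real (immigrants i \<omega>) * enn2real (immigrants j \<omega>)) =
      immigrants i \<omega> * immigrants j \<omega>"
    using immigration_process_AE_finite[of i] immigration_process_AE_finite[of j]
    by eventually_elim (simp add: ennreal_mult)
  from integral_eq_enn2real[OF _ this second_moment_finite]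
  show "integrable M (\<lambda>\<omega>. enn2real (immigrants i \<omega>) * enn2real (immigrants j \<omega>))"
    "(\<integral>\<omega>. enn2real (immigrants i \<omega>) * enn2real (immigrants j \<omega>) \<partial>M) =
    enn2real (\<integral>\<^sup>+\<omega>. immigrants i \<omega> * immigrants j \<omega> \<partial>M)"
    by auto
qed

lemma covariance_formula:
  "covariance M (\<lambda>\<omega>. enn2real (immigrants i \<omega>)) (\<lambda>\<omega>. enn2real (immigrants j \<omega>)) =
    (LINT x:{0<..t}|\<Lambda>. K x x * (\<integral>\<omega>. real (Zx (t - x) \<omega> i) * real (Zx (t - x) \<omega> j) \<partial>M')) -
    (LINT (x, y):{0<..t} \<times> {0<..t}|\<Lambda> \<Otimes>\<^sub>M \<Lambda>.
       (K x y)\<^sup>2 * (\<integral>\<omega>. real (Zx (t - x) \<omega> i) \<partial>M') * (\<integral>\<omega>. real (Zx (t - y) \<omega> j) \<partial>M'))"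
proof -
  define X where "X i \<omega> = enn2real (immigrants i \<omega>)" for i \<omega>
  let ?e = "\<lambda>i. \<integral>\<^sup>+\<omega>. immigrants i \<omega> \<partial>M"
  let ?A = "\<integral>\<^sup>+x. ennreal (K x x) * (indicator {0<..t} x * moment2 i j (t - x)) \<partial>\<Lambda>"
  let ?R = "\<integral>\<^sup>+p. ennreal (pair_correlation K p) * indicator ({0<..t} \<times> {0<..t}) p * (mean i (t - fst p) * mean j (t - snd p)) \<partial>(\<Lambda> \<Otimes>\<^sub>M \<Lambda>)"
  have X[simp]: "integrable M (X i)" "integral\<^sup>L M (X i) = enn2real (?e i)" for i
    using integrable_immigration unfolding X_def by auto
  have XX: "integrable M (\<lambda>\<omega>. X i \<omega> * X j \<omega>)" "(\<integral>\<omega>. X i \<omega> * X j \<omega> \<partial>M) = enn2real (?A + ?R)"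
    using integrable_immigration_product unfolding X_def second_moment by auto
  have sum: "?R + repulsion i j = ?e i * ?e j" by (rule pair_correlation_plus_repulsion)
  also have "\<dots> < \<infinity>" using first_moment_finite by (simp add: ennreal_mult_less_top)
  finally have "?R < \<infinity>" by (simp add: less_top)
  have "(X i \<omega> - a) * (X j \<omega> - b) = X i \<omega> * X j \<omega> - b * X i \<omega> - a * X j \<omega> + a * b" for a b \<omega>
    by (simp add: algebra_simps)
  then have "covariance M (X i) (X j) =
      (\<integral>\<omega>. X i \<omega> * X j \<omega> - enn2real (?e j) * X i \<omega> - enn2real (?e i) * X j \<omega> + enn2real (?e i) * enn2real (?e j) \<partial>M)"
    by (simp only: covariance_def X)
  also have "\<dots> = enn2real (?A + ?R) - enn2real (?e i) * enn2real (?e j)"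
    using XX by (simp add: M.prob_space)
  \<comment> \<open>\<open>enn2real\<close> is additive on finite values only. The pair term
    \<open>?R\<close> then occurs in the second moment and in the product of the means and cancels,
    so that the diagonal term minus the repulsion is left.\<close>
  also have "enn2real (?A + ?R) = enn2real ?A + enn2real ?R"
    using diagonal_finite[of i j] \<open>?R < \<infinity>\<close> by (intro enn2real_plus) auto
  also have "enn2real (?e i) * enn2real (?e j) = enn2real ?R + enn2real (repulsion i j)"
    unfolding enn2real_mult[symmetric] sum[symmetric]
    using repulsion_finite[of i j] \<open>?R < \<infinity>\<close> by (intro enn2real_plus) auto
  finally show ?thesis
    unfolding set_integral_diagonal(2) set_integral_repulsion(2) X_def by simp
qed

end

end

text \<open>The integrability clauses belong to the claim: a Bochner integral of a function that is
  not integrable is 0 by convention, and the identity for the covariance alone would say less. For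
  the same reason the mean is stated in \<open>[0, \<infinity>]\<close> together with its
  finiteness.\<close>

theorem theorem5p1:
  fixes \<mu> :: "'d::finite \<Rightarrow> real"
    and I :: "('d \<Rightarrow> nat) pmf"
    and \<nu> :: "'d \<Rightarrow> ('d \<Rightarrow> nat) pmf"
    and M' :: "'b measure"
    and Zx :: "real \<Rightarrow> 'b \<Rightarrow> 'd \<Rightarrow> nat"
    and \<Lambda> :: "real measure"
    and K :: "real \<Rightarrow> real \<Rightarrow> real"
    and M :: "'a measure"
    and \<kappa> :: "'a \<Rightarrow> enat"
    and T :: "nat \<Rightarrow> 'a \<Rightarrow> real"
    and C :: "nat \<Rightarrow> real \<Rightarrow> 'a \<Rightarrow> 'd \<Rightarrow> nat"
    and t :: real
    and i j :: 'd
  defines "Z \<equiv> immigration_process \<kappa> T C"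
  assumes "branching_parameters \<mu> I \<nu>"
    and "prob_space M'"
    and "branching_process \<mu> I \<nu> M' Zx"
    and "determinantal_kernel \<Lambda> K"
    and "prob_space M"
    and "determinantal_process \<Lambda> K M \<kappa> T"
    and "iid_copies M' Zx M C"
    and "independent_of_atoms M \<kappa> T C"
    and "0 \<le> t"
  shows
    "((\<integral>\<^sup>+\<omega>. Z t \<omega> i \<partial>M) =
        (\<integral>\<^sup>+x\<in>{0<..t}. ennreal (K x x) * (\<integral>\<^sup>+\<omega>. of_nat (Zx (t - x) \<omega> i) \<partial>M') \<partial>\<Lambda>) \<and>
      (\<integral>\<^sup>+\<omega>. Z t \<omega> i \<partial>M) < \<infinity>) \<and>
     (finite_second_moments I \<nu> \<longrightarrow>
        integrable M (\<lambda>\<omega>. (enn2real (Z t \<omega> i))\<^sup>2) \<and>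
        integrable M (\<lambda>\<omega>. (enn2real (Z t \<omega> j))\<^sup>2) \<and>
        (\<forall>s\<ge>0. \<forall>k. integrable M' (\<lambda>\<omega>. (real (Zx s \<omega> k))\<^sup>2)) \<and>
        set_integrable \<Lambda> {0<..t}
          (\<lambda>x. K x x * (\<integral>\<omega>. real (Zx (t - x) \<omega> i) * real (Zx (t - x) \<omega> j) \<partial>M')) \<and>
        set_integrable (\<Lambda> \<Otimes>\<^sub>M \<Lambda>) ({0<..t} \<times> {0<..t})
          (\<lambda>(x, y). (K x y)\<^sup>2 * (\<integral>\<omega>. real (Zx (t - x) \<omega> i) \<partial>M') *
                               (\<integral>\<omega>. real (Zx (t - y) \<omega> j) \<partial>M')) \<and>
        covariance M (\<lambda>\<omega>. enn2real (Z t \<omega> i)) (\<lambda>\<omega>. enn2real (Z t \<omega> j)) =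
          (LINT x:{0<..t}|\<Lambda>.
             K x x * (\<integral>\<omega>. real (Zx (t - x) \<omega> i) * real (Zx (t - x) \<omega> j) \<partial>M')) -
          (LINT (x, y):{0<..t} \<times> {0<..t}|\<Lambda> \<Otimes>\<^sub>M \<Lambda>.
             (K x y)\<^sup>2 * (\<integral>\<omega>. real (Zx (t - x) \<omega> i) \<partial>M') * (\<integral>\<omega>. real (Zx (t - y) \<omega> j) \<partial>M')))"
  unfolding Z_def
proof (intro conjI impI allI)
  note assms = assms(2-10)
  show "(\<integral>\<^sup>+\<omega>. immigration_process \<kappa> T C t \<omega> i \<partial>M) =
      (\<integral>\<^sup>+x\<in>{0<..t}. ennreal (K x x) * (\<integral>\<^sup>+\<omega>. of_nat (Zx (t - x) \<omega> i) \<partial>M') \<partial>\<Lambda>)"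
    using assms by (intro first_moment_formula)
  show "(\<integral>\<^sup>+\<omega>. immigration_process \<kappa> T C t \<omega> i \<partial>M) < \<infinity>"
    using assms by (intro first_moment_finite)
  assume fin: "finite_second_moments I \<nu>"
  have "integrable M (\<lambda>\<omega>. enn2real (immigration_process \<kappa> T C t \<omega> k) * enn2real (immigration_process \<kappa> T C t \<omega> k))" for k
    using assms fin by (intro integrable_immigration_product)
  then show "integrable M (\<lambda>\<omega>. (enn2real (immigration_process \<kappa> T C t \<omega> i))\<^sup>2)"
    "integrable M (\<lambda>\<omega>. (enn2real (immigration_process \<kappa> T C t \<omega> j))\<^sup>2)"
    by (simp_all add: power2_eq_square)
  show "integrable M' (\<lambda>\<omega>. (real (Zx s \<omega> k))\<^sup>2)" if "0 \<le> s" for s k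
    using Zx_second_moment(1)[OF assms(1-8) fin that, of k k] by (simp add: power2_eq_square)
  show "set_integrable \<Lambda> {0<..t} (\<lambda>x. K x x * (\<integral>\<omega>. real (Zx (t - x) \<omega> i) * real (Zx (t - x) \<omega> j) \<partial>M'))"
    using assms fin by (intro set_integral_diagonal(1))
  show "set_integrable (\<Lambda> \<Otimes>\<^sub>M \<Lambda>) ({0<..t} \<times> {0<..t})
      (\<lambda>(x, y). (K x y)\<^sup>2 * (\<integral>\<omega>. real (Zx (t - x) \<omega> i) \<partial>M') * (\<integral>\<omega>. real (Zx (t - y) \<omega> j) \<partial>M'))"
    using assms by (intro set_integral_repulsion(1))
  show "covariance M (\<lambda>\<omega>. enn2real (immigration_process \<kappa> T C t \<omega> i)) (\<lambda>\<omega>. enn2real (immigration_process \<kappa> T C t \<omega> j)) =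
      (LINT x:{0<..t}|\<Lambda>. K x x * (\<integral>\<omega>. real (Zx (t - x) \<omega> i) * real (Zx (t - x) \<omega> j) \<partial>M')) -
      (LINT (x, y):{0<..t} \<times> {0<..t}|\<Lambda> \<Otimes>\<^sub>M \<Lambda>.
         (K x y)\<^sup>2 * (\<integral>\<omega>. real (Zx (t - x) \<omega> i) \<partial>M') * (\<integral>\<omega>. real (Zx (t - y) \<omega> j) \<partial>M'))"
    using assms fin by (intro covariance_formula)
qed

end
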